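(* For any $m\in \mathbb N$, $r\in \mathbb Z$ and any positive integer $n$, \[ \sum_{j=1}^{t_m} \delta_j \cdot \rho_{v_j}(n,r) = \begin{cases} 96 \left( \sum_{\substack{ d>0,\; d\text{ odd} \\ d\mid n,\ d\mid r,\ d\mid m}} dH^{(2)}\Big(\frac{4(nm-r^2)}{d^2}\Big)+2\sum_{\substack{ d>0,\; d\text{ odd} \\ d\mid n,\ d\mid r,\ d\mid m}}dH^{(2)}\Big(\frac{nm-r^2}{d^2}\Big) \right),& \text{if } 2\mid n \text{ and } 2\mid m, \\ 96\sum_{\substack{ d>0,\; d\text{ odd} \\ d\mid n,\ d\mid r,\ d\mid m}} dH^{(2)}\Big(\frac{4(nm-r^2)}{d^2}\Big), & \text{otherwise}. \end{cases} \] (The left-hand side equals $\rho(n,r,m)=\#\{u,v\in\mathbb Z^4:\langle u,u\rangle=n,\ \langle v,v\rangle=m,\ \langle u,v\rangle=r\}$.)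
   Context: $\mathbb N=\{0,1,2,\dots\}$. For $u=(x_1,\dots,x_4),v=(y_1,\dots,y_4)\in\mathbb Z^4$, $\langle u,v\rangle=\sum_i x_iy_i$. $\mathrm{O}(\mathbb Z^4)$ is the group (of order $384$) generated by all coordinate permutations and sign changes acting on $\mathbb Z^4$. For $m\in\mathbb N$, $\mathcal S_m=\{v\in\mathbb Z^4:\langle v,v\rangle=m\}$. For $v=(a,b,c,d)\in\mathcal S_m$, $r\in\mathbb Z$ and a positive integer $n$, $\rho_v(n,r)=\#\{(x,y,z,w)\in\mathbb Z^4: x^2+y^2+z^2+w^2=n,\ ax+by+cz+dw=r\}$; it depends only on the $\mathrm{O}(\mathbb Z^4)$-orbit of $v$. The orbits of $\mathrm{O}(\mathbb Z^4)$ on $\mathcal S_m$ are $\mathrm{O}(\mathbb Z^4)\cdot v_j$, $1\leq j\leq t_m$, and $\delta_j$ is the cardinality of the $j$-th orbit. $H(D)$ is the Hurwitz class number: $H(0)=-1/12$; for $D>0$, $H(D)$ is the number of $\mathrm{SL}_2(\mathbb Z)$-classes of positive definite integral binary quadratic forms of discriminant $-D$, weighted by $1/2$ for the class of $a(x^2+y^2)$ and $1/3$ for the class of $a(x^2+xy+y^2)$; $H(D)=0$ if $D<0$ or $D\equiv1,2\pmod 4$. $H^{(2)}(D)=H(4D)-2H(D)$ if $D\equiv 0,3\pmod 4$, and $H^{(2)}(D)=0$ otherwise (in particular $H^{(2)}(D)=0$ for $D<0$). *)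

theory Defs
  imports
    "HOL-Analysis.Finite_Cartesian_Product"
    "HOL-Library.Numeral_Type"
    "HOL-Algebra.Group_Action"
    "HOL-Algebra.Generated_Groups"
begin

section \<open>The lattice of integer 4-vectors\<close>

text \<open>The library inner product is confined to real vector spaces, hence a separate pairing.\<close>

definition ip :: "int ^ 4 \<Rightarrow> int ^ 4 \<Rightarrow> int" where
  "ip u v = (\<Sum>i\<in>UNIV. u $ i * v $ i)"

definition coord_perms :: "(int ^ 4 \<Rightarrow> int ^ 4) set" where
  "coord_perms = {\<lambda>v. (\<chi> i. v $ \<pi> i) | \<pi> :: 4 \<Rightarrow> 4. bij \<pi>}"

definition sign_changes :: "(int ^ 4 \<Rightarrow> int ^ 4) set" where
  "sign_changes = {\<lambda>v. (\<chi> i. \<epsilon> i * v $ i) | \<epsilon> :: 4 \<Rightarrow> int. \<forall>i. \<epsilon> i \<in> {1, -1}}"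

definition OZ4 :: "(int ^ 4 \<Rightarrow> int ^ 4) monoid" where
  "OZ4 = (BijGroup UNIV)
     \<lparr>carrier := generate (BijGroup UNIV) (coord_perms \<union> sign_changes)\<rparr>"

definition S :: "nat \<Rightarrow> (int ^ 4) set" where
  "S m = {v. ip v v = int m}"

abbreviation OZ4_orbit :: "int ^ 4 \<Rightarrow> (int ^ 4) set" where
  "OZ4_orbit v \<equiv> orbit OZ4 (\<lambda>g. g) v"

abbreviation OZ4_orbits :: "nat \<Rightarrow> (int ^ 4) set set" where
  "OZ4_orbits m \<equiv> orbits OZ4 (S m) (\<lambda>g. g)"

definition rho :: "int ^ 4 \<Rightarrow> nat \<Rightarrow> int \<Rightarrow> nat" where
  "rho v n r = card {w. ip w w = int n \<and> ip v w = r}"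

section \<open>Hurwitz class numbers\<close>

text \<open>The triple \<open>(a, b, c)\<close> stands for the form \<open>a x^2 + b x y + c y^2\<close>; forms are not required
  to be primitive.\<close>

type_synonym qform = "int \<times> int \<times> int"

definition qf_eval :: "qform \<Rightarrow> int \<Rightarrow> int \<Rightarrow> int" where
  "qf_eval f x y = (case f of (a, b, c) \<Rightarrow> a * x ^ 2 + b * x * y + c * y ^ 2)"

definition qf_disc :: "qform \<Rightarrow> int" where
  "qf_disc f = (case f of (a, b, c) \<Rightarrow> b ^ 2 - 4 * a * c)"

definition qf_pos_def :: "qform \<Rightarrow> bool" where
  "qf_pos_def f \<longleftrightarrow> (\<forall>x y. (x, y) \<noteq> (0, 0) \<longrightarrow> qf_eval f x y > 0)"

definition qforms :: "int \<Rightarrow> qform set" where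
  "qforms D = {f. qf_pos_def f \<and> qf_disc f = - D}"

text \<open>A form is determined by its values on integer pairs, so the substitution by a matrix
  with rows \<open>(p, q)\<close> and \<open>(s, t)\<close> can be expressed through evaluation.\<close>

definition qf_SL2_rel :: "int \<Rightarrow> (qform \<times> qform) set" where
  "qf_SL2_rel D = {(f, g). f \<in> qforms D \<and> g \<in> qforms D \<and>
     (\<exists>p q s t. p * t - q * s = 1 \<and>
        (\<forall>x y. qf_eval g x y = qf_eval f (p * x + q * y) (s * x + t * y)))}"

definition class_weight :: "qform set \<Rightarrow> rat" where
  "class_weight C =
     (if \<exists>a. (a, 0, a) \<in> C then 1 / 2
      else if \<exists>a. (a, a, a) \<in> C then 1 / 3
      else 1)"

definition H :: "int \<Rightarrow> rat" where
  "H D =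
     (if D = 0 then - 1 / 12
      else if D < 0 \<or> D mod 4 \<in> {1, 2} then 0
      else (\<Sum>C \<in> qforms D // qf_SL2_rel D. class_weight C))"

definition H2 :: "int \<Rightarrow> rat" where
  "H2 D = (if D mod 4 \<in> {0, 3} then H (4 * D) - 2 * H D else 0)"

definition odd_divs :: "nat \<Rightarrow> int \<Rightarrow> nat \<Rightarrow> nat set" where
  "odd_divs n r m = {d. d > 0 \<and> odd d \<and> d dvd n \<and> int d dvd r \<and> d dvd m}"

end

theory Submission
  imports Defs "HOL-Library.Groups_Big_Fun" "HOL-Computational_Algebra.Primes"
    "HOL-Number_Theory.Cong" "HOL-Analysis.Cartesian_Space"
begin

text \<open>
  Write \<open>r\<^sub>3(N)\<close> for the number of representations of \<open>N\<close> as a sum of three squares. The theorem is the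
  conjunction of two facts.

  First, with \<open>u, w\<close> read as quaternions, a pair with Gram matrix \<open>(n, r; r, m)\<close> is a factorization
  \<open>u \<cdot> conj w\<close> of a quaternion with real part \<open>r\<close> and norm \<open>n m\<close>. In the Hurwitz order, where right
  ideals are principal, a given \<open>x\<close> of norm \<open>n m\<close> has \<open>24 \<Sum> d\<close> left divisors of norm \<open>n\<close>, where \<open>d\<close> runs
  over the odd common divisors of \<open>n\<close>, \<open>m\<close> and \<open>x\<close> (induction over the primes dividing \<open>n\<close>). Summing
  over the imaginary part of \<open>x\<close> gives \<open>8\<close> or \<open>24\<close> times \<open>\<Sum> d r\<^sub>3((n m - r\<^sup>2) / d\<^sup>2)\<close>.

  Second, Gauss's theorem \<open>12 H\<^sup>(\<^sup>2\<^sup>)(4 N) = r\<^sub>3(N)\<close>. By Selling's reduction \<open>6 H(D)\<close> is a weighted count of the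
  \<open>p, q, t \<ge> 0\<close> of equal parity with \<open>p q + q t + t p = D\<close>, so the class number side becomes a signed
  count \<open>R(N)\<close> of the solutions of \<open>p q + q t + t p = N\<close>. Since \<open>\<Sum>\<^sub>r r\<^sub>3(n - r\<^sup>2)\<close> is the number of
  representations by four squares, which the first part provides, it suffices to show that
  \<open>\<Sum>\<^sub>r R(n - r\<^sup>2)\<close> has the same value. This is a sum over the solutions of \<open>r\<^sup>2 + p q + q t + t p = n\<close>; its
  summand is rewritten in terms of signs of linear forms that are antisymmetric under
  automorphisms of the quaternary form, up to contributions of the points where a linear form vanishes.
\<close>

section \<open>Sums over the quaternary form\<close>

text \<open>Adding \<open>r^2\<close> to \<open>p*q + q*t + t*p\<close> gives a form of signature
  (2,2), which is a sum of two products, in two ways: \<open>(p+t)*(q-r) + (t+r)*(p+r)\<close> and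
  \<open>(p+t)*(q+t) + (r+t)*(r-t)\<close>. An automorphism can negate both factors of one product
  alone, so a product of signs taken from different products is antisymmetric. The price is an
  indefinite form with infinitely many solutions: antisymmetry makes a sum vanish only where the
  support is finite. The points on the hyperplanes given by the factors therefore decide the result;
  what survives there is a sum over the factorizations of \<open>n\<close>, the source of the
  four-square divisor sum. On the quaternion side only odd \<open>d\<close> occur because 2 is
  ramified: \<open>1 + i\<close> left-divides every element of even norm, so the prime 2 can be
  cancelled without multiplicity. Returning from Hurwitz to integral coordinates costs a factor 3
  unless \<open>n\<close> and \<open>m\<close> are both even. The second sum in the statement
  restores that factor: for even \<open>n\<close> and \<open>m\<close>, each \<open>H2 k\<close> in
  it equals the matching \<open>H2 (4*k)\<close>.\<close>

type_synonym quad = "int \<times> int \<times> int \<times> int"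

definition qform4 :: "quad \<Rightarrow> int" where
  "qform4 = (\<lambda>(r, p, q, t). r\<^sup>2 + p * q + q * t + t * p)"

text \<open>Triples of equal parity are the Selling parameters of forms of discriminant
  \<open>-N\<close>; all triples, after doubling, give discriminant \<open>-4*N\<close>. The sign
  thus makes the weighted count proportional to \<open>H (4*N) - 2 * H N\<close>.\<close>

definition par3 :: "int \<Rightarrow> int \<Rightarrow> int \<Rightarrow> int" where
  "par3 p q t = (if even (p - q) \<and> even (q - t) then -1 else 1)"

text \<open>The set of solutions is infinite, hence \<open>Sum_any\<close>; its value is meaningful
  only together with \<open>fin_supp\<close>.\<close>

definition ssum :: "int \<Rightarrow> (quad \<Rightarrow> int) \<Rightarrow> int" where
  "ssum n f = Sum_any (\<lambda>x. if qform4 x = n then (case x of (r, p, q, t) \<Rightarrow> par3 p q t) * f x else 0)"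

definition fin_supp :: "int \<Rightarrow> (quad \<Rightarrow> int) \<Rightarrow> bool" where
  "fin_supp n f \<longleftrightarrow> finite {x. qform4 x = n \<and> f x \<noteq> 0}"

lemma par3_nonzero [simp]: "par3 p q t \<noteq> 0"
  by (simp add: par3_def)

lemma ssum_support:
  "{x. (if qform4 x = n then (case x of (r, p, q, t) \<Rightarrow> par3 p q t) * f x else 0) \<noteq> (0::int)}
    = {x. qform4 x = n \<and> f x \<noteq> 0}"
  by (auto split: if_splits prod.splits)

lemma ssum_superset:
  assumes "finite A" "{x. qform4 x = n \<and> f x \<noteq> 0} \<subseteq> A"
  shows "ssum n f = (\<Sum>x\<in>A. if qform4 x = n then (case x of (r, p, q, t) \<Rightarrow> par3 p q t) * f x else 0)"
  unfolding ssum_def using assms by (intro Sum_any.expand_superset) (simp_all add: ssum_support)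

lemma fin_supp_add:
  assumes "fin_supp n f" "fin_supp n g"
  shows "fin_supp n (\<lambda>x. f x + g x)"
  using assms unfolding fin_supp_def
  by (rule finite_subset[rotated, OF finite_UnI]) auto

lemma fin_supp_cmult: "fin_supp n f \<Longrightarrow> fin_supp n (\<lambda>x. c * f x)"
  unfolding fin_supp_def by (erule finite_subset[rotated]) auto

lemma ssum_add:
  assumes "fin_supp n f" "fin_supp n g"
  shows "ssum n (\<lambda>x. f x + g x) = ssum n f + ssum n g"
proof -
  have "ssum n (\<lambda>x. f x + g x) = Sum_any (\<lambda>x.
      (if qform4 x = n then (case x of (r, p, q, t) \<Rightarrow> par3 p q t) * f x else 0) +
      (if qform4 x = n then (case x of (r, p, q, t) \<Rightarrow> par3 p q t) * g x else 0))"
    unfolding ssum_def by (rule Sum_any.cong) (simp add: algebra_simps)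
  also have "\<dots> = ssum n f + ssum n g"
    unfolding ssum_def using assms
    by (intro Sum_any.distrib) (simp_all add: ssum_support fin_supp_def)
  finally show ?thesis .
qed

lemma ssum_cmult:
  assumes "fin_supp n f"
  shows "ssum n (\<lambda>x. c * f x) = c * ssum n f"
proof -
  have "ssum n (\<lambda>x. c * f x) = Sum_any (\<lambda>x.
      c * (if qform4 x = n then (case x of (r, p, q, t) \<Rightarrow> par3 p q t) * f x else 0))"
    unfolding ssum_def by (rule Sum_any.cong) (simp add: algebra_simps)
  also have "\<dots> = c * ssum n f"
    unfolding ssum_def using assms
    by (intro Sum_any_right_distrib[symmetric]) (simp_all add: ssum_support fin_supp_def)
  finally show ?thesis .
qed

lemma ssum_cong:
  assumes "\<And>x. qform4 x = n \<Longrightarrow> f x = g x"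
  shows "ssum n f = ssum n g"
  unfolding ssum_def using assms by (intro Sum_any.cong) auto

definition symm4 :: "(quad \<Rightarrow> quad) \<Rightarrow> bool" where
  "symm4 l \<longleftrightarrow> bij l \<and> (\<forall>r p q t. qform4 (l (r, p, q, t)) = qform4 (r, p, q, t) \<and>
     (case l (r, p, q, t) of (r', p', q', t') \<Rightarrow> par3 p' q' t' = par3 p q t))"

lemma ssum_symm:
  assumes "symm4 l"
  shows "ssum n (\<lambda>x. f (l x)) = ssum n f"
  unfolding ssum_def
proof (rule sym, rule Sum_any.reindex_cong[of l])
  show "bij l" using assms by (simp add: symm4_def)
  show "(\<lambda>x. if qform4 x = n then (case x of (r, p, q, t) \<Rightarrow> par3 p q t) * f x else 0) \<circ> l
     = (\<lambda>x. if qform4 x = n then (case x of (r, p, q, t) \<Rightarrow> par3 p q t) * f (l x) else 0)"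
    using assms unfolding symm4_def by (fastforce simp: fun_eq_iff split: prod.splits)
qed

lemma fin_supp_symm:
  assumes "symm4 l" "fin_supp n f"
  shows "fin_supp n (\<lambda>x. f (l x))"
proof -
  have q: "qform4 (l x) = qform4 x" for x
    using assms(1) unfolding symm4_def by (cases x) auto
  have "finite (l -` {x. qform4 x = n \<and> f x \<noteq> 0})"
    using assms unfolding symm4_def fin_supp_def by (intro finite_vimageI) (auto dest: bij_is_inj)
  then show ?thesis
    unfolding fin_supp_def by (rule finite_subset[rotated]) (auto simp: q)
qed

lemma ssum_antisymm:
  assumes "symm4 l" "\<And>x. qform4 x = n \<Longrightarrow> f (l x) = - f x" "fin_supp n f"
  shows "ssum n f = 0"
proof -
  have "ssum n f = ssum n (\<lambda>x. f (l x))" using assms(1) by (simp add: ssum_symm)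
  also have "\<dots> = ssum n (\<lambda>x. (-1) * f x)" by (rule ssum_cong) (simp add: assms(2))
  also have "\<dots> = - ssum n f" using assms(3) by (simp only: ssum_cmult)
  finally show ?thesis by simp
qed

section \<open>Automorphisms of the quaternary form\<close>

definition rot :: "quad \<Rightarrow> quad" where
  "rot = (\<lambda>(r, p, q, t). (r, q, t, p))"
definition swap4 :: "quad \<Rightarrow> quad" where
  "swap4 = (\<lambda>(r, p, q, t). (-r, q, p, t))"
text \<open>In the splitting \<open>(p+t)*(q-r) + (t+r)*(p+r)\<close> this negates both factors of
  the first product and fixes both factors of the second.\<close>

definition flip1 :: "quad \<Rightarrow> quad" where
  "flip1 = (\<lambda>(r, p, q, t). (r + p + t, -t, 2*r + p + t - q, -p))"
text \<open>In the splitting \<open>(p+t)*(q+t) + (r+t)*(r-t)\<close> this exchanges the two factors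
  within each product, and it negates \<open>t\<close>.\<close>

definition flip2 :: "quad \<Rightarrow> quad" where
  "flip2 = (\<lambda>(r, p, q, t). (r, q + 2*t, p + 2*t, -t))"

lemma symm4_rot: "symm4 rot"
  unfolding symm4_def rot_def
  by (auto simp: bij_def inj_on_def surj_def qform4_def par3_def algebra_simps)

lemma symm4_swap4: "symm4 swap4"
proof -
  have "bij swap4" by (rule involuntory_imp_bij) (auto simp: swap4_def)
  then show ?thesis
    unfolding symm4_def swap4_def by (auto simp: qform4_def par3_def algebra_simps)
qed

lemma symm4_flip1: "symm4 flip1"
proof -
  have "bij flip1" by (rule involuntory_imp_bij) (auto simp: flip1_def algebra_simps)
  then show ?thesis
    unfolding symm4_def flip1_def
    by (auto simp: qform4_def par3_def power2_eq_square algebra_simps)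
qed

lemma symm4_flip2: "symm4 flip2"
proof -
  have "bij flip2" by (rule involuntory_imp_bij) (auto simp: flip2_def algebra_simps)
  then show ?thesis
    unfolding symm4_def flip2_def
    by (auto simp: qform4_def par3_def power2_eq_square algebra_simps)
qed

section \<open>Sign identities for the weight\<close>

lemma sgn_zero_sum:
  fixes x y z :: int
  assumes "x + y + z = 0" "x \<noteq> 0 \<or> y \<noteq> 0"
  shows "sgn x * sgn y + sgn y * sgn z + sgn z * sgn x = -1"
  using assms by (auto simp: sgn_if)

text \<open>The number of nonzero parameters minus one: 2 inside an octant and 1 on a face, so that
  every class of forms contributes 6 times its weight. On an axis it is 0, which discards the
  infinitely many solutions with value 0; at the origin it is -1, which \<open>par3\<close> turns
  into the 1 of \<open>r3 0\<close>.\<close>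

definition sell_wt :: "int \<Rightarrow> int \<Rightarrow> int \<Rightarrow> int" where
  "sell_wt p q t = (if p \<ge> 0 \<and> q \<ge> 0 \<and> t \<ge> 0 \<or> p \<le> 0 \<and> q \<le> 0 \<and> t \<le> 0
     then \<bar>sgn p\<bar> + \<bar>sgn q\<bar> + \<bar>sgn t\<bar> - 1 else 0)"

definition sell_wt4 :: "quad \<Rightarrow> int" where
  "sell_wt4 = (\<lambda>(r, p, q, t). sell_wt p q t)"

text \<open>Each term combines a factor of one product of the first splitting with a factor of the
  other product, hence it is odd under \<open>flip1\<close>.\<close>

definition crossing :: "quad \<Rightarrow> int" where
  "crossing = (\<lambda>(r, p, q, t). sgn (q - r) * sgn (p + r) + sgn (t + r) * sgn (p + t))"
text \<open>Odd under \<open>flip2\<close> because of the last factor; the other two factors are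
  invariant.\<close>

definition wall :: "quad \<Rightarrow> int" where
  "wall = (\<lambda>(r, p, q, t). (sgn (p + t) + sgn (q + t)) * (1 - sgn (t - r) * sgn (t + r)) * sgn t)"

lemma sell_wt_sgn:
  "2 * sell_wt p q t = -2 + sgn (p + t) * (sgn p + sgn t) + sgn (q + t) * (sgn q + sgn t)
     + sgn (p + q) * (sgn p + sgn q)"
  unfolding sell_wt_def by (auto simp: sgn_if split: if_splits)

text \<open>With \<open>a = p + t\<close> and \<open>c = q + t\<close> the hypothesis says that the
  quaternary form is positive. If \<open>a * c > 0\<close>, the signs of \<open>a\<close> and
  \<open>c\<close> agree and the claim is a relation between the signs of \<open>t + r\<close>,
  \<open>t - r\<close> and their half sum \<open>t\<close>. Otherwise \<open>r\<close> exceeds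
  \<open>t\<close> in absolute value and alone determines the signs of \<open>t + r\<close> and
  \<open>t - r\<close>.\<close>

lemma edge_identity:
  fixes a c r t :: int
  assumes "a * c + (r + t) * (r - t) > 0"
  shows "2 * sgn a * sgn (t + r) + 2 * sgn c * sgn (t - r)
      + (sgn a + sgn c) * (1 - sgn (t - r) * sgn (t + r)) * sgn t
    = 2 * (sgn a + sgn c) * sgn t + 2 * (sgn a - sgn c) * sgn r"
proof (cases "a * c > 0")
  case True
  then have "sgn a = sgn c" by (auto simp: zero_less_mult_iff sgn_if)
  then show ?thesis by (auto simp: sgn_if)
next
  case False
  then have "(r + t) * (r - t) > 0" using assms by linarith
  then have "sgn (t + r) = sgn r" "sgn (t - r) = - sgn r"
    by (auto simp: zero_less_mult_iff sgn_if)
  moreover have "sgn r * sgn r = 1"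
    using \<open>(r + t) * (r - t) > 0\<close> by (auto simp: sgn_if zero_less_mult_iff)
  ultimately show ?thesis by (simp add: algebra_simps)
qed

text \<open>The coefficients result from an elimination. Summed over the rotations, the products
  \<open>N\<close> are expressed by the edge terms \<open>g\<close> (\<open>sN\<close>), and
  \<open>g\<close> is expressed by \<open>wall\<close> and the signs occurring in
  \<open>sell_wt_sgn\<close> (\<open>e\<close>). The terms with \<open>sgn r\<close> cancel over the
  three rotations.\<close>

lemma pointwise_identity:
  assumes "qform4 x > 0"
  shows "12 * sell_wt4 x =
    (2 * crossing x + 2 * crossing (swap4 x) + 3 * wall x)
    + (2 * crossing (rot x) + 2 * crossing (swap4 (rot x)) + 3 * wall (rot x))
    + (2 * crossing (rot (rot x)) + 2 * crossing (swap4 (rot (rot x))) + 3 * wall (rot (rot x)))"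
proof -
  obtain r p q t where x: "x = (r, p, q, t)" by (cases x) auto
  have pos: "r\<^sup>2 + p * q + q * t + t * p > 0" using assms by (simp add: x qform4_def)
  define g :: "int \<Rightarrow> int \<Rightarrow> int \<Rightarrow> int"
    where "g = (\<lambda>p q t. sgn (p + t) * sgn (t + r) + sgn (q + t) * sgn (t - r))"
  define N :: "int \<Rightarrow> int \<Rightarrow> int" where "N = (\<lambda>p q. sgn (q - r) * sgn (p + r))"
  have N: "N p q = -1 + sgn (p + q) * (sgn (q - r) + sgn (p + r))"
    if "r\<^sup>2 + p * q + q * t + t * p > 0" for p q t
  proof -
    have "p + r \<noteq> 0 \<or> q - r \<noteq> 0"
    proof (rule ccontr)
      assume "\<not> ?thesis"
      then have "p = - r" "q = r" by auto
      then show False using that by (simp add: algebra_simps power2_eq_square)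
    qed
    then have "sgn (p + r) * sgn (q - r) + sgn (q - r) * sgn (-(p + q)) + sgn (-(p + q)) * sgn (p + r) = -1"
      by (intro sgn_zero_sum) auto
    moreover have "sgn (-(p + q)) = - sgn (p + q)" by (simp add: sgn_if)
    ultimately have "sgn (p + r) * sgn (q - r) - sgn (q - r) * sgn (p + q) - sgn (p + q) * sgn (p + r) = -1"
      by (simp only:)
    then show ?thesis unfolding N_def by (simp add: algebra_simps)
  qed
  have e: "2 * g p q t + wall (r, p, q, t) = 2 * (sgn (p + t) + sgn (q + t)) * sgn t
      + 2 * (sgn (p + t) - sgn (q + t)) * sgn r"
    if "r\<^sup>2 + p * q + q * t + t * p > 0" for p q t
    using edge_identity[of "p + t" "q + t" r t] that unfolding g_def wall_def
    by (simp add: algebra_simps power2_eq_square)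
  have B: "crossing (r, p, q, t) + crossing (swap4 (r, p, q, t)) = 2 * N p q + g p q t" for p q t
    unfolding crossing_def swap4_def N_def g_def by (simp add: algebra_simps)
  have pos2: "r\<^sup>2 + q * t + t * p + p * q > 0" "r\<^sup>2 + t * p + p * q + q * t > 0"
    using pos by (simp_all add: algebra_simps)
  have sN: "N p q + N q t + N t p = -3 + g p q t + g q t p + g t p q"
    using N[OF pos] N[OF pos2(1)] N[OF pos2(2)] unfolding g_def by (simp add: algebra_simps)
  have "24 * sell_wt4 x = 12 * (-2 + sgn (p + t) * (sgn p + sgn t) + sgn (q + t) * (sgn q + sgn t)
     + sgn (p + q) * (sgn p + sgn q))"
    using sell_wt_sgn[of p q t] by (simp add: x sell_wt4_def)
  also have "\<dots> = -24 + 6 * (2 * g p q t + wall (r, p, q, t)) + 6 * (2 * g q t p + wall (r, q, t, p))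
      + 6 * (2 * g t p q + wall (r, t, p, q))"
    unfolding e[OF pos] e[OF pos2(1)] e[OF pos2(2)] by (simp add: algebra_simps)
  also have "\<dots> = 4 * (2 * (N p q + N q t + N t p) + (g p q t + g q t p + g t p q))
      + 6 * (wall (r, p, q, t) + wall (r, q, t, p) + wall (r, t, p, q))"
    unfolding sN by (simp add: algebra_simps)
  also have "\<dots> = 2 * ((2 * crossing x + 2 * crossing (swap4 x) + 3 * wall x)
    + (2 * crossing (rot x) + 2 * crossing (swap4 (rot x)) + 3 * wall (rot x))
    + (2 * crossing (rot (rot x)) + 2 * crossing (swap4 (rot (rot x))) + 3 * wall (rot (rot x))))"
    using B[of p q t] B[of q t p] B[of t p q] by (simp add: x rot_def algebra_simps)
  finally have "24 * sell_wt4 x = 2 * ((2 * crossing x + 2 * crossing (swap4 x) + 3 * wall x)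
    + (2 * crossing (rot x) + 2 * crossing (swap4 (rot x)) + 3 * wall (rot x))
    + (2 * crossing (rot (rot x)) + 2 * crossing (swap4 (rot (rot x))) + 3 * wall (rot (rot x))))" .
  moreover have "24 * u = 2 * v \<Longrightarrow> 12 * u = v" for u v :: int by simp
  ultimately show ?thesis by blast
qed

text \<open>On \<open>qform4 x = n\<close> the functions \<open>crossing\<close> and \<open>wall\<close> have infinite support, so that their
  antisymmetry under \<open>flip1\<close> and \<open>flip2\<close> cannot be used directly. The points where a linear form
  vanishes are responsible; without them the support is finite, and their contributions combine
  to the defects, again of finite support.\<close>

definition crossing_reg :: "quad \<Rightarrow> int" where
  "crossing_reg = (\<lambda>(r, p, q, t). if p + t \<noteq> 0 \<and> q - r \<noteq> 0 \<and> t + r \<noteq> 0 \<and> p + r \<noteq> 0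
     then crossing (r, p, q, t) else 0)"
definition wall_reg :: "quad \<Rightarrow> int" where
  "wall_reg = (\<lambda>(r, p, q, t). if p + t \<noteq> 0 \<and> q + t \<noteq> 0 \<and> t - r \<noteq> 0 \<and> t + r \<noteq> 0
     then wall (r, p, q, t) else 0)"
definition off_diag_defect :: "quad \<Rightarrow> int" where
  "off_diag_defect = (\<lambda>(r, p, q, t). if t + r = 0
     then 2 * sgn (q + t) * (sgn (p - t) + sgn (q - t) + sgn (p + q) + 3 * sgn t) else 0)"
definition diag_defect :: "quad \<Rightarrow> int" where
  "diag_defect = (\<lambda>(r, p, q, t). if p + t = 0
     then 2 * sgn (r - t) * (sgn (q - r) - sgn (q + r)) + 6 * sgn t * (sgn (q + t) - sgn (q - t)) else 0)"

definition at_zero :: "int \<Rightarrow> int \<Rightarrow> int" where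
  "at_zero e X = (if e = 0 then X else 0)"

lemma at_zero_add: "at_zero e (X + Y) = at_zero e X + at_zero e Y"
  by (simp add: at_zero_def)

lemma at_zero_mult: "at_zero e (k * X) = k * at_zero e X"
  by (simp add: at_zero_def)

text \<open>One of the two products is positive, so linear forms from different products never
  vanish together. On a hyperplane where a factor of one product vanishes, only the listed term of
  \<open>crossing\<close> can be nonzero.\<close>

lemma crossing_zero_part:
  assumes "r\<^sup>2 + p * q + q * t + t * p > 0"
  shows "crossing (r, p, q, t) = crossing_reg (r, p, q, t)
    + at_zero (p + t) (sgn (q - r) * sgn (p + r)) + at_zero (t + r) (sgn (q - r) * sgn (p + r))
    + at_zero (q - r) (sgn (t + r) * sgn (p + t)) + at_zero (p + r) (sgn (t + r) * sgn (p + t))"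
proof -
  have "(p + t) * (q - r) + (t + r) * (p + r) > 0"
    using assms by (simp add: algebra_simps power2_eq_square)
  then have "p + t \<noteq> 0 \<or> t + r \<noteq> 0" "p + t \<noteq> 0 \<or> p + r \<noteq> 0"
     "q - r \<noteq> 0 \<or> t + r \<noteq> 0" "q - r \<noteq> 0 \<or> p + r \<noteq> 0" by auto
  then show ?thesis unfolding crossing_def crossing_reg_def at_zero_def by auto
qed

lemma wall_zero_part:
  assumes "r\<^sup>2 + p * q + q * t + t * p > 0"
  shows "wall (r, p, q, t) = wall_reg (r, p, q, t)
    + at_zero (p + t) (2 * sgn (q + t) * sgn t) + at_zero (q + t) (2 * sgn (p + t) * sgn t)
    + at_zero (t - r) ((sgn (p + t) + sgn (q + t)) * sgn t)
    + at_zero (t + r) ((sgn (p + t) + sgn (q + t)) * sgn t)"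
proof -
  have pos: "(p + t) * (q + t) + (t + r) * (r - t) > 0"
    using assms by (simp add: algebra_simps power2_eq_square)
  \<comment> \<open>With \<open>p + t\<close> or \<open>q + t\<close> zero, the other product
    carries the whole value of the form. So \<open>1 - sgn (t - r) * sgn (t + r)\<close> is 2, the
    factor in front of the corresponding contributions.\<close>
  have "sgn (t - r) * sgn (t + r) = -1" if "p + t = 0 \<or> q + t = 0"
  proof -
    have "(t + r) * (r - t) > 0" using pos that by auto
    then show ?thesis by (auto simp: zero_less_mult_iff sgn_if)
  qed
  moreover have "sgn t = 0" if "t - r = 0" "t + r = 0" using that by auto
  moreover have "p + t \<noteq> 0 \<or> t + r \<noteq> 0" "p + t \<noteq> 0 \<or> t - r \<noteq> 0"
     "q + t \<noteq> 0 \<or> t + r \<noteq> 0" "q + t \<noteq> 0 \<or> t - r \<noteq> 0" using pos by auto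
  ultimately show ?thesis unfolding wall_def wall_reg_def at_zero_def
    by (cases "p + t = 0"; cases "q + t = 0"; cases "t - r = 0"; cases "t + r = 0") simp_all
qed

text \<open>On \<open>t + r = 0\<close> the product \<open>(p + t) * (q + t)\<close> is the whole
  value of the form, so its two factors have the same sign, which can be taken out of all four
  contributions.\<close>

lemma off_diag_defect_zero_part:
  assumes "r\<^sup>2 + p * q + q * t + t * p > 0"
  shows "off_diag_defect (r, p, q, t) =
    2 * at_zero (t + r) (sgn (q - r) * sgn (p + r)) + 2 * at_zero (t + r) (sgn (q + r) * sgn (t + q))
    + 2 * at_zero (t + r) (sgn (q - r) * sgn (p + q))
    + 3 * at_zero (t + r) ((sgn (p + t) + sgn (q + t)) * sgn t)"
proof (cases "t + r = 0")
  case True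
  then have r: "r = - t" by simp
  have "(p + t) * (q + t) > 0" using assms by (simp add: r algebra_simps power2_eq_square)
  then have "sgn (p + t) = sgn (q + t)" by (auto simp: zero_less_mult_iff sgn_if)
  then show ?thesis unfolding off_diag_defect_def at_zero_def by (simp add: r algebra_simps)
qed (simp add: off_diag_defect_def at_zero_def)

lemma diag_defect_zero_part:
  "diag_defect (r, p, q, t) =
    2 * at_zero (p + t) (sgn (q - r) * sgn (p + r)) + 2 * at_zero (p + t) (sgn (t - r) * sgn (q + r))
    + 3 * at_zero (p + t) (2 * sgn (q + t) * sgn t) + 3 * at_zero (p + t) (2 * sgn (q + p) * sgn p)"
proof (cases "p + t = 0")
  case True
  then have p: "p = - t" by simp
  have "sgn (t - r) = - sgn (r - t)" by (simp add: sgn_if)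
  then show ?thesis unfolding diag_defect_def at_zero_def by (simp add: p algebra_simps)
qed (simp add: diag_defect_def at_zero_def)

text \<open>Because the identity is a sum over the rotations, with \<open>crossing\<close> entering
  together with its image under \<open>swap4\<close>, each contribution of a hyperplane may be
  carried to \<open>t + r = 0\<close> or to \<open>p + t = 0\<close> by these symmetries. Collected
  there, they form the two defects.\<close>

lemma pointwise_identity_split:
  assumes "qform4 x > 0"
  defines "F \<equiv> (\<lambda>x. 2 * crossing_reg x + 2 * crossing_reg (swap4 x) + 3 * wall_reg x + off_diag_defect x + off_diag_defect (swap4 x) + diag_defect x)"
  shows "12 * sell_wt4 x = F x + F (rot x) + F (rot (rot x))"
proof -
  obtain r p q t where x: "x = (r, p, q, t)" by (cases x) auto
  have pos: "r\<^sup>2 + p * q + q * t + t * p > 0" using assms by (simp add: x qform4_def)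
  have pos': "r\<^sup>2 + q * t + t * p + p * q > 0" "r\<^sup>2 + t * p + p * q + q * t > 0"
     "(-r)\<^sup>2 + q * p + p * t + t * q > 0" "(-r)\<^sup>2 + t * q + q * p + p * t > 0"
     "(-r)\<^sup>2 + p * t + t * q + q * p > 0"
    using pos by (simp_all add: algebra_simps)
  note P = pos pos'
  show ?thesis
    using pointwise_identity[OF assms(1)]
    unfolding F_def x rot_def swap4_def prod.case
      crossing_zero_part[OF P(1)] crossing_zero_part[OF P(2)] crossing_zero_part[OF P(3)]
      crossing_zero_part[OF P(4)] crossing_zero_part[OF P(5)] crossing_zero_part[OF P(6)]
      wall_zero_part[OF P(1)] wall_zero_part[OF P(2)] wall_zero_part[OF P(3)]
      off_diag_defect_zero_part[OF P(1)] off_diag_defect_zero_part[OF P(2)] off_diag_defect_zero_part[OF P(3)]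
      off_diag_defect_zero_part[OF P(4)] off_diag_defect_zero_part[OF P(5)] off_diag_defect_zero_part[OF P(6)] diag_defect_zero_part
    by (simp add: algebra_simps at_zero_add at_zero_mult)
qed

section \<open>Finiteness of the supports\<close>

lemma fin_supp_bounded:
  assumes "\<And>r p q t. qform4 (r, p, q, t) = n \<Longrightarrow> f (r, p, q, t) \<noteq> 0 \<Longrightarrow>
    \<bar>r\<bar> \<le> M \<and> \<bar>p\<bar> \<le> M \<and> \<bar>q\<bar> \<le> M \<and> \<bar>t\<bar> \<le> M"
  shows "fin_supp n f"
proof -
  have "{x. qform4 x = n \<and> f x \<noteq> 0} \<subseteq> {-M..M} \<times> {-M..M} \<times> {-M..M} \<times> {-M..M}"
    using assms by fastforce
  then show ?thesis unfolding fin_supp_def by (rule finite_subset) simp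
qed

lemma abs_le_of_mult_le:
  fixes a b n :: int
  assumes "a * b \<le> n" "a * b > 0"
  shows "\<bar>a\<bar> \<le> n" "\<bar>b\<bar> \<le> n"
proof -
  have "\<bar>a\<bar> * \<bar>b\<bar> = a * b" using assms by (simp add: abs_mult[symmetric])
  moreover have "a \<noteq> 0" "b \<noteq> 0" using assms(2) by auto
  then have "\<bar>a\<bar> * 1 \<le> \<bar>a\<bar> * \<bar>b\<bar>" "1 * \<bar>b\<bar> \<le> \<bar>a\<bar> * \<bar>b\<bar>"
    by (intro mult_left_mono mult_right_mono; simp)+
  ultimately show "\<bar>a\<bar> \<le> n" "\<bar>b\<bar> \<le> n" using assms by linarith+
qed

text \<open>If the two terms of \<open>crossing\<close> do not cancel, the product of the four
  factors is positive, so the two products have the same sign. Their sum is \<open>n > 0\<close>,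
  hence both are positive, and each factor is at most \<open>n\<close> in absolute value.\<close>

lemma fin_supp_crossing_reg:
  assumes "n > 0"
  shows "fin_supp n crossing_reg"
proof (rule fin_supp_bounded[where M = "3 * n"])
  fix r p q t assume q: "qform4 (r, p, q, t) = n" and nz: "crossing_reg (r, p, q, t) \<noteq> 0"
  have eq: "(p + t) * (q - r) + (t + r) * (p + r) = n"
    using q by (simp add: qform4_def algebra_simps power2_eq_square)
  have nz4: "p + t \<noteq> 0" "q - r \<noteq> 0" "t + r \<noteq> 0" "p + r \<noteq> 0"
    and s: "sgn (q - r) * sgn (p + r) + sgn (t + r) * sgn (p + t) \<noteq> 0"
    using nz by (auto simp: crossing_reg_def crossing_def split: if_splits)
  have "(p + t) * (q - r) > 0 \<longleftrightarrow> (t + r) * (p + r) > 0"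
    using nz4 s unfolding zero_less_mult_iff sgn_if by (auto split: if_splits)
  moreover have "(p + t) * (q - r) > 0 \<or> (t + r) * (p + r) > 0"
    using eq assms by (rule_tac ccontr) linarith
  ultimately have pos: "(p + t) * (q - r) > 0" "(t + r) * (p + r) > 0" by auto
  have "\<bar>p + t\<bar> \<le> n" "\<bar>q - r\<bar> \<le> n" "\<bar>t + r\<bar> \<le> n" "\<bar>p + r\<bar> \<le> n"
    using abs_le_of_mult_le[OF _ pos(1), of n] abs_le_of_mult_le[OF _ pos(2), of n] pos eq by linarith+
  then show "\<bar>r\<bar> \<le> 3 * n \<and> \<bar>p\<bar> \<le> 3 * n \<and> \<bar>q\<bar> \<le> 3 * n \<and> \<bar>t\<bar> \<le> 3 * n" by linarith
qed

text \<open>A nonzero value forces equal signs on \<open>p + t\<close>, \<open>q + t\<close> and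
  opposite signs on \<open>t - r\<close>, \<open>t + r\<close>; again both products are
  positive.\<close>

lemma fin_supp_wall_reg:
  assumes "n > 0"
  shows "fin_supp n wall_reg"
proof (rule fin_supp_bounded[where M = "3 * n"])
  fix r p q t assume q: "qform4 (r, p, q, t) = n" and nz: "wall_reg (r, p, q, t) \<noteq> 0"
  have eq: "(p + t) * (q + t) + (r + t) * (r - t) = n"
    using q by (simp add: qform4_def algebra_simps power2_eq_square)
  have nz4: "p + t \<noteq> 0" "q + t \<noteq> 0" "t - r \<noteq> 0" "t + r \<noteq> 0"
    and s: "sgn (p + t) + sgn (q + t) \<noteq> 0" "sgn (t - r) * sgn (t + r) \<noteq> 1"
    using nz by (auto simp: wall_reg_def wall_def split: if_splits)
  have pos: "(p + t) * (q + t) > 0" "(r + t) * (r - t) > 0"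
    using nz4 s unfolding zero_less_mult_iff sgn_if by (auto split: if_splits)
  have "\<bar>p + t\<bar> \<le> n" "\<bar>q + t\<bar> \<le> n" "\<bar>r + t\<bar> \<le> n" "\<bar>r - t\<bar> \<le> n"
    using abs_le_of_mult_le[OF _ pos(1), of n] abs_le_of_mult_le[OF _ pos(2), of n] pos eq by linarith+
  then show "\<bar>r\<bar> \<le> 3 * n \<and> \<bar>p\<bar> \<le> 3 * n \<and> \<bar>q\<bar> \<le> 3 * n \<and> \<bar>t\<bar> \<le> 3 * n" by linarith
qed

lemma off_diag_defect_bounds:
  assumes "n > 0" "qform4 (r, p, q, t) = n" "off_diag_defect (r, p, q, t) \<noteq> 0"
  shows "r = - t \<and> (p + t) * (q + t) = n \<and> \<bar>p + t\<bar> \<le> n \<and> \<bar>q + t\<bar> \<le> n \<and> \<bar>t\<bar> \<le> n"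
proof -
  have r: "r = - t" using assms(3) by (auto simp: off_diag_defect_def split: if_splits)
  have eq: "(p + t) * (q + t) = n"
    using assms(2) by (simp add: qform4_def r algebra_simps power2_eq_square)
  have b: "\<bar>p + t\<bar> \<le> n" "\<bar>q + t\<bar> \<le> n"
    using abs_le_of_mult_le[of "p + t" "q + t" n] eq assms(1) by simp_all
  have "\<bar>t\<bar> \<le> n"
  proof (rule ccontr)
    assume "\<not> ?thesis"
    \<comment> \<open>On the hyperplane \<open>t\<close> is still free. For large \<open>t\<close>
      the first three signs all equal \<open>- sgn t\<close>, because \<open>p\<close> and
      \<open>q\<close> stay within \<open>n\<close> of \<open>- t\<close>; they cancel the last
      term.\<close>
    then have "sgn (p - t) + sgn (q - t) + sgn (p + q) + 3 * sgn t = 0"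
      using b by (auto simp: sgn_if)
    then show False using assms(3) by (auto simp: off_diag_defect_def split: if_splits)
  qed
  with r eq b show ?thesis by simp
qed

lemma fin_supp_off_diag_defect: "n > 0 \<Longrightarrow> fin_supp n off_diag_defect"
  by (rule fin_supp_bounded[where M = "3 * n"]) (drule (2) off_diag_defect_bounds, linarith)

lemma diag_defect_bounds:
  assumes "n > 0" "qform4 (r, p, q, t) = n" "diag_defect (r, p, q, t) \<noteq> 0"
  shows "p = - t \<and> r\<^sup>2 - t\<^sup>2 = n \<and> \<bar>r\<bar> \<le> n \<and> \<bar>t\<bar> \<le> n \<and> \<bar>q\<bar> \<le> n"
proof -
  have p: "p = - t" using assms(3) by (auto simp: diag_defect_def split: if_splits)
  have eq: "(r - t) * (r + t) = n"
    using assms(2) by (simp add: qform4_def p algebra_simps power2_eq_square)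
  have "\<bar>r - t\<bar> \<le> n" "\<bar>r + t\<bar> \<le> n"
    using abs_le_of_mult_le[of "r - t" "r + t" n] eq assms(1) by simp_all
  then have b: "\<bar>r\<bar> \<le> n" "\<bar>t\<bar> \<le> n" by linarith+
  have "\<bar>q\<bar> \<le> n"
  proof (rule ccontr)
    assume "\<not> ?thesis"
    then have "sgn (q - r) - sgn (q + r) = 0" "sgn (q + t) - sgn (q - t) = 0"
      using b by (auto simp: sgn_if)
    then show False using assms(3) by (auto simp: diag_defect_def split: if_splits)
  qed
  with p eq b show ?thesis by (simp add: power2_eq_square algebra_simps)
qed

lemma fin_supp_diag_defect: "n > 0 \<Longrightarrow> fin_supp n diag_defect"
  by (rule fin_supp_bounded[where M = "3 * n"]) (drule (2) diag_defect_bounds, linarith)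

section \<open>Evaluation of the defect sums\<close>

text \<open>For \<open>k > 0\<close> the weight is 2 strictly between \<open>-k\<close> and
  \<open>k\<close> and 1 at both ends: a trapezoidal sum of an alternating sequence. Passing to
  \<open>k + 1\<close> adds 1 at two pairs of neighbours, and each pair cancels.\<close>

lemma alternating_sum_aux:
  fixes s :: "int \<Rightarrow> int"
  assumes s: "\<And>q. s (q + 1) = - s q"
  shows "int k \<le> n \<Longrightarrow> (\<Sum>q\<in>{-n..n}. s q * (sgn (q + int k) - sgn (q - int k))) = 0"
proof (induction k)
  case (Suc k)
  let ?k = "int k"
  have "s q * (sgn (q + int (Suc k)) - sgn (q - int (Suc k))) =
      s q * (sgn (q + ?k) - sgn (q - ?k)) + (if q = -?k - 1 then s q else 0) + (if q = -?k then s q else 0)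
      + (if q = ?k then s q else 0) + (if q = ?k + 1 then s q else 0)" for q
    by (auto simp: sgn_if algebra_simps)
  then have "(\<Sum>q\<in>{-n..n}. s q * (sgn (q + int (Suc k)) - sgn (q - int (Suc k)))) =
     s (-?k - 1) + s (-?k) + s ?k + s (?k + 1)"
    using Suc by (simp add: sum.distrib)
  also have "\<dots> = 0" using s[of "-?k - 1"] s[of ?k] by simp
  finally show ?case .
qed simp

lemma alternating_sum:
  fixes s :: "int \<Rightarrow> int"
  assumes s: "\<And>q. s (q + 1) = - s q" and "\<bar>m\<bar> \<le> n"
  shows "(\<Sum>q\<in>{-n..n}. s q * (sgn (q + m) - sgn (q - m))) = 0"
proof (cases "m \<ge> 0")
  case True
  then show ?thesis using alternating_sum_aux[of s, OF s, of "nat m" n] assms by simp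
next
  case False
  then have "(\<Sum>q\<in>{-n..n}. s q * (sgn (q - m) - sgn (q + m))) = 0"
    using alternating_sum_aux[of s, OF s, of "nat (-m)" n] assms by simp
  moreover have "s q * (sgn (q + m) - sgn (q - m)) = - (s q * (sgn (q - m) - sgn (q + m)))" for q
    by (simp add: algebra_simps)
  ultimately show ?thesis by (simp add: sum_negf)
qed

lemma sgn_sum_aux:
  "int k \<le> n \<Longrightarrow> (\<Sum>t\<in>{-n..n}. sgn (int k - 2 * t) + sgn t) = int k"
proof (induction k)
  case 0
  have "sgn (- (2 * t)) + sgn t = (0::int)" for t by (auto simp: sgn_if)
  then show ?case by simp
next
  case (Suc k)
  \<comment> \<open>Exactly one of \<open>k\<close> and \<open>k + 1\<close> is even; its half is
    the only \<open>t\<close> at which the first sign changes, and there it grows by 1.\<close>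
  have "sgn (int (Suc k) - 2 * t) + sgn t = (sgn (int k - 2 * t) + sgn t) +
      (if t = (int k + 1) div 2 then 1 else 0)" for t
    by (auto simp: sgn_if)
  moreover have "- n \<le> (int k + 1) div 2" "(int k + 1) div 2 \<le> n" using Suc.prems by linarith+
  ultimately show ?case using Suc by (simp add: sum.distrib)
qed

lemma sgn_sum:
  fixes a n :: int
  assumes "\<bar>a\<bar> \<le> n"
  shows "(\<Sum>t\<in>{-n..n}. sgn (a - 2 * t) + sgn t) = a"
proof (cases "a \<ge> 0")
  case True
  then show ?thesis using sgn_sum_aux[of "nat a" n] assms by simp
next
  case False
  have "(\<Sum>t\<in>{-n..n}. sgn (a - 2 * t) + sgn t) = (\<Sum>t\<in>{-n..n}. - (sgn (-a - 2 * t) + sgn t))"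
    by (rule sum.reindex_bij_witness[of _ uminus uminus]) (auto simp: sgn_if)
  also have "\<dots> = - (\<Sum>t\<in>{-n..n}. sgn (-a - 2 * t) + sgn t)"
    by (rule sum_negf)
  also have "\<dots> = - (-a)"
    using sgn_sum_aux[of "nat (-a)" n] assms False by simp
  finally show ?thesis by simp
qed

text \<open>On \<open>p + t = 0\<close> the variable \<open>q\<close> is free. Since
  \<open>p\<close> and \<open>t\<close> have the same parity, \<open>par3\<close> alternates in
  \<open>q\<close>, while the defect is a combination of differences of shifted signs of
  \<open>q\<close>; so the sum over \<open>q\<close> is zero for each \<open>r\<close> and
  \<open>t\<close>.\<close>

lemma ssum_diag_defect:
  assumes n: "n > 0"
  shows "ssum n diag_defect = 0"
proof -
  define T where "T = {(r, t). \<bar>r\<bar> \<le> n \<and> \<bar>t\<bar> \<le> n \<and> r\<^sup>2 - t\<^sup>2 = n}"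
  have "T \<subseteq> {-n..n} \<times> {-n..n}" by (auto simp: T_def)
  then have finT: "finite T" by (rule finite_subset) simp
  define h where "h = (\<lambda>((r::int, t::int), q::int). (r, -t, q, t))"
  have inj: "inj_on h X" for X by (auto simp: h_def inj_on_def)
  have "ssum n diag_defect = (\<Sum>x\<in>h ` (T \<times> {-n..n}). if qform4 x = n then (case x of (r, p, q, t) \<Rightarrow> par3 p q t) * diag_defect x else 0)"
  proof (rule ssum_superset)
    show "{x. qform4 x = n \<and> diag_defect x \<noteq> 0} \<subseteq> h ` (T \<times> {- n..n})"
    proof
      fix x assume "x \<in> {x. qform4 x = n \<and> diag_defect x \<noteq> 0}"
      then obtain r p q t where x: "x = (r, p, q, t)" and "qform4 (r, p, q, t) = n" "diag_defect (r, p, q, t) \<noteq> 0"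
        by (cases x) auto
      from diag_defect_bounds[OF n this(2,3)] have "(r, p, q, t) = h ((r, t), q)" "((r, t), q) \<in> T \<times> {-n..n}"
        by (auto simp: h_def T_def)
      then show "x \<in> h ` (T \<times> {- n..n})" unfolding x by (rule image_eqI)
    qed
  qed (use finT in simp)
  also have "\<dots> = (\<Sum>(x, q)\<in>T \<times> {-n..n}. case x of (r, t) \<Rightarrow> par3 (-t) q t * diag_defect (r, -t, q, t))"
    unfolding sum.reindex[OF inj] by (rule sum.cong) (auto simp: h_def T_def qform4_def algebra_simps power2_eq_square)
  also have "\<dots> = (\<Sum>x\<in>T. \<Sum>q\<in>{-n..n}. case x of (r, t) \<Rightarrow> par3 (-t) q t * diag_defect (r, -t, q, t))"
    by (rule sum.cartesian_product[symmetric])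
  also have "\<dots> = 0"
  proof (rule sum.neutral, clarify)
    fix r t assume rt: "(r, t) \<in> T"
    define s where "s = (\<lambda>q. par3 (-t) q t)"
    have s: "s (q + 1) = - s q" for q by (auto simp: s_def par3_def)
    have eq: "s q * diag_defect (r, -t, q, t) = - 2 * sgn (r - t) * (s q * (sgn (q + r) - sgn (q - r)))
       + 6 * sgn t * (s q * (sgn (q + t) - sgn (q - t)))" for q
      by (simp add: diag_defect_def algebra_simps)
    have "(\<Sum>q\<in>{-n..n}. s q * diag_defect (r, -t, q, t)) =
        - 2 * sgn (r - t) * (\<Sum>q\<in>{-n..n}. s q * (sgn (q + r) - sgn (q - r)))
       + 6 * sgn t * (\<Sum>q\<in>{-n..n}. s q * (sgn (q + t) - sgn (q - t)))"
      unfolding sum_distrib_left sum.distrib[symmetric] by (rule sum.cong) (simp_all only: eq)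
    also have "\<dots> = 0"
      using alternating_sum[of s, OF s, of r n] alternating_sum[of s, OF s, of t n] rt by (simp add: T_def)
    finally show "(\<Sum>q\<in>{-n..n}. par3 (-t) q t * diag_defect (r, -t, q, t)) = 0" by (simp add: s_def)
  qed
  finally show ?thesis .
qed

text \<open>Eight times this divisor sum is the number of representations of \<open>n\<close> by
  four squares, see \<open>sum_r3\<close>.\<close>

definition eps_sigma :: "int \<Rightarrow> int" where
  "eps_sigma n = (\<Sum>a | 0 < a \<and> a dvd n. (if even a \<and> even (n div a) then -a else a))"

text \<open>The substitution \<open>a = p + t\<close>, \<open>c = q + t\<close> leaves the
  factorizations \<open>a * c = n\<close> and a free \<open>t\<close>, on which the sign does not
  depend. The sums over \<open>t\<close> for \<open>a\<close>, \<open>c\<close> and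
  \<open>a + c\<close> together give \<open>2 * (a + c)\<close>.\<close>

lemma ssum_off_diag_defect:
  assumes n: "n > 0"
  shows "ssum n off_diag_defect = 16 * eps_sigma n"
proof -
  define e where "e = (\<lambda>a c. if even (a::int) \<and> even (c::int) then -1 else 1 :: int)"
  define T where "T = {(a, c). \<bar>a\<bar> \<le> n \<and> \<bar>c\<bar> \<le> n \<and> a * c = n}"
  have "T \<subseteq> {-n..n} \<times> {-n..n}" by (auto simp: T_def)
  then have finT: "finite T" by (rule finite_subset) simp
  define h where "h = (\<lambda>((a::int, c::int), t::int). (-t, a - t, c - t, t))"
  have inj: "inj_on h X" for X by (auto simp: h_def inj_on_def)
  have "ssum n off_diag_defect = (\<Sum>x\<in>h ` (T \<times> {-n..n}). if qform4 x = n then (case x of (r, p, q, t) \<Rightarrow> par3 p q t) * off_diag_defect x else 0)"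
  proof (rule ssum_superset)
    show "{x. qform4 x = n \<and> off_diag_defect x \<noteq> 0} \<subseteq> h ` (T \<times> {- n..n})"
    proof
      fix x assume "x \<in> {x. qform4 x = n \<and> off_diag_defect x \<noteq> 0}"
      then obtain r p q t where x: "x = (r, p, q, t)" and "qform4 (r, p, q, t) = n" "off_diag_defect (r, p, q, t) \<noteq> 0"
        by (cases x) auto
      from off_diag_defect_bounds[OF n this(2,3)] have "(r, p, q, t) = h ((p + t, q + t), t)" "((p + t, q + t), t) \<in> T \<times> {-n..n}"
        by (auto simp: h_def T_def)
      then show "x \<in> h ` (T \<times> {- n..n})" unfolding x by (rule image_eqI)
    qed
  qed (use finT in simp)
  also have "\<dots> = (\<Sum>(x, t)\<in>T \<times> {-n..n}. case x of (a, c) \<Rightarrow> e a c * off_diag_defect (-t, a - t, c - t, t))"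
    unfolding sum.reindex[OF inj]
    by (rule sum.cong) (auto simp: h_def T_def e_def par3_def qform4_def algebra_simps power2_eq_square)
  also have "\<dots> = (\<Sum>x\<in>T. \<Sum>t\<in>{-n..n}. case x of (a, c) \<Rightarrow> e a c * off_diag_defect (-t, a - t, c - t, t))"
    by (rule sum.cartesian_product[symmetric])
  also have "\<dots> = (\<Sum>(a, c)\<in>T. 4 * e a c * \<bar>a + c\<bar>)"
  proof (rule sum.cong[OF refl], clarify)
    fix a c assume ac: "(a, c) \<in> T"
    then have "a * c > 0" using n by (simp add: T_def)
    then have sg: "sgn a = sgn c" by (auto simp: zero_less_mult_iff sgn_if)
    have "a * c = n" "\<bar>a\<bar> \<le> n" "\<bar>c\<bar> \<le> n" using ac by (auto simp: T_def)
    have bd: "\<bar>a + c\<bar> \<le> 2 * n" using \<open>\<bar>a\<bar> \<le> n\<close> \<open>\<bar>c\<bar> \<le> n\<close> by linarith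
    \<comment> \<open>The value \<open>n + 1\<close> does occur, for instance for
      \<open>a = 1\<close>, \<open>c = n\<close>, and lies just outside the range allowed in
      \<open>sgn_sum\<close>. There the lemma is applied to the interval enlarged by one on both
      sides, whose two additional terms vanish.\<close>
    have bd': "\<bar>a + c\<bar> \<le> n + 1"
    proof -
      have "(\<bar>a\<bar> - 1) * (\<bar>c\<bar> - 1) \<ge> 0" using \<open>a * c > 0\<close> by (intro mult_nonneg_nonneg) auto
      moreover have "\<bar>a\<bar> * \<bar>c\<bar> = n" using \<open>a * c = n\<close> n by (simp add: abs_mult[symmetric])
      ultimately have "\<bar>a\<bar> + \<bar>c\<bar> \<le> n + 1" by (simp add: algebra_simps)
      then show ?thesis by linarith
    qed
    have "(\<Sum>t\<in>{-n..n}. sgn (a + c - 2 * t) + sgn t) = a + c"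
    proof (cases "\<bar>a + c\<bar> \<le> n")
      case True then show ?thesis by (rule sgn_sum)
    next
      case False
      then have "\<bar>a + c\<bar> = n + 1" using bd' by linarith
      have ins: "{-(n+1)..n+1} = insert (n+1) (insert (-(n+1)) {-n..n})" using n by auto
      define f where "f = (\<lambda>t. sgn (a + c - 2 * t) + sgn t)"
      have "sum f {-(n+1)..n+1} = a + c"
        unfolding f_def by (rule sgn_sum) (use bd' in simp)
      moreover have "f (n+1) = 0" "f (-(n+1)) = 0"
        using \<open>\<bar>a + c\<bar> = n + 1\<close> n by (auto simp: sgn_if f_def)
      moreover have "sum f {-(n+1)..n+1} = f (n+1) + (f (-(n+1)) + sum f {-n..n})"
        unfolding ins using n by (subst sum.insert; simp)
      ultimately show ?thesis unfolding f_def[symmetric] by simp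
    qed
    moreover have "(\<Sum>t\<in>{-n..n}. e a c * off_diag_defect (-t, a - t, c - t, t)) =
      2 * e a c * sgn c * ((\<Sum>t\<in>{-n..n}. sgn (a - 2 * t) + sgn t) + (\<Sum>t\<in>{-n..n}. sgn (c - 2 * t) + sgn t)
       + (\<Sum>t\<in>{-n..n}. sgn (a + c - 2 * t) + sgn t))"
      unfolding sum_distrib_left sum.distrib[symmetric]
      by (rule sum.cong) (simp_all add: off_diag_defect_def algebra_simps)
    ultimately have "(\<Sum>t\<in>{-n..n}. e a c * off_diag_defect (-t, a - t, c - t, t)) = 4 * e a c * (sgn c * (a + c))"
      using sgn_sum[OF \<open>\<bar>a\<bar> \<le> n\<close>] sgn_sum[OF \<open>\<bar>c\<bar> \<le> n\<close>] by (simp add: algebra_simps)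
    also have "sgn c * (a + c) = \<bar>a + c\<bar>" using sg by (auto simp: sgn_if split: if_splits)
    finally show "(\<Sum>t\<in>{-n..n}. e a c * off_diag_defect (-t, a - t, c - t, t)) = 4 * e a c * \<bar>a + c\<bar>" .
  qed
  also have "\<dots> = (\<Sum>(a, c)\<in>T. 4 * e a c * \<bar>a\<bar>) + (\<Sum>(a, c)\<in>T. 4 * e a c * \<bar>c\<bar>)"
    unfolding sum.distrib[symmetric]
  proof (rule sum.cong[OF refl], clarify)
    fix a c assume "(a, c) \<in> T"
    then have "a * c > 0" using n by (simp add: T_def)
    then have "\<bar>a + c\<bar> = \<bar>a\<bar> + \<bar>c\<bar>" by (auto simp: zero_less_mult_iff)
    then show "4 * e a c * \<bar>a + c\<bar> = 4 * e a c * \<bar>a\<bar> + 4 * e a c * \<bar>c\<bar>" by (simp add: algebra_simps)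
  qed
  also have "(\<Sum>(a, c)\<in>T. 4 * e a c * \<bar>c\<bar>) = (\<Sum>(a, c)\<in>T. 4 * e a c * \<bar>a\<bar>)"
    by (rule sum.reindex_bij_witness[of _ prod.swap prod.swap]) (auto simp: T_def e_def algebra_simps)
  also have "(\<Sum>(a, c)\<in>T. 4 * e a c * \<bar>a\<bar>) =
     (\<Sum>a | 0 < a \<and> a dvd n. 4 * e a (n div a) * a) + (\<Sum>a | 0 < a \<and> a dvd n. 4 * e a (n div a) * a)"
  proof -
    define Tp where "Tp = {(a, c) \<in> T. a > 0}"
    define Tm where "Tm = {(a, c) \<in> T. a < 0}"
    have "a \<noteq> 0" if "(a, c) \<in> T" for a c using that n by (auto simp: T_def)
    then have T: "T = Tp \<union> Tm" "Tp \<inter> Tm = {}"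
      unfolding Tp_def Tm_def by (auto simp: linorder_neq_iff)
    have fin: "finite Tp" "finite Tm" using finT T(1) by auto
    have "(\<Sum>(a, c)\<in>Tp. 4 * e a c * \<bar>a\<bar>) = (\<Sum>a | 0 < a \<and> a dvd n. 4 * e a (n div a) * a)"
    proof (rule sum.reindex_bij_witness[of _ "\<lambda>a. (a, n div a)" fst])
      fix x assume "x \<in> Tp"
      then obtain a c where x: "x = (a, c)" and a: "a > 0" "n = a * c" by (auto simp: Tp_def T_def)
      have "n div a = c" using a by simp
      then show "(fst x, n div fst x) = x" "fst x \<in> {a. 0 < a \<and> a dvd n}"
        "4 * e (fst x) (n div fst x) * fst x = (case x of (a, c) \<Rightarrow> 4 * e a c * \<bar>a\<bar>)"
        using a by (simp_all add: x)
    next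
      fix a assume "a \<in> {a. 0 < a \<and> a dvd n}"
      then obtain c where a: "a > 0" "n = a * c" by auto
      then have nd: "n div a = c" by simp
      have "a * c > 0" using n a by simp
      then have "\<bar>a\<bar> \<le> n" "\<bar>c\<bar> \<le> n" using abs_le_of_mult_le[of a c n] a by simp_all
      then show "(a, n div a) \<in> Tp" unfolding nd using a by (simp add: Tp_def T_def)
    qed simp
    moreover have "(\<Sum>(a, c)\<in>Tm. 4 * e a c * \<bar>a\<bar>) = (\<Sum>(a, c)\<in>Tp. 4 * e a c * \<bar>a\<bar>)"
      by (rule sum.reindex_bij_witness[of _ "\<lambda>(a, c). (-a, -c)" "\<lambda>(a, c). (-a, -c)"])
        (auto simp: Tp_def Tm_def T_def e_def)
    ultimately show ?thesis unfolding T(1) by (simp add: sum.union_disjoint[OF fin T(2)])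
  qed
  also have "(\<Sum>a | 0 < a \<and> a dvd n. 4 * e a (n div a) * a) = 4 * eps_sigma n"
    unfolding eps_sigma_def sum_distrib_left by (rule sum.cong) (auto simp: e_def)
  finally show ?thesis by simp
qed

text \<open>The weight vanishes on the axes away from the origin. So either all parameters are 0, or
  at least two are nonzero, and then each nonzero one is a factor of a positive product bounded by
  \<open>N\<close>.\<close>

lemma sell_wt_bounds:
  assumes eq: "p * q + q * t + t * p = N" and nz: "sell_wt p q t \<noteq> 0"
  shows "N \<ge> 0 \<and> \<bar>p\<bar> \<le> N \<and> \<bar>q\<bar> \<le> N \<and> \<bar>t\<bar> \<le> N"
proof -
  have same: "p \<ge> 0 \<and> q \<ge> 0 \<and> t \<ge> 0 \<or> p \<le> 0 \<and> q \<le> 0 \<and> t \<le> 0"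
    using nz by (auto simp: sell_wt_def split: if_splits)
  then have ge: "p * q \<ge> 0" "q * t \<ge> 0" "t * p \<ge> 0" by (auto simp: zero_le_mult_iff)
  have le: "p * q \<le> N" "q * t \<le> N" "t * p \<le> N" using eq ge by linarith+
  have "\<bar>p\<bar> \<le> N \<and> \<bar>q\<bar> \<le> N \<and> \<bar>t\<bar> \<le> N"
  proof (cases "p = 0 \<and> q = 0 \<or> q = 0 \<and> t = 0 \<or> t = 0 \<and> p = 0")
    case True
    then have "p = 0 \<and> q = 0 \<and> t = 0" using nz by (auto simp: sell_wt_def sgn_if split: if_splits)
    then show ?thesis using eq by simp
  next
    case False
    then consider "p * q \<noteq> 0" "q * t \<noteq> 0" | "p * q \<noteq> 0" "t = 0" | "q * t \<noteq> 0" "p = 0"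
      | "t * p \<noteq> 0" "q = 0" by auto
    then show ?thesis
    proof cases
      case 1
      then have "p * q > 0" "q * t > 0" using ge by linarith+
      then show ?thesis using abs_le_of_mult_le[OF le(1)] abs_le_of_mult_le[OF le(2)] by simp
    next
      case 2
      then have "p * q > 0" using ge by linarith
      then show ?thesis using abs_le_of_mult_le[OF le(1)] 2 le ge by simp
    next
      case 3
      then have "q * t > 0" using ge by linarith
      then show ?thesis using abs_le_of_mult_le[OF le(2)] 3 le ge by simp
    next
      case 4
      then have "t * p > 0" using ge by linarith
      then show ?thesis using abs_le_of_mult_le[OF le(3)] 4 le ge by simp
    qed
  qed
  then show ?thesis by linarith
qed

lemma square_bound: "\<bar>r\<bar> \<le> (r::int)\<^sup>2"
  using self_le_power[of "\<bar>r\<bar>" 2] by (cases "r = 0") auto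

lemma fin_supp_sell_wt4: "fin_supp n sell_wt4"
proof (rule fin_supp_bounded[where M = n])
  fix r p q t assume "qform4 (r, p, q, t) = n" and nz: "sell_wt4 (r, p, q, t) \<noteq> 0"
  then have "p * q + q * t + t * p = n - r\<^sup>2" by (simp add: qform4_def)
  from sell_wt_bounds[OF this] nz show "\<bar>r\<bar> \<le> n \<and> \<bar>p\<bar> \<le> n \<and> \<bar>q\<bar> \<le> n \<and> \<bar>t\<bar> \<le> n"
    using square_bound[of r] by (auto simp: sell_wt4_def)
qed

text \<open>Of \<open>F\<close> only the two copies of \<open>off_diag_defect\<close> survive, each
  with sum \<open>16 * eps_sigma n\<close>. The three rotations give equal sums, so
  \<open>12 * ssum n sell_wt4 = 3 * 32 * eps_sigma n\<close>.\<close>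

theorem ssum_sell_wt4:
  assumes n: "n > 0"
  shows "ssum n sell_wt4 = 8 * eps_sigma n"
proof -
  define F where "F = (\<lambda>x. 2 * crossing_reg x + 2 * crossing_reg (swap4 x) + 3 * wall_reg x + off_diag_defect x + off_diag_defect (swap4 x) + diag_defect x)"
  have fB: "fin_supp n crossing_reg" "fin_supp n (\<lambda>x. crossing_reg (swap4 x))"
    and fD: "fin_supp n off_diag_defect" "fin_supp n (\<lambda>x. off_diag_defect (swap4 x))"
    using fin_supp_crossing_reg[OF n] fin_supp_off_diag_defect[OF n] symm4_swap4 by (auto intro: fin_supp_symm)
  note fH = fin_supp_wall_reg[OF n] and fA = fin_supp_diag_defect[OF n]
  note fins = fB fD fH fA fin_supp_add fin_supp_cmult
  have fF: "fin_supp n F" unfolding F_def by (intro fins)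
  have "ssum n crossing_reg = 0"
  proof (rule ssum_antisymm[OF symm4_flip1 _ fB(1)])
    fix x :: quad
    obtain r p q t where x: "x = (r, p, q, t)" by (cases x) auto
    have [simp]: "sgn (- t - p) = - sgn (p + t)" "sgn (- p - t) = - sgn (p + t)" "sgn (r - q) = - sgn (q - r)"
      by (simp_all add: sgn_if)
    show "crossing_reg (flip1 x) = - crossing_reg x"
      unfolding x flip1_def crossing_reg_def crossing_def by (auto simp: algebra_simps)
  qed
  moreover have "ssum n wall_reg = 0"
  proof (rule ssum_antisymm[OF symm4_flip2 _ fH])
    fix x :: quad
    obtain r p q t where x: "x = (r, p, q, t)" by (cases x) auto
    have [simp]: "sgn (- t - r) = - sgn (t + r)" "sgn (- r - t) = - sgn (t + r)" "sgn (r - t) = - sgn (t - r)"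
      by (simp_all add: sgn_if)
    show "wall_reg (flip2 x) = - wall_reg x"
      unfolding x flip2_def wall_reg_def wall_def by (auto simp: algebra_simps)
  qed
  ultimately have F: "ssum n F = 2 * ssum n off_diag_defect"
    unfolding F_def using fB fD fH fA symm4_swap4
    by (simp add: ssum_add ssum_cmult fin_supp_add fin_supp_cmult ssum_symm ssum_diag_defect[OF n])
  have "12 * ssum n sell_wt4 = ssum n (\<lambda>x. 12 * sell_wt4 x)"
    using fin_supp_sell_wt4 by (simp add: ssum_cmult)
  also have "\<dots> = ssum n (\<lambda>x. F x + F (rot x) + F (rot (rot x)))"
    by (rule ssum_cong) (use n pointwise_identity_split in \<open>simp add: F_def\<close>)
  also have "\<dots> = ssum n F + ssum n (\<lambda>x. F (rot x)) + ssum n (\<lambda>x. F (rot (rot x)))"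
    using fF fin_supp_symm[OF symm4_rot fF] fin_supp_symm[OF symm4_rot fin_supp_symm[OF symm4_rot fF]]
    by (simp add: ssum_add fin_supp_add)
  also have "\<dots> = 3 * ssum n F"
    using ssum_symm[OF symm4_rot, of n F] ssum_symm[OF symm4_rot, of n "\<lambda>x. F (rot x)"] by simp
  finally show ?thesis using F ssum_off_diag_defect[OF n] by simp
qed

section \<open>Hurwitz quaternions\<close>

text \<open>\<open>Hur a b c d\<close> stands for \<open>a \<omega> + b i + c j + d k\<close> with \<open>\<omega> = (1 + i + j + k) / 2\<close>; so \<open>ha x\<close> is twice
  the real part of \<open>x\<close>, and \<open>x\<close> has integral coordinates iff \<open>ha x\<close> is even.\<close>

datatype hur = Hur (ha: int) (hb: int) (hc: int) (hd: int)

lemma hur_eq_iff: "x = y \<longleftrightarrow> ha x = ha y \<and> hb x = hb y \<and> hc x = hc y \<and> hd x = hd y"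
  by (cases x; cases y) auto

instantiation hur :: ring_1
begin
definition "0 = Hur 0 0 0 0"
definition "1 = Hur 2 (-1) (-1) (-1)"
definition "x + y = Hur (ha x + ha y) (hb x + hb y) (hc x + hc y) (hd x + hd y)"
definition "x - y = Hur (ha x - ha y) (hb x - hb y) (hc x - hc y) (hd x - hd y)"
definition "- x = Hur (- ha x) (- hb x) (- hc x) (- hd x)"
definition "x * y = (case (x, y) of (Hur a b c d, Hur a' b' c' d') \<Rightarrow> Hur
  (- a * a' - a * b' - a * c' - a * d' - b * a' - 2 * b * b' - c * a' - 2 * c * c' - d * a' - 2 * d * d')
  (a * a' + a * b' + a * d' + b * a' + b * b' + c * a' + c * c' + c * d' - d * c' + d * d')
  (a * a' + a * b' + a * c' + b * b' - b * d' + c * a' + c * c' + d * a' + d * b' + d * d')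
  (a * a' + a * c' + a * d' + b * a' + b * b' + b * c' - c * b' + c * c' + d * a' + d * d'))"
instance
proof
  fix x y z :: hur
  show "x * y * z = x * (y * z)"
    by (cases x; cases y; cases z) (simp add: times_hur_def algebra_simps)
qed (auto simp: hur_eq_iff zero_hur_def one_hur_def plus_hur_def minus_hur_def uminus_hur_def
       times_hur_def algebra_simps split: hur.splits)
end

lemma hur_sel_simps [simp]:
  "ha 0 = 0" "hb 0 = 0" "hc 0 = 0" "hd 0 = 0"
  "ha 1 = 2" "hb 1 = -1" "hc 1 = -1" "hd 1 = -1"
  "ha (x + y) = ha x + ha y" "hb (x + y) = hb x + hb y" "hc (x + y) = hc x + hc y" "hd (x + y) = hd x + hd y"
  "ha (x - y) = ha x - ha y" "hb (x - y) = hb x - hb y" "hc (x - y) = hc x - hc y" "hd (x - y) = hd x - hd y"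
  "ha (- x) = - ha x" "hb (- x) = - hb x" "hc (- x) = - hc x" "hd (- x) = - hd x"
  by (simp_all add: zero_hur_def one_hur_def plus_hur_def minus_hur_def uminus_hur_def)

lemma hur_mult_sel:
  "ha (x * y) = - ha x * ha y - ha x * hb y - ha x * hc y - ha x * hd y - hb x * ha y - 2 * hb x * hb y - hc x * ha y - 2 * hc x * hc y - hd x * ha y - 2 * hd x * hd y"
  "hb (x * y) = ha x * ha y + ha x * hb y + ha x * hd y + hb x * ha y + hb x * hb y + hc x * ha y + hc x * hc y + hc x * hd y - hd x * hc y + hd x * hd y"
  "hc (x * y) = ha x * ha y + ha x * hb y + ha x * hc y + hb x * hb y - hb x * hd y + hc x * ha y + hc x * hc y + hd x * ha y + hd x * hb y + hd x * hd y"
  "hd (x * y) = ha x * ha y + ha x * hc y + ha x * hd y + hb x * ha y + hb x * hb y + hb x * hc y - hc x * hb y + hc x * hc y + hd x * ha y + hd x * hd y"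
  by (cases x; cases y; simp add: times_hur_def)+

lemma of_int_hur: "of_int n = Hur (2 * n) (- n) (- n) (- n)"
proof -
  have nat: "of_nat k = Hur (2 * int k) (- int k) (- int k) (- int k)" for k
    by (induction k) (auto simp: hur_eq_iff)
  show ?thesis
    by (cases n) (auto simp: nat hur_eq_iff simp del: of_nat_Suc)
qed

lemma of_int_hur_sel [simp]:
  "ha (of_int n) = 2 * n" "hb (of_int n) = - n" "hc (of_int n) = - n" "hd (of_int n) = - n"
  by (simp_all add: of_int_hur)

lemma of_int_mult_hur: "of_int n * x = Hur (n * ha x) (n * hb x) (n * hc x) (n * hd x)"
  by (simp add: hur_eq_iff hur_mult_sel algebra_simps)

lemma of_int_commute_hur: "x * of_int n = of_int n * (x :: hur)"
  by (simp add: hur_eq_iff hur_mult_sel algebra_simps)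

definition hN :: "hur \<Rightarrow> int" where
  "hN x = (ha x)\<^sup>2 + (hb x)\<^sup>2 + (hc x)\<^sup>2 + (hd x)\<^sup>2 + ha x * (hb x + hc x + hd x)"

text \<open>Conjugation sends \<open>\<omega>\<close> to
  \<open>\<omega> - i - j - k\<close>.\<close>

definition hconj :: "hur \<Rightarrow> hur" where
  "hconj x = Hur (ha x) (- ha x - hb x) (- ha x - hc x) (- ha x - hd x)"

lemma hconj_sel [simp]:
  "ha (hconj x) = ha x" "hb (hconj x) = - ha x - hb x" "hc (hconj x) = - ha x - hc x" "hd (hconj x) = - ha x - hd x"
  by (simp_all add: hconj_def)

lemma hN_four: "4 * hN x = (ha x)\<^sup>2 + (ha x + 2 * hb x)\<^sup>2 + (ha x + 2 * hc x)\<^sup>2 + (ha x + 2 * hd x)\<^sup>2"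
  by (simp add: hN_def power2_eq_square algebra_simps)

lemma hN_nonneg [simp]: "hN x \<ge> 0"
  using hN_four[of x] by (smt (verit) zero_le_power2)

lemma hN_eq_0_iff [simp]: "hN x = 0 \<longleftrightarrow> x = 0"
proof
  assume "hN x = 0"
  then have "(ha x)\<^sup>2 = 0 \<and> (ha x + 2 * hb x)\<^sup>2 = 0 \<and> (ha x + 2 * hc x)\<^sup>2 = 0 \<and> (ha x + 2 * hd x)\<^sup>2 = 0"
    using hN_four[of x] by (smt (verit) zero_le_power2)
  then show "x = 0" by (auto simp: hur_eq_iff)
qed (simp add: hN_def)

lemma hN_mult: "hN (x * y) = hN x * hN y"
  unfolding hN_def hur_mult_sel by algebra

lemma hN_of_int [simp]: "hN (of_int n) = n\<^sup>2"
  by (simp add: hN_def power2_eq_square algebra_simps)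

lemma hN_hconj [simp]: "hN (hconj x) = hN x"
  unfolding hN_def hconj_sel by algebra

lemma hconj_hconj [simp]: "hconj (hconj x) = x" by (simp add: hur_eq_iff)

lemma hconj_mult: "hconj (x * y) = hconj y * hconj x"
  by (simp add: hur_eq_iff hur_mult_sel algebra_simps)

lemma mult_hconj: "x * hconj x = of_int (hN x)" "hconj x * x = of_int (hN x)"
  by (simp_all add: hur_eq_iff hur_mult_sel hN_def power2_eq_square algebra_simps)

instance hur :: ring_1_no_zero_divisors
proof
  fix x y :: hur assume "x \<noteq> 0" "y \<noteq> 0"
  then have "hN x * hN y \<noteq> 0" by simp
  then show "x * y \<noteq> 0" by (metis hN_eq_0_iff hN_mult)
qed

section \<open>Left divisibility and Euclidean division\<close>

definition ldvd :: "hur \<Rightarrow> hur \<Rightarrow> bool" (infix "ldvd" 50) where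
  "x ldvd y \<longleftrightarrow> (\<exists>z. y = x * z)"

lemma ldvdI: "y = x * z \<Longrightarrow> x ldvd y" by (auto simp: ldvd_def)
lemma ldvd_refl [simp]: "x ldvd x" by (rule ldvdI[of _ _ 1]) simp
lemma ldvd_mult_right: "x ldvd y \<Longrightarrow> x ldvd y * z" by (auto simp: ldvd_def mult.assoc)
lemma ldvd_trans: "x ldvd y \<Longrightarrow> y ldvd z \<Longrightarrow> x ldvd z" by (auto simp: ldvd_def mult.assoc)
lemma ldvd_mult_cancel: "c \<noteq> 0 \<Longrightarrow> c * x ldvd c * y \<longleftrightarrow> x ldvd y"
  by (auto simp: ldvd_def mult.assoc)
lemma ldvd_add: "x ldvd y \<Longrightarrow> x ldvd z \<Longrightarrow> x ldvd y + z"
  unfolding ldvd_def by (metis distrib_left)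

lemma of_int_ldvd_iff: "of_int n ldvd x \<longleftrightarrow> n dvd ha x \<and> n dvd hb x \<and> n dvd hc x \<and> n dvd hd x"
proof
  assume "of_int n ldvd x"
  then show "n dvd ha x \<and> n dvd hb x \<and> n dvd hc x \<and> n dvd hd x"
    by (auto simp: ldvd_def of_int_mult_hur)
next
  assume "n dvd ha x \<and> n dvd hb x \<and> n dvd hc x \<and> n dvd hd x"
  then obtain a b c d where "ha x = n * a" "hb x = n * b" "hc x = n * c" "hd x = n * d" by (auto elim!: dvdE)
  then show "of_int n ldvd x"
    by (intro ldvdI[of _ _ "Hur a b c d"]) (simp add: of_int_mult_hur hur_eq_iff)
qed

lemma of_int_ldvd_mult_left: "of_int n ldvd x \<Longrightarrow> of_int n ldvd y * x"
  unfolding ldvd_def by (metis mult.assoc of_int_commute_hur)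

lemma of_int_ldvd_of_int_mult_iff:
  assumes "coprime n k"
  shows "of_int n ldvd of_int k * x \<longleftrightarrow> of_int n ldvd x"
  using assms unfolding of_int_ldvd_iff of_int_mult_hur by (simp add: coprime_dvd_mult_right_iff)

lemma ldvd_imp_hN_dvd: "x ldvd y \<Longrightarrow> hN x dvd hN y"
  by (auto simp: ldvd_def hN_mult)

lemma ldvd_hN: "x ldvd of_int (hN x)"
  by (rule ldvdI[of _ _ "hconj x"]) (simp add: mult_hconj)

lemma round_div:
  fixes a m :: int
  assumes "m > 0"
  obtains q where "2 * \<bar>a - m * q\<bar> \<le> m"
proof (cases "2 * (a mod m) \<le> m")
  case True
  have "a - m * (a div m) = a mod m" by (simp add: minus_mult_div_eq_mod)
  then show ?thesis using True assms that[of "a div m"] by simp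
next
  case False
  have eq: "a - m * (a div m + 1) = a mod m - m" by (simp add: minus_mult_div_eq_mod algebra_simps)
  moreover have "a mod m < m" using assms by simp
  ultimately have "2 * \<bar>a mod m - m\<bar> \<le> m" using False by auto
  then show ?thesis using eq by (intro that[of "a div m + 1"]) simp
qed

text \<open>Rounding the coefficient of \<open>\<omega>\<close> leaves a real part of at most
  \<open>m/4\<close>, and afterwards the imaginary coordinates can be brought to at most
  \<open>m/2\<close>. The norm is then at most \<open>13/16 * m^2\<close>. Rounding among integral
  coordinates alone would only give \<open>m^2\<close>, without strictness.\<close>

lemma hur_round:
  fixes z :: hur
  assumes "m > 0"
  shows "\<exists>g. hN (z - of_int m * g) < m\<^sup>2"
proof -
  obtain a where a: "2 * \<bar>ha z - m * a\<bar> \<le> m" using round_div[OF assms] .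
  have rr: "\<exists>q. \<bar>(ha z - m * a) + 2 * (y - m * q)\<bar> \<le> m" for y
  proof -
    obtain q where "2 * \<bar>(ha z - m * a + 2 * y) - (2 * m) * q\<bar> \<le> 2 * m"
      using round_div[of "2 * m" "ha z - m * a + 2 * y"] assms by auto
    then show ?thesis by (intro exI[of _ q]) (simp add: algebra_simps)
  qed
  obtain b c d where bcd: "\<bar>(ha z - m * a) + 2 * (hb z - m * b)\<bar> \<le> m"
     "\<bar>(ha z - m * a) + 2 * (hc z - m * c)\<bar> \<le> m" "\<bar>(ha z - m * a) + 2 * (hd z - m * d)\<bar> \<le> m"
    using rr by metis
  have sq: "y\<^sup>2 \<le> m\<^sup>2" if "\<bar>y\<bar> \<le> m" for y :: int
    using that assms by (simp add: abs_le_square_iff[symmetric])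
  have "4 * y\<^sup>2 \<le> m\<^sup>2" if "2 * \<bar>y\<bar> \<le> m" for y
    using sq[of "2 * y"] that by (simp add: power_mult_distrib abs_mult)
  from this[OF a] have "4 * (ha z - m * a)\<^sup>2 \<le> m\<^sup>2" .
  moreover have "m\<^sup>2 > 0" using assms by simp
  moreover note sq[OF bcd(1)] sq[OF bcd(2)] sq[OF bcd(3)]
  moreover have "4 * hN (z - of_int m * Hur a b c d) = (ha z - m * a)\<^sup>2
      + ((ha z - m * a) + 2 * (hb z - m * b))\<^sup>2 + ((ha z - m * a) + 2 * (hc z - m * c))\<^sup>2
      + ((ha z - m * a) + 2 * (hd z - m * d))\<^sup>2"
    unfolding hN_four by (simp add: of_int_mult_hur)
  ultimately have "4 * hN (z - of_int m * Hur a b c d) < 4 * m\<^sup>2" by linarith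
  then show ?thesis by auto
qed

text \<open>The quotient is the rounding of \<open>hconj y * x\<close> divided by the norm of
  \<open>y\<close>.\<close>

lemma hur_division:
  assumes "y \<noteq> 0"
  shows "\<exists>g. hN (x - y * g) < hN y"
proof -
  have m: "hN y > 0" using assms hN_nonneg[of y] by (metis hN_eq_0_iff le_less)
  obtain g where g: "hN (hconj y * x - of_int (hN y) * g) < (hN y)\<^sup>2" using hur_round[OF m] by blast
  have "hconj y * x - of_int (hN y) * g = hconj y * (x - y * g)"
    by (simp add: right_diff_distrib mult.assoc[symmetric] mult_hconj)
  then have "hN y * hN (x - y * g) < hN y * hN y" using g by (simp add: hN_mult power2_eq_square)
  then show ?thesis using m by (auto simp: mult_less_cancel_left)
qed

lemma right_ideal_principal:
  assumes closed: "\<And>x y. x \<in> I \<Longrightarrow> y \<in> I \<Longrightarrow> x - y \<in> I" "\<And>x y. x \<in> I \<Longrightarrow> x * y \<in> I"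
    and "u \<in> I" "u \<noteq> 0"
  shows "\<exists>g\<in>I. g \<noteq> 0 \<and> (\<forall>x\<in>I. g ldvd x)"
proof -
  obtain g where g: "g \<in> I" "g \<noteq> 0" and min: "\<And>y. y \<in> I \<Longrightarrow> y \<noteq> 0 \<Longrightarrow> nat (hN g) \<le> nat (hN y)"
    using ex_has_least_nat[of "\<lambda>x. x \<in> I \<and> x \<noteq> 0" u "\<lambda>x. nat (hN x)"] assms(3,4) by blast
  have "g ldvd x" if "x \<in> I" for x
  proof -
    obtain q where q: "hN (x - g * q) < hN g" using hur_division[OF g(2)] by blast
    have "x - g * q \<in> I" using that g closed by blast
    then have "x - g * q = 0" using min q by (metis hN_nonneg nat_le_eq_zle not_less)
    then show ?thesis by (intro ldvdI[of _ _ q]) simp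
  qed
  then show ?thesis using g by blast
qed

definition hunits :: "hur set" where "hunits = {u. hN u = 1}"

lemma finite_hN: "finite {x. hN x = n}"
proof -
  have "{x. hN x = n} \<subseteq> (\<lambda>(a, b, c, d). Hur a b c d) ` ({-4*n..4*n} \<times> {-4*n..4*n} \<times> {-4*n..4*n} \<times> {-4*n..4*n})"
  proof
    fix x assume "x \<in> {x. hN x = n}"
    then have eq: "4 * n = (ha x)\<^sup>2 + (ha x + 2 * hb x)\<^sup>2 + (ha x + 2 * hc x)\<^sup>2 + (ha x + 2 * hd x)\<^sup>2"
      using hN_four[of x] by simp
    have "\<bar>ha x\<bar> \<le> 4 * n" "\<bar>ha x + 2 * hb x\<bar> \<le> 4 * n - \<bar>ha x\<bar>" "\<bar>ha x + 2 * hc x\<bar> \<le> 4 * n - \<bar>ha x\<bar>"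
       "\<bar>ha x + 2 * hd x\<bar> \<le> 4 * n - \<bar>ha x\<bar>"
      using eq square_bound[of "ha x"] square_bound[of "ha x + 2 * hb x"]
        square_bound[of "ha x + 2 * hc x"] square_bound[of "ha x + 2 * hd x"]
        zero_le_power2[of "ha x"] zero_le_power2[of "ha x + 2 * hb x"] zero_le_power2[of "ha x + 2 * hc x"] zero_le_power2[of "ha x + 2 * hd x"] by linarith+
    then show "x \<in> (\<lambda>(a, b, c, d). Hur a b c d) ` ({-4*n..4*n} \<times> {-4*n..4*n} \<times> {-4*n..4*n} \<times> {-4*n..4*n})"
      by (intro image_eqI[of _ _ "(ha x, hb x, hc x, hd x)"]) auto
  qed
  then show ?thesis by (rule finite_subset) simp
qed

lemma card_hunits: "card hunits = 24"
proof -
  define B where "B = [-2, -1, 0, 1, 2 :: int]"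
  have "hunits = (\<lambda>(a, b, c, d). Hur a b c d) ` set (filter (\<lambda>(a, b, c, d). a * a + b * b + c * c + d * d + a * (b + c + d) = 1)
     (List.product B (List.product B (List.product B B))))" (is "_ = _ ` set ?L")
  proof (intro subset_antisym subsetI)
    fix x assume "x \<in> hunits"
    then have x: "hN x = 1" by (simp add: hunits_def)
    have eq: "4 = (ha x)\<^sup>2 + (ha x + 2 * hb x)\<^sup>2 + (ha x + 2 * hc x)\<^sup>2 + (ha x + 2 * hd x)\<^sup>2"
      using hN_four[of x] x by simp
    have ab: "\<bar>y\<bar> \<le> 2" if "y\<^sup>2 \<le> 4" for y :: int
      using that abs_le_square_iff[of y 2] by simp
    have bd: "\<bar>ha x\<bar> \<le> 2" "\<bar>ha x + 2 * hb x\<bar> \<le> 2" "\<bar>ha x + 2 * hc x\<bar> \<le> 2" "\<bar>ha x + 2 * hd x\<bar> \<le> 2"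
      using eq zero_le_power2[of "ha x"] zero_le_power2[of "ha x + 2 * hb x"] zero_le_power2[of "ha x + 2 * hc x"] zero_le_power2[of "ha x + 2 * hd x"]
      by (intro ab; linarith)+
    have mem: "y \<in> set B" if "\<bar>y\<bar> \<le> 2" for y using that by (auto simp: B_def)
    show "x \<in> (\<lambda>(a, b, c, d). Hur a b c d) ` set ?L"
      using x bd by (intro image_eqI[of _ _ "(ha x, hb x, hc x, hd x)"])
        (auto simp: hN_def power2_eq_square intro!: mem)
  next
    fix x assume "x \<in> (\<lambda>(a, b, c, d). Hur a b c d) ` set ?L"
    then show "x \<in> hunits" by (auto simp: hunits_def hN_def power2_eq_square)
  qed
  then have "card hunits = card ((\<lambda>(a, b, c, d). Hur a b c d) ` set ?L)"
    by (rule arg_cong)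
  also have "\<dots> = card (set ?L)"
    by (rule card_image) (auto simp: inj_on_def)
  also have "\<dots> = length ?L" by (intro distinct_card distinct_filter distinct_product) (simp_all add: B_def)
  also have "\<dots> = 24" unfolding B_def by code_simp
  finally show ?thesis .
qed

lemma hN_0 [simp]: "hN 0 = 0" by (simp add: hN_def)

instance hur :: ring_char_0
proof
  show "inj (of_nat :: nat \<Rightarrow> hur)"
  proof (rule injI)
    fix m n assume "of_nat m = (of_nat n :: hur)"
    then have "of_int (int m) = (of_int (int n) :: hur)" by simp
    then show "m = n" unfolding of_int_hur by simp
  qed
qed

section \<open>Elements of prime norm\<close>

lemma prime_square_divisor:
  fixes p a b :: int
  assumes "prime p" "a * b = p\<^sup>2" "a \<ge> 0"
  shows "a = 1 \<or> a = p \<or> a = p\<^sup>2"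
proof -
  have "a dvd p ^ 2" using assms(2) by (metis dvd_triv_left)
  then obtain i where "i \<le> 2" "normalize a = p ^ i" using divides_primepow[OF assms(1)] by blast
  then have "a = p ^ i" "i = 0 \<or> i = 1 \<or> i = 2" using assms(3) by auto
  then show ?thesis by auto
qed

lemma hN_of_int_mult: "hN (of_int p * x) = p\<^sup>2 * hN x"
  by (simp add: hN_mult)

lemma hN_diff_of_int_mult: "p dvd hN (y - of_int p * b) - hN y"
proof -
  have "hN (y - of_int p * b) - hN y = p * (p * hN b - (2 * ha y * ha b + 2 * hb y * hb b + 2 * hc y * hc b
     + 2 * hd y * hd b + ha y * (hb b + hc b + hd b) + ha b * (hb y + hc y + hd y)))"
    unfolding of_int_mult_hur hN_def by (simp add: power2_eq_square algebra_simps)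
  then show ?thesis by simp
qed

lemma ldvd_unit_imp: "hN g = 1 \<Longrightarrow> g ldvd x"
  by (rule ldvdI[of _ _ "hconj g * x"]) (simp add: mult.assoc[symmetric] mult_hconj)

text \<open>A generator left-divides \<open>p\<close>, so its norm divides \<open>p^2\<close>. Norm
  1 is excluded by assumption; with norm \<open>p^2\<close> it would be an associate of
  \<open>p\<close>, which would then divide \<open>x\<close>.\<close>

lemma right_ideal_prime_generator:
  assumes p: "prime p"
    and closed: "\<And>x y. x \<in> I \<Longrightarrow> y \<in> I \<Longrightarrow> x - y \<in> I" "\<And>x y. x \<in> I \<Longrightarrow> x * y \<in> I"
    and pI: "of_int p \<in> I" and x: "x \<in> I" "\<not> of_int p ldvd x"
    and norm: "\<And>y. y \<in> I \<Longrightarrow> hN y \<noteq> 1"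
  shows "\<exists>g\<in>I. hN g = p \<and> (\<forall>y. y \<in> I \<longleftrightarrow> g ldvd y)"
proof -
  have "(of_int p :: hur) \<noteq> 0" using p by (auto simp: hur_eq_iff)
  then obtain g where g: "g \<in> I" "\<And>y. y \<in> I \<Longrightarrow> g ldvd y"
    using right_ideal_principal[OF closed pI] by blast
  obtain s where s: "of_int p = g * s" using g(2)[OF pI] by (auto simp: ldvd_def)
  have "hN g * hN s = p\<^sup>2" using s by (metis hN_mult hN_of_int)
  then consider "hN g = 1" | "hN g = p" | "hN g = p\<^sup>2" using prime_square_divisor[OF p] by fastforce
  then have "hN g = p"
  proof cases
    case 1
    then show ?thesis using norm g(1) by blast
  next
    case 3
    then have "hN s = 1" using \<open>hN g * hN s = p\<^sup>2\<close> p by auto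
    then have "s * hconj s = 1" by (simp add: mult_hconj)
    then have "g = of_int p * hconj s" using s by (metis mult.assoc mult_1_right)
    then have "of_int p ldvd x" using g(2)[OF x(1)] by (metis ldvdI ldvd_trans)
    then show ?thesis using x(2) by blast
  qed
  moreover have "y \<in> I" if "g ldvd y" for y using that g(1) closed(2) by (auto simp: ldvd_def)
  ultimately show ?thesis using g by blast
qed

text \<open>The right ideal generated by \<open>x\<close> and \<open>p\<close> contains no unit:
  modulo \<open>p\<close> the norm of \<open>x * a + of_int p * b\<close> is that of
  \<open>x * a\<close>, hence 0.\<close>

lemma common_left_divisor:
  assumes p: "prime p" and px: "p dvd hN x" and npx: "\<not> of_int p ldvd x"
  obtains g where "hN g = p" "\<And>y. g ldvd y \<longleftrightarrow> (\<exists>a b. y = x * a + of_int p * b)"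
proof -
  define I where "I = {y. \<exists>a b. y = x * a + of_int p * b}"
  have cl1: "y - z \<in> I" if yz: "y \<in> I" "z \<in> I" for y z
  proof -
    obtain a b a' b' where "y = x * a + of_int p * b" "z = x * a' + of_int p * b'" using yz unfolding I_def by blast
    then have "y - z = x * (a - a') + of_int p * (b - b')" by (simp add: right_diff_distrib)
    then show ?thesis by (auto simp: I_def)
  qed
  have cl2: "y * z \<in> I" if y: "y \<in> I" for y z
  proof -
    obtain a b where "y = x * a + of_int p * b" using y unfolding I_def by blast
    then have "y * z = x * (a * z) + of_int p * (b * z)" by (simp add: distrib_right mult.assoc)
    then show ?thesis by (auto simp: I_def)
  qed
  have "of_int p = x * 0 + of_int p * 1" "x = x * 1 + of_int p * 0" by simp_all
  then have mem: "of_int p \<in> I" "x \<in> I" unfolding I_def by blast+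
  have nrm: "hN y \<noteq> 1" if y: "y \<in> I" for y
  proof
    assume "hN y = 1"
    obtain a b where "y = x * a + of_int p * b" using y unfolding I_def by blast
    then have "y - of_int p * b = x * a" by simp
    then have "p dvd hN (y - of_int p * b)" using px by (simp add: hN_mult)
    from dvd_diff[OF this hN_diff_of_int_mult[of p y b]] have "p dvd hN y" by simp
    then show False using p \<open>hN y = 1\<close> by (auto simp: prime_int_iff)
  qed
  obtain g where "hN g = p" "\<forall>y. y \<in> I \<longleftrightarrow> g ldvd y"
    using right_ideal_prime_generator[of p I x, OF p cl1 cl2 mem npx nrm] by blast
  then show ?thesis by (intro that[of g]) (auto simp: I_def)
qed

lemma associates_card:
  assumes "hN g > 0"
  shows "card {\<pi>. hN \<pi> = hN g \<and> g ldvd \<pi>} = 24"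
proof -
  have nz: "g \<noteq> 0" using assms by auto
  have "{\<pi>. hN \<pi> = hN g \<and> g ldvd \<pi>} = (\<lambda>u. g * u) ` hunits"
    using assms by (auto simp: ldvd_def hN_mult hunits_def image_def)
  moreover have "inj_on (\<lambda>u. g * u) hunits" using nz by (auto simp: inj_on_def)
  ultimately show ?thesis by (simp add: card_image card_hunits)
qed

lemma same_norm_ldvd_symm:
  assumes "hN g = hN \<pi>" "hN g \<noteq> 0" "g ldvd \<pi>"
  shows "\<pi> ldvd g"
proof -
  obtain u where u: "\<pi> = g * u" using assms by (auto simp: ldvd_def)
  then have "hN u = 1" using assms by (simp add: hN_mult)
  then have "\<pi> * hconj u = g" by (simp add: u mult.assoc mult_hconj)
  then show ?thesis by (auto simp: ldvd_def)
qed

text \<open>A left divisor of \<open>x\<close> of norm \<open>p\<close> also left-divides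
  \<open>p\<close>, hence the generator \<open>g\<close> of the ideal generated by both. Equal norms
  make it an associate of \<open>g\<close>, so the divisors are exactly the products of
  \<open>g\<close> with the 24 units.\<close>

lemma left_divisors_of_norm_p:
  assumes p: "prime p" and px: "p dvd hN x" and npx: "\<not> of_int p ldvd x"
  shows "card {\<pi>. hN \<pi> = p \<and> \<pi> ldvd x} = 24"
    and "\<And>\<pi> \<pi>'. hN \<pi> = p \<Longrightarrow> \<pi> ldvd x \<Longrightarrow> hN \<pi>' = p \<Longrightarrow> \<pi>' ldvd x \<Longrightarrow> \<pi> ldvd \<pi>'"
proof -
  obtain g where g: "hN g = p" "\<And>y. g ldvd y \<longleftrightarrow> (\<exists>a b. y = x * a + of_int p * b)"
    using common_left_divisor[OF assms] by blast
  have p0: "p > 0" using p by (simp add: prime_gt_0_int)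
  have gx: "g ldvd x" unfolding g(2) by (rule exI[of _ 1], rule exI[of _ 0]) simp
  have 1: "\<pi> ldvd g" if "hN \<pi> = p" "\<pi> ldvd x" for \<pi>
  proof -
    obtain a b where "g = x * a + of_int p * b" using g(2)[of g] by auto
    moreover have "\<pi> ldvd of_int p" using ldvd_hN[of \<pi>] that by simp
    ultimately show ?thesis using that by (simp add: ldvd_add ldvd_mult_right)
  qed
  have 2: "g ldvd \<pi>" if "hN \<pi> = p" "\<pi> ldvd x" for \<pi>
    using same_norm_ldvd_symm[of \<pi> g] 1[OF that] that g(1) p0 by simp
  have "{\<pi>. hN \<pi> = p \<and> \<pi> ldvd x} = {\<pi>. hN \<pi> = hN g \<and> g ldvd \<pi>}"
  proof (intro equalityI subsetI)
    fix \<pi> assume "\<pi> \<in> {\<pi>. hN \<pi> = hN g \<and> g ldvd \<pi>}"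
    then have "hN \<pi> = p" "\<pi> ldvd g" using same_norm_ldvd_symm[of g \<pi>] g(1) p0 by auto
    then show "\<pi> \<in> {\<pi>. hN \<pi> = p \<and> \<pi> ldvd x}" using ldvd_trans[OF _ gx] by simp
  qed (use 2 g(1) in simp)
  then show "card {\<pi>. hN \<pi> = p \<and> \<pi> ldvd x} = 24" using associates_card[of g] g(1) p0 by simp
  show "\<pi> ldvd \<pi>'" if "hN \<pi> = p" "\<pi> ldvd x" "hN \<pi>' = p" "\<pi>' ldvd x" for \<pi> \<pi>'
    using 1[OF that(1,2)] 2[OF that(3,4)] ldvd_trans by blast
qed

definition one_plus_i :: hur where "one_plus_i = Hur 2 0 (-1) (-1)"

lemma hN_one_plus_i [simp]: "hN one_plus_i = 2" by (simp add: hN_def one_plus_i_def)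

lemma even_hN_iff: "even (hN x) \<longleftrightarrow> even (ha x) \<and> even (hb x + hc x + hd x)"
  by (auto simp: hN_def)

text \<open>Evenness of the norm makes \<open>hconj one_plus_i * x\<close> divisible by 2, and 2 is
  \<open>one_plus_i * hconj one_plus_i\<close>. The prime above 2 is therefore unique.\<close>

lemma one_plus_i_ldvd_iff: "one_plus_i ldvd x \<longleftrightarrow> even (hN x)"
proof
  assume "one_plus_i ldvd x"
  then show "even (hN x)" using ldvd_imp_hN_dvd[of one_plus_i x] by simp
next
  assume "even (hN x)"
  then have ev: "even (ha x)" "even (hb x + hc x + hd x)" by (auto simp: even_hN_iff)
  have "of_int 2 ldvd hconj one_plus_i * x"
    using ev unfolding of_int_ldvd_iff by (auto simp: hur_mult_sel one_plus_i_def)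
  then obtain z where "hconj one_plus_i * x = of_int 2 * z" by (auto simp: ldvd_def)
  then have "one_plus_i * (hconj one_plus_i * x) = of_int 2 * (one_plus_i * z)"
    by (metis mult.assoc of_int_commute_hur)
  then have "of_int 2 * x = of_int 2 * (one_plus_i * z)"
    by (metis mult.assoc mult_hconj(1) hN_one_plus_i)
  then have "x = one_plus_i * z" by simp
  then show "one_plus_i ldvd x" by (rule ldvdI)
qed

text \<open>Pigeonhole: for \<open>a\<close> and \<open>b\<close> from 0 to \<open>(p-1)/2\<close>,
  the residues of \<open>a^2\<close> and those of \<open>-1 - b^2\<close> are \<open>(p+1)/2\<close>
  each, too many to be disjoint modulo \<open>p\<close>.\<close>

lemma square_plus_square_minus_one:
  fixes p :: int
  assumes p: "prime p" "odd p"
  obtains \<alpha> \<beta> where "p dvd \<alpha>\<^sup>2 + \<beta>\<^sup>2 + 1"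
proof -
  define k where "k = (p - 1) div 2"
  have p0: "p > 0" using p by (simp add: prime_gt_0_int)
  have pk: "p = 2 * k + 1" using p(2) by (auto simp: k_def elim!: oddE)
  have k0: "k \<ge> 0" using p0 pk by linarith
  have inj: "a = b" if "a \<in> {0..k}" "b \<in> {0..k}" "p dvd a\<^sup>2 - b\<^sup>2" for a b
  proof -
    have "p dvd (a - b) * (a + b)" using that(3) by (simp add: power2_eq_square algebra_simps)
    then consider "p dvd a - b" | "p dvd a + b" using p(1) by (auto simp: prime_dvd_mult_iff)
    then show ?thesis
    proof cases
      case 1
      have "\<bar>a - b\<bar> < p" using that pk by auto
      then show ?thesis using 1 dvd_imp_le_int[of "a - b" p] p0 by (cases "a - b = 0") auto
    next
      case 2
      have "a + b < p" "a + b \<ge> 0" using that pk by auto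
      then have "a + b = 0" using 2 zdvd_imp_le[of p "a + b"] by (cases "a + b = 0") auto
      then show ?thesis using that by auto
    qed
  qed
  define A where "A = (\<lambda>a. a\<^sup>2 mod p) ` {0..k}"
  define B where "B = (\<lambda>b. (- 1 - b\<^sup>2) mod p) ` {0..k}"
  have "inj_on (\<lambda>a. a\<^sup>2 mod p) {0..k}"
    by (rule inj_onI) (auto simp: mod_eq_dvd_iff intro: inj)
  then have cA: "card A = nat (k + 1)" by (simp add: A_def card_image)
  have "inj_on (\<lambda>b. (- 1 - b\<^sup>2) mod p) {0..k}"
  proof (rule inj_onI)
    fix a b assume ab: "a \<in> {0..k}" "b \<in> {0..k}" "(- 1 - a\<^sup>2) mod p = (- 1 - b\<^sup>2) mod p"
    then have "p dvd (- 1 - a\<^sup>2) - (- 1 - b\<^sup>2)" by (simp add: mod_eq_dvd_iff)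
    moreover have "(- 1 - a\<^sup>2) - (- 1 - b\<^sup>2) = b\<^sup>2 - a\<^sup>2" by simp
    ultimately show "a = b" using inj[of b a] ab by simp
  qed
  then have cB: "card B = nat (k + 1)" by (simp add: B_def card_image)
  have "A \<union> B \<subseteq> {0..<p}" using p0 by (auto simp: A_def B_def)
  then have "card (A \<union> B) \<le> nat p" using card_mono[of "{0..<p}" "A \<union> B"] by simp
  moreover have "nat p < nat (k + 1) + nat (k + 1)" using pk k0 by simp
  ultimately have "A \<inter> B \<noteq> {}"
    using card_Un_disjoint[of A B] cA cB by (auto simp: A_def B_def)
  then obtain a b where "a\<^sup>2 mod p = (- 1 - b\<^sup>2) mod p" by (auto simp: A_def B_def)
  then have "p dvd a\<^sup>2 - (- 1 - b\<^sup>2)" by (simp add: mod_eq_dvd_iff)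
  then show ?thesis by (intro that[of a b]) (simp add: algebra_simps)
qed

text \<open>Modulo an odd prime \<open>p\<close> the order becomes the ring of 2 by 2 matrices via
  \<open>i \<mapsto> (0, -1; 1, 0)\<close> and \<open>j \<mapsto> (\<alpha>, \<beta>; \<beta>, -\<alpha>)\<close>, where \<open>\<alpha>\<^sup>2 + \<beta>\<^sup>2 = -1\<close>. The matrix of \<open>2 x\<close> is used, to
  stay integral; the right ideals of norm \<open>p\<close> are the annihilators of row vectors \<open>(s, t)\<close>.\<close>

context
  fixes p \<alpha> \<beta> :: int
  assumes p: "prime p" "odd p" and ab: "p dvd \<alpha>\<^sup>2 + \<beta>\<^sup>2 + 1"
begin

definition dm11 :: "hur \<Rightarrow> int" where "dm11 x = ha x + \<alpha> * (ha x + 2 * hc x) - \<beta> * (ha x + 2 * hd x)"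
definition dm12 :: "hur \<Rightarrow> int" where "dm12 x = - (ha x + 2 * hb x) + \<beta> * (ha x + 2 * hc x) + \<alpha> * (ha x + 2 * hd x)"
definition dm21 :: "hur \<Rightarrow> int" where "dm21 x = (ha x + 2 * hb x) + \<beta> * (ha x + 2 * hc x) + \<alpha> * (ha x + 2 * hd x)"
definition dm22 :: "hur \<Rightarrow> int" where "dm22 x = ha x - \<alpha> * (ha x + 2 * hc x) + \<beta> * (ha x + 2 * hd x)"
lemmas dm_defs = dm11_def dm12_def dm21_def dm22_def

text \<open>The factor 2 appears because the matrices of \<open>2 * x\<close> and
  \<open>2 * y\<close> multiply to that of \<open>4 * x * y\<close>.\<close>

lemma dm_mult:
  "p dvd dm11 x * dm11 y + dm12 x * dm21 y - 2 * dm11 (x * y)"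
  "p dvd dm11 x * dm12 y + dm12 x * dm22 y - 2 * dm12 (x * y)"
  "p dvd dm21 x * dm11 y + dm22 x * dm21 y - 2 * dm21 (x * y)"
  "p dvd dm21 x * dm12 y + dm22 x * dm22 y - 2 * dm22 (x * y)"
proof -
  define x2 where "x2 = ha x + 2 * hc x"
  define x3 where "x3 = ha x + 2 * hd x"
  define y2 where "y2 = ha y + 2 * hc y"
  define y3 where "y3 = ha y + 2 * hd y"
  have "dm11 x * dm11 y + dm12 x * dm21 y - 2 * dm11 (x * y) = (\<alpha>\<^sup>2 + \<beta>\<^sup>2 + 1) * ((x2 * y2 + x3 * y3))"
    by (simp add: x2_def x3_def y2_def y3_def dm_defs hur_mult_sel power2_eq_square algebra_simps)
  then show "p dvd dm11 x * dm11 y + dm12 x * dm21 y - 2 * dm11 (x * y)" using ab by (simp only: dvd_mult2)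
  have "dm11 x * dm12 y + dm12 x * dm22 y - 2 * dm12 (x * y) = (\<alpha>\<^sup>2 + \<beta>\<^sup>2 + 1) * ((x2 * y3 - x3 * y2))"
    by (simp add: x2_def x3_def y2_def y3_def dm_defs hur_mult_sel power2_eq_square algebra_simps)
  then show "p dvd dm11 x * dm12 y + dm12 x * dm22 y - 2 * dm12 (x * y)" using ab by (simp only: dvd_mult2)
  have "dm21 x * dm11 y + dm22 x * dm21 y - 2 * dm21 (x * y) = (\<alpha>\<^sup>2 + \<beta>\<^sup>2 + 1) * ((x3 * y2 - x2 * y3))"
    by (simp add: x2_def x3_def y2_def y3_def dm_defs hur_mult_sel power2_eq_square algebra_simps)
  then show "p dvd dm21 x * dm11 y + dm22 x * dm21 y - 2 * dm21 (x * y)" using ab by (simp only: dvd_mult2)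
  have "dm21 x * dm12 y + dm22 x * dm22 y - 2 * dm22 (x * y) = (\<alpha>\<^sup>2 + \<beta>\<^sup>2 + 1) * ((x2 * y2 + x3 * y3))"
    by (simp add: x2_def x3_def y2_def y3_def dm_defs hur_mult_sel power2_eq_square algebra_simps)
  then show "p dvd dm21 x * dm12 y + dm22 x * dm22 y - 2 * dm22 (x * y)" using ab by (simp only: dvd_mult2)
qed

lemma dm_det: "p dvd dm11 x * dm22 x - dm12 x * dm21 x - 4 * hN x"
proof -
  have "dm11 x * dm22 x - dm12 x * dm21 x - 4 * hN x
      = (\<alpha>\<^sup>2 + \<beta>\<^sup>2 + 1) * (- ((ha x + 2 * hc x)\<^sup>2 + (ha x + 2 * hd x)\<^sup>2))"
    by (simp add: dm_defs hN_def power2_eq_square algebra_simps)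
  then show ?thesis using ab by (simp only: dvd_mult2)
qed

lemma p_dvd_2_iff: "p dvd 2 * z \<longleftrightarrow> p dvd z"
  using p(2) coprime_dvd_mult_right_iff[of p 2 z] by simp

text \<open>The matrices of 1, i, j, k are linearly independent modulo the odd prime
  \<open>p\<close>.\<close>

lemma dm_eq_0_imp:
  assumes "p dvd dm11 x" "p dvd dm12 x" "p dvd dm21 x" "p dvd dm22 x"
  shows "of_int p ldvd x"
proof -
  define x2 where "x2 = ha x + 2 * hc x"
  define x3 where "x3 = ha x + 2 * hd x"
  have "p dvd dm11 x + dm22 x" using assms by simp
  then have "p dvd 2 * ha x" by (simp add: dm_defs)
  then have a: "p dvd ha x" by (simp add: p_dvd_2_iff)
  have "p dvd dm21 x - dm12 x" using assms by simp
  then have "p dvd 2 * (ha x + 2 * hb x)" by (simp add: dm_defs algebra_simps)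
  then have "p dvd ha x + 2 * hb x" by (simp only: p_dvd_2_iff)
  then have b: "p dvd hb x" using a by (simp add: dvd_add_right_iff p_dvd_2_iff)
  have "p dvd dm11 x - ha x" "p dvd dm21 x - (ha x + 2 * hb x)" using assms a b by simp_all
  then have e: "p dvd \<alpha> * x2 - \<beta> * x3" "p dvd \<beta> * x2 + \<alpha> * x3" by (simp_all add: dm_defs x2_def x3_def)
  have "p dvd (\<alpha>\<^sup>2 + \<beta>\<^sup>2 + 1) * x2 - (\<alpha> * (\<alpha> * x2 - \<beta> * x3) + \<beta> * (\<beta> * x2 + \<alpha> * x3))"
    by (rule dvd_diff[OF dvd_mult2[OF ab] dvd_add[OF dvd_mult[OF e(1)] dvd_mult[OF e(2)]]])
  also have "(\<alpha>\<^sup>2 + \<beta>\<^sup>2 + 1) * x2 - (\<alpha> * (\<alpha> * x2 - \<beta> * x3) + \<beta> * (\<beta> * x2 + \<alpha> * x3)) = x2" by (simp add: power2_eq_square algebra_simps)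
  finally have c: "p dvd x2" .
  have "p dvd (\<alpha>\<^sup>2 + \<beta>\<^sup>2 + 1) * x3 - (\<alpha> * (\<beta> * x2 + \<alpha> * x3) - \<beta> * (\<alpha> * x2 - \<beta> * x3))"
    by (rule dvd_diff[OF dvd_mult2[OF ab] dvd_diff[OF dvd_mult[OF e(2)] dvd_mult[OF e(1)]]])
  also have "(\<alpha>\<^sup>2 + \<beta>\<^sup>2 + 1) * x3 - (\<alpha> * (\<beta> * x2 + \<alpha> * x3) - \<beta> * (\<alpha> * x2 - \<beta> * x3)) = x3" by (simp add: power2_eq_square algebra_simps)
  finally have d: "p dvd x3" .
  have "p dvd 2 * hc x" "p dvd 2 * hd x" using a c d by (simp_all add: x2_def x3_def dvd_add_right_iff)
  then show ?thesis using a b by (simp add: of_int_ldvd_iff p_dvd_2_iff)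
qed

definition row_ideal :: "int \<times> int \<Rightarrow> hur set" where
  "row_ideal l = {x. p dvd fst l * dm11 x + snd l * dm21 x \<and> p dvd fst l * dm12 x + snd l * dm22 x}"

text \<open>Representatives of the \<open>p + 1\<close> points of the projective line over the field
  with \<open>p\<close> elements.\<close>

definition prows :: "(int \<times> int) set" where
  "prows = insert (0, 1) ((\<lambda>t. (1, t)) ` {0..<p})"

lemma p_gt_0: "p > 0" using p by (simp add: prime_gt_0_int)

lemma card_prows: "card prows = nat p + 1" "finite prows"
proof -
  have "card ((\<lambda>t::int. (1::int, t)) ` {0..<p}) = nat p" by (subst card_image) (auto simp: inj_on_def)
  then show "card prows = nat p + 1" unfolding prows_def by (subst card_insert_disjoint) auto
qed (simp add: prows_def)

lemma row_ideal_diff: "x \<in> row_ideal l \<Longrightarrow> y \<in> row_ideal l \<Longrightarrow> x - y \<in> row_ideal l"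
proof -
  assume "x \<in> row_ideal l" "y \<in> row_ideal l"
  then have "p dvd (fst l * dm11 x + snd l * dm21 x) - (fst l * dm11 y + snd l * dm21 y)"
    "p dvd (fst l * dm12 x + snd l * dm22 x) - (fst l * dm12 y + snd l * dm22 y)"
    by (auto simp: row_ideal_def)
  then show ?thesis by (simp add: row_ideal_def dm_defs algebra_simps)
qed

lemma row_ideal_mult:
  assumes "x \<in> row_ideal l"
  shows "x * y \<in> row_ideal l"
proof -
  obtain s t where l: "l = (s, t)" by (cases l)
  have e: "p dvd s * dm11 x + t * dm21 x" "p dvd s * dm12 x + t * dm22 x"
    using assms by (auto simp: row_ideal_def l)
  have "p dvd (s * dm11 x + t * dm21 x) * dm11 y + (s * dm12 x + t * dm22 x) * dm21 y
      - s * (dm11 x * dm11 y + dm12 x * dm21 y - 2 * dm11 (x * y))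
      - t * (dm21 x * dm11 y + dm22 x * dm21 y - 2 * dm21 (x * y))"
    by (rule dvd_diff[OF dvd_diff[OF dvd_add[OF dvd_mult2[OF e(1)] dvd_mult2[OF e(2)]]
      dvd_mult[OF dm_mult(1)]] dvd_mult[OF dm_mult(3)]])
  also have "\<dots> = 2 * (s * dm11 (x * y) + t * dm21 (x * y))" by (simp add: algebra_simps)
  finally have 1: "p dvd s * dm11 (x * y) + t * dm21 (x * y)" by (simp only: p_dvd_2_iff)
  have "p dvd (s * dm11 x + t * dm21 x) * dm12 y + (s * dm12 x + t * dm22 x) * dm22 y
      - s * (dm11 x * dm12 y + dm12 x * dm22 y - 2 * dm12 (x * y))
      - t * (dm21 x * dm12 y + dm22 x * dm22 y - 2 * dm22 (x * y))"
    by (rule dvd_diff[OF dvd_diff[OF dvd_add[OF dvd_mult2[OF e(1)] dvd_mult2[OF e(2)]]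
      dvd_mult[OF dm_mult(2)]] dvd_mult[OF dm_mult(4)]])
  also have "\<dots> = 2 * (s * dm12 (x * y) + t * dm22 (x * y))" by (simp add: algebra_simps)
  finally have "p dvd s * dm12 (x * y) + t * dm22 (x * y)" by (simp only: p_dvd_2_iff)
  with 1 show ?thesis by (simp add: row_ideal_def l)
qed

lemma prows_not_both: "l \<in> prows \<Longrightarrow> \<not> (p dvd fst l \<and> p dvd snd l)"
  using p by (auto simp: prows_def prime_int_iff)

lemma row_ideal_generator:
  assumes l: "l \<in> prows"
  shows "\<exists>g. hN g = p \<and> (\<forall>y. y \<in> row_ideal l \<longleftrightarrow> g ldvd y)"
proof -
  obtain s t where st: "l = (s, t)" by (cases l)
  have nb: "\<not> (p dvd s \<and> p dvd t)" using prows_not_both[OF l] by (simp add: st)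
  \<comment> \<open>The witness is the quaternion with real part \<open>- t\<close> and imaginary
    coordinates \<open>s, x2, x3\<close>. Modulo \<open>p\<close> its matrix is
    \<open>(-2 t, 0; 2 s, 0)\<close>, which is nonzero and annihilated by the row
    \<open>(s, t)\<close>.\<close>
  define x2 where "x2 = \<alpha> * t - \<beta> * s"
  define x3 where "x3 = - \<beta> * t - \<alpha> * s"
  define x where "x = Hur (- 2 * t) (s + t) (x2 + t) (x3 + t)"
  have xd: "ha x + 2 * hb x = 2 * s" "ha x + 2 * hc x = 2 * x2" "ha x + 2 * hd x = 2 * x3" "ha x = - 2 * t"
    by (simp_all add: x_def)
  have "s * dm11 x + t * dm21 x = 0"
    unfolding dm_defs unfolding xd(1-3) unfolding xd(4) x2_def x3_def by (simp add: algebra_simps)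
  then have 1: "p dvd s * dm11 x + t * dm21 x" by simp
  have "s * dm12 x + t * dm22 x = (\<alpha>\<^sup>2 + \<beta>\<^sup>2 + 1) * (- 2 * (s * s + t * t))"
    unfolding dm_defs unfolding xd(1-3) unfolding xd(4) x2_def x3_def by (simp add: power2_eq_square algebra_simps)
  then have "p dvd s * dm12 x + t * dm22 x" using ab by (simp only: dvd_mult2)
  with 1 have xI: "x \<in> row_ideal l" by (simp add: row_ideal_def st)
  have "\<not> of_int p ldvd x"
  proof
    assume "of_int p ldvd x"
    then have "p dvd 2 * t" "p dvd s + t" by (auto simp: of_int_ldvd_iff x_def)
    then have "p dvd t" "p dvd s + t" by (simp_all add: p_dvd_2_iff)
    then show False using nb by (simp add: dvd_add_left_iff)
  qed
  moreover have "of_int p \<in> row_ideal l" by (simp add: row_ideal_def dm_defs)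
  moreover have "hN y \<noteq> 1" if "y \<in> row_ideal l" for y
  proof
    assume "hN y = 1"
    then have "1 = y * hconj y" by (simp add: mult_hconj)
    then have "1 \<in> row_ideal l" using row_ideal_mult[OF that, of "hconj y"] by simp
    then have "p dvd s * 2" "p dvd t * 2" by (simp_all add: row_ideal_def dm_defs st)
    then show False using nb p_dvd_2_iff[of s] p_dvd_2_iff[of t] by (simp add: mult.commute)
  qed
  ultimately show ?thesis
    using right_ideal_prime_generator[OF p(1) row_ideal_diff row_ideal_mult _ xI] by blast
qed

lemma norm_p_not_ldvd:
  assumes "hN \<pi> = p"
  shows "\<not> of_int p ldvd \<pi>"
proof
  assume "of_int p ldvd \<pi>"
  then have "p\<^sup>2 dvd p" using ldvd_imp_hN_dvd[of "of_int p" \<pi>] assms by simp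
  then have "p * p dvd p * 1" by (simp add: power2_eq_square)
  then have "p dvd 1" using p_gt_0 by (simp only: dvd_mult_cancel_left) simp
  then show False using p by (auto simp: prime_int_iff)
qed

text \<open>Modulo \<open>p\<close> the determinant is \<open>4 * hN \<pi>\<close>, that is 0, so
  some nonzero row annihilates the matrix; it can be scaled to an element of
  \<open>prows\<close>.\<close>

lemma in_some_row_ideal:
  assumes "hN \<pi> = p"
  shows "\<exists>l\<in>prows. \<pi> \<in> row_ideal l"
proof -
  have "p dvd (dm11 \<pi> * dm22 \<pi> - dm12 \<pi> * dm21 \<pi> - 4 * hN \<pi>) + 4 * hN \<pi>"
    using dm_det[of \<pi>] assms by (intro dvd_add) auto
  then have det: "p dvd dm11 \<pi> * dm22 \<pi> - dm12 \<pi> * dm21 \<pi>" by simp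
  have inv: "\<exists>c\<in>{0..<p}. p dvd a + c * b" if nb: "\<not> p dvd b" for a b
  proof -
    have "coprime b p" using prime_imp_coprime[OF p(1) nb] by (simp add: ac_simps)
    then obtain u where "[b * u = 1] (mod p)" using cong_solve_coprime_int by blast
    then have "p dvd b * u - 1" by (simp add: cong_iff_dvd_diff)
    from dvd_mult2[OF this, of "- a"] have "p dvd a - a * (b * u)" by (simp add: algebra_simps)
    moreover have "((- a * u) mod p) mod p = (- a * u) mod p" by simp
    then have "p dvd (- a * u) mod p - (- a * u)" by (simp only: mod_eq_dvd_iff)
    from dvd_mult2[OF this, of b] have "p dvd ((- a * u) mod p) * b - (- a * u) * b"
      by (simp only: left_diff_distrib)
    ultimately have "p dvd (a - a * (b * u)) + (((- a * u) mod p) * b - (- a * u) * b)" by (rule dvd_add)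
    also have "\<dots> = a + ((- a * u) mod p) * b" by (simp add: algebra_simps)
    finally show ?thesis using p_gt_0 by (intro bexI[of _ "(- a * u) mod p"]) auto
  qed
  consider "\<not> p dvd dm21 \<pi>" | "p dvd dm21 \<pi>" "\<not> p dvd dm22 \<pi>" | "p dvd dm21 \<pi>" "p dvd dm22 \<pi>" by blast
  then show ?thesis
  proof cases
    case 1
    obtain c where c: "c \<in> {0..<p}" "p dvd dm11 \<pi> + c * dm21 \<pi>" using inv[OF 1] by blast
    have "p dvd (dm11 \<pi> + c * dm21 \<pi>) * dm22 \<pi> - (dm11 \<pi> * dm22 \<pi> - dm12 \<pi> * dm21 \<pi>)"
      by (rule dvd_diff[OF dvd_mult2[OF c(2)] det])
    then have "p dvd dm21 \<pi> * (dm12 \<pi> + c * dm22 \<pi>)" by (simp add: algebra_simps)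
    then have "p dvd dm12 \<pi> + c * dm22 \<pi>" using 1 p(1) by (simp add: prime_dvd_mult_iff)
    then show ?thesis using c by (intro bexI[of _ "(1, c)"]) (auto simp: row_ideal_def prows_def)
  next
    case 2
    obtain c where c: "c \<in> {0..<p}" "p dvd dm12 \<pi> + c * dm22 \<pi>" using inv[OF 2(2)] by blast
    have "p dvd (dm11 \<pi> * dm22 \<pi> - dm12 \<pi> * dm21 \<pi>) + (dm12 \<pi> + c * dm22 \<pi>) * dm21 \<pi>"
      by (rule dvd_add[OF det dvd_mult2[OF c(2)]])
    then have "p dvd dm22 \<pi> * (dm11 \<pi> + c * dm21 \<pi>)" by (simp add: algebra_simps)
    then have "p dvd dm11 \<pi> + c * dm21 \<pi>" using 2 p(1) by (simp add: prime_dvd_mult_iff)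
    then show ?thesis using c by (intro bexI[of _ "(1, c)"]) (auto simp: row_ideal_def prows_def)
  next
    case 3
    then show ?thesis by (intro bexI[of _ "(0, 1)"]) (auto simp: row_ideal_def prows_def)
  qed
qed

text \<open>Two different points of the projective line span the space of rows, so the matrix
  vanishes modulo \<open>p\<close>.\<close>

lemma row_ideals_disjoint:
  assumes "l \<in> prows" "l' \<in> prows" "l \<noteq> l'" "x \<in> row_ideal l" "x \<in> row_ideal l'"
  shows "of_int p ldvd x"
proof -
  have main: "of_int p ldvd x"
    if "x \<in> row_ideal (1, a)" "x \<in> row_ideal l'" "l' = (0, 1) \<or> l' = (1, b) \<and> \<not> p dvd a - b" for a b l'
  proof -
    have e: "p dvd dm11 x + a * dm21 x" "p dvd dm12 x + a * dm22 x" using that(1) by (auto simp: row_ideal_def)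
    have e2: "p dvd dm21 x \<and> p dvd dm22 x"
      using that(3)
    proof
      assume "l' = (0, 1)" then show ?thesis using that(2) by (auto simp: row_ideal_def)
    next
      assume b: "l' = (1, b) \<and> \<not> p dvd a - b"
      then have e': "p dvd dm11 x + b * dm21 x" "p dvd dm12 x + b * dm22 x"
        using that(2) by (auto simp: row_ideal_def)
      have "p dvd (a - b) * dm21 x" "p dvd (a - b) * dm22 x"
        using dvd_diff[OF e(1) e'(1)] dvd_diff[OF e(2) e'(2)] by (simp_all add: left_diff_distrib)
      then show ?thesis using b p(1) by (simp add: prime_dvd_mult_iff)
    qed
    then have "p dvd dm11 x" "p dvd dm12 x" using e by (simp_all add: dvd_add_left_iff)
    then show ?thesis using e2 by (intro dm_eq_0_imp) auto
  qed
  have nd: "\<not> p dvd a - b" if "a \<in> {0..<p}" "b \<in> {0..<p}" "a \<noteq> b" for a b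
  proof
    assume "p dvd a - b"
    then have "a mod p = b mod p" by (simp add: mod_eq_dvd_iff)
    then show False using that by simp
  qed
  have cases: "l = (0, 1) \<or> (\<exists>a\<in>{0..<p}. l = (1, a))" if "l \<in> prows" for l
    using that by (auto simp: prows_def)
  show ?thesis
  proof (cases "l = (0, 1)")
    case True
    then obtain b where "l' = (1, b)" using cases[OF assms(2)] assms(3) by auto
    then show ?thesis using main[of b l undefined] assms(4,5) True by simp
  next
    case False
    then obtain a where a: "l = (1, a)" "a \<in> {0..<p}" using cases[OF assms(1)] by auto
    show ?thesis
    proof (cases "l' = (0, 1)")
      case True
      then show ?thesis using main[of a l' undefined] assms(4,5) a by simp
    next
      case False
      then obtain b where b: "l' = (1, b)" "b \<in> {0..<p}" using cases[OF assms(2)] by auto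
      then have "\<not> p dvd a - b" using nd a assms(3) by auto
      then show ?thesis using main[of a l' b] assms(4,5) a b by simp
    qed
  qed
qed

text \<open>An element of norm \<open>p\<close> generates exactly one of the \<open>p + 1\<close>
  row ideals, and each of these has 24 generators.\<close>

lemma card_norm_p: "card {\<pi>. hN \<pi> = p} = 24 * (nat p + 1)"
proof -
  have eq: "{\<pi>. hN \<pi> = p} = (\<Union>l\<in>prows. {\<pi>. hN \<pi> = p \<and> \<pi> \<in> row_ideal l})"
    using in_some_row_ideal by auto
  have 24: "card {\<pi>. hN \<pi> = p \<and> \<pi> \<in> row_ideal l} = 24" if l: "l \<in> prows" for l
  proof -
    obtain g where "hN g = p" "\<forall>y. y \<in> row_ideal l \<longleftrightarrow> g ldvd y" using row_ideal_generator[OF l] by blast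
    then show ?thesis using associates_card[of g] p_gt_0 by simp
  qed
  have "card {\<pi>. hN \<pi> = p} = (\<Sum>l\<in>prows. card {\<pi>. hN \<pi> = p \<and> \<pi> \<in> row_ideal l})"
    unfolding eq
  proof (rule card_UN_disjoint)
    show "finite prows" by (rule card_prows)
    show "\<forall>i\<in>prows. finite {\<pi>. hN \<pi> = p \<and> \<pi> \<in> row_ideal i}" using finite_hN[of p] by simp
    show "\<forall>i\<in>prows. \<forall>j\<in>prows. i \<noteq> j \<longrightarrow>
       {\<pi>. hN \<pi> = p \<and> \<pi> \<in> row_ideal i} \<inter> {\<pi>. hN \<pi> = p \<and> \<pi> \<in> row_ideal j} = {}"
      using row_ideals_disjoint norm_p_not_ldvd by blast
  qed
  also have "\<dots> = 24 * (nat p + 1)" using 24 card_prows by simp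
  finally show ?thesis .
qed

end

lemma card_norm_odd_prime:
  assumes "prime p" "odd p"
  shows "card {\<pi>. hN \<pi> = p} = 24 * (nat p + 1)"
  using square_plus_square_minus_one[OF assms] card_norm_p[OF assms] by metis

section \<open>Counting the left divisors of given norm\<close>

definition ldivs :: "int \<Rightarrow> hur \<Rightarrow> hur set" where
  "ldivs n w = {u. hN u = n \<and> u ldvd w}"

definition odd_cd :: "int \<Rightarrow> int \<Rightarrow> hur \<Rightarrow> int set" where
  "odd_cd n m w = {d. d > 0 \<and> odd d \<and> d dvd n \<and> d dvd m \<and> of_int d ldvd w}"

lemma finite_ldivs [simp]: "finite (ldivs n w)"
  unfolding ldivs_def using finite_hN[of n] by simp

lemma finite_odd_cd: "n > 0 \<Longrightarrow> finite (odd_cd n m w)"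
  by (rule finite_subset[of _ "{1..n}"]) (auto simp: odd_cd_def dest: zdvd_imp_le)

lemma card_ldivs_step:
  assumes "hN \<pi> = p" "p > 0" "w = \<pi> * w'" "n = p * n'" "\<And>u. u \<in> ldivs n w \<Longrightarrow> \<pi> ldvd u"
  shows "card (ldivs n w) = card (ldivs n' w')"
proof -
  have nz: "\<pi> \<noteq> 0" using assms by auto
  have "ldivs n w = (\<lambda>u. \<pi> * u) ` ldivs n' w'"
  proof (intro equalityI subsetI)
    fix u assume u: "u \<in> ldivs n w"
    then obtain u' where u': "u = \<pi> * u'" using assms(5) by (auto simp: ldvd_def)
    have "u' \<in> ldivs n' w'" using u assms nz unfolding ldivs_def u' by (auto simp: hN_mult ldvd_mult_cancel)
    then show "u \<in> (\<lambda>u. \<pi> * u) ` ldivs n' w'" by (auto simp: u')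
  next
    fix u assume "u \<in> (\<lambda>u. \<pi> * u) ` ldivs n' w'"
    then show "u \<in> ldivs n w" using assms nz by (auto simp: ldivs_def hN_mult ldvd_mult_cancel)
  qed
  then show ?thesis using nz by (simp add: card_image inj_on_def)
qed

text \<open>Multiplication by \<open>hconj \<pi>\<close> turns \<open>w\<close> into
  \<open>of_int p * w'\<close>. An odd \<open>d\<close> dividing \<open>w\<close> is coprime to
  \<open>p\<close>, either because \<open>p = 2\<close> or because \<open>p\<close> does not divide
  \<open>w\<close>; so it divides \<open>w'\<close>.\<close>

lemma odd_cd_step:
  assumes "hN \<pi> = p" "prime p" "w = \<pi> * w'" "n = p * n'" "p = 2 \<or> \<not> of_int p ldvd w"
  shows "odd_cd n m w = odd_cd n' m w'"
proof -
  have "d dvd n \<longleftrightarrow> d dvd n'" "of_int d ldvd w \<longleftrightarrow> of_int d ldvd w'"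
    if d: "odd d" "of_int d ldvd w \<or> of_int d ldvd w'" for d
  proof -
    have dw: "of_int d ldvd w" using d(2) assms(3) of_int_ldvd_mult_left by auto
    have cop: "coprime d p"
    proof (cases "p = 2")
      case True then show ?thesis using d(1) by simp
    next
      case False
      then have "\<not> p dvd d"
        using assms(5) dw ldvd_trans[of "of_int p" "of_int d" w] by (auto simp: of_int_ldvd_iff)
      then show ?thesis using prime_imp_coprime[OF assms(2)] by (simp add: ac_simps)
    qed
    show "d dvd n \<longleftrightarrow> d dvd n'" using cop assms(4) by (simp add: coprime_dvd_mult_right_iff)
    have "hconj \<pi> * w = of_int p * w'"
      using assms(1,3) by (simp add: mult.assoc[symmetric] mult_hconj)
    then have "of_int d ldvd of_int p * w'" using of_int_ldvd_mult_left[OF dw, of "hconj \<pi>"] by simp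
    then have "of_int d ldvd w'" using cop by (simp add: of_int_ldvd_of_int_mult_iff)
    then show "of_int d ldvd w \<longleftrightarrow> of_int d ldvd w'" using dw by simp
  qed
  then show ?thesis unfolding odd_cd_def by blast
qed

text \<open>If \<open>d\<close> divides \<open>x\<close>, all \<open>24 * (p + 1)\<close> elements
  qualify; if \<open>d\<close> does not divide \<open>p * x\<close>, none does. In between,
  \<open>d = p * e\<close> and \<open>x = e * y\<close> with \<open>y\<close> not divisible by
  \<open>p\<close>, and the condition becomes \<open>\<pi> ldvd y\<close>, with 24 solutions. The
  assumption on the norm of \<open>x\<close> supplies \<open>p dvd hN y\<close>.\<close>

lemma count_norm_p_divisors:
  assumes p: "prime p" "odd p" and d: "d > 0" and div: "p dvd d \<Longrightarrow> p * d\<^sup>2 dvd p\<^sup>2 * hN x"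
  shows "int (card {\<pi>. hN \<pi> = p \<and> of_int d ldvd hconj \<pi> * x}) =
    24 * ((if of_int d ldvd x then p else 0) + (if of_int d ldvd of_int p * x then 1 else 0))"
proof -
  have p0: "p > 0" using p by (simp add: prime_gt_0_int)
  have px: "of_int d ldvd of_int p * x" if "of_int d ldvd hconj \<pi> * x" "hN \<pi> = p" for \<pi>
  proof -
    have "of_int d ldvd \<pi> * (hconj \<pi> * x)" using that by (simp add: of_int_ldvd_mult_left)
    then show ?thesis using that by (simp add: mult.assoc[symmetric] mult_hconj)
  qed
  consider "of_int d ldvd x" | "\<not> of_int d ldvd x" "\<not> of_int d ldvd of_int p * x"
    | "\<not> of_int d ldvd x" "of_int d ldvd of_int p * x" by blast
  then show ?thesis
  proof cases
    case 1
    then have "{\<pi>. hN \<pi> = p \<and> of_int d ldvd hconj \<pi> * x} = {\<pi>. hN \<pi> = p}"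
      by (auto simp: of_int_ldvd_mult_left)
    then show ?thesis using card_norm_odd_prime[OF p] 1 p0 by (simp add: of_int_ldvd_mult_left)
  next
    case 2
    then have "{\<pi>. hN \<pi> = p \<and> of_int d ldvd hconj \<pi> * x} = {}" using px by blast
    then have "card {\<pi>. hN \<pi> = p \<and> of_int d ldvd hconj \<pi> * x} = 0" by (simp only: card.empty)
    then show ?thesis using 2 by simp
  next
    case 3
    have "p dvd d"
    proof (rule ccontr)
      assume "\<not> p dvd d"
      then have "coprime d p" using prime_imp_coprime[OF p(1)] by (simp add: ac_simps)
      then show False using 3 of_int_ldvd_of_int_mult_iff by blast
    qed
    then obtain e where e: "d = p * e" by auto
    have nz: "(of_int p :: hur) \<noteq> 0" "(of_int e :: hur) \<noteq> 0" using p0 d e by auto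
    have "of_int e ldvd x" using 3(2) nz(1) by (simp add: e ldvd_mult_cancel)
    then obtain y where y: "x = of_int e * y" by (auto simp: ldvd_def)
    have dd: "of_int d = (of_int e * of_int p :: hur)" by (simp add: e mult.commute flip: of_int_mult)
    have npy: "\<not> of_int p ldvd y" using 3(1) nz by (simp add: dd y ldvd_mult_cancel)
    have iff: "of_int d ldvd hconj \<pi> * x \<longleftrightarrow> \<pi> ldvd y" if pi: "hN \<pi> = p" for \<pi>
    proof -
      have pnz: "\<pi> \<noteq> 0" using pi p0 by auto
      have "hconj \<pi> * x = of_int e * (hconj \<pi> * y)" by (metis y mult.assoc of_int_commute_hur)
      then have "of_int d ldvd hconj \<pi> * x \<longleftrightarrow> of_int p ldvd hconj \<pi> * y"
        using nz by (simp add: dd ldvd_mult_cancel)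
      also have "of_int p = hconj \<pi> * \<pi>" using pi by (simp add: mult_hconj)
      also have "hconj \<pi> * \<pi> ldvd hconj \<pi> * y \<longleftrightarrow> \<pi> ldvd y"
      proof (rule ldvd_mult_cancel)
        show "hconj \<pi> \<noteq> 0" using pi p0 by (metis hN_0 hN_hconj less_irrefl)
      qed
      finally show ?thesis .
    qed
    have "p * (p * e)\<^sup>2 dvd p\<^sup>2 * (e\<^sup>2 * hN y)" using div[OF \<open>p dvd d\<close>] by (simp add: e y hN_mult)
    then have "(p\<^sup>2 * e\<^sup>2) * p dvd (p\<^sup>2 * e\<^sup>2) * hN y" by (simp add: power_mult_distrib algebra_simps)
    then have "p dvd hN y" using p0 d e by (subst (asm) dvd_mult_cancel_left) auto
    then have "card {\<pi>. hN \<pi> = p \<and> \<pi> ldvd y} = 24" using left_divisors_of_norm_p(1)[OF p(1) _ npy] by simp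
    moreover have "{\<pi>. hN \<pi> = p \<and> of_int d ldvd hconj \<pi> * x} = {\<pi>. hN \<pi> = p \<and> \<pi> ldvd y}"
      using iff by auto
    ultimately show ?thesis using 3 by simp
  qed
qed

text \<open>A relation of Hecke type between divisor sums: multiplication by \<open>p\<close> maps
  \<open>A - C\<close> bijectively onto the members of \<open>odd_cd n m (of_int p * x)\<close>
  outside \<open>B\<close>.\<close>

lemma divisor_sum_recursion:
  fixes n m p :: int
  assumes p: "prime p" "odd p" and n: "n > 0" "p dvd n" and N: "p\<^sup>2 * hN x = n * m"
  defines "A \<equiv> {d. d > 0 \<and> odd d \<and> p * d dvd n \<and> d dvd m \<and> of_int d ldvd x}"
    and "B \<equiv> {d. d > 0 \<and> odd d \<and> p * d dvd n \<and> d dvd m \<and> of_int d ldvd of_int p * x}"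
    and "C \<equiv> {d. d > 0 \<and> odd d \<and> p\<^sup>2 * d dvd n \<and> d dvd m \<and> of_int d ldvd x}"
  shows "p * \<Sum>A + \<Sum>B = \<Sum>(odd_cd n m (of_int p * x)) + p * \<Sum>C"
proof -
  define E where "E = odd_cd n m (of_int p * x)"
  have p0: "p > 0" using p by (simp add: prime_gt_0_int)
  have fin: "finite E" unfolding E_def using n by (simp add: finite_odd_cd)
  have sub: "C \<subseteq> A" "B \<subseteq> E"
    unfolding A_def B_def C_def E_def odd_cd_def by (auto simp: power2_eq_square mult.assoc dest: dvd_mult_right)
  have finA: "finite A"
    by (rule finite_subset[of _ "{1..n}"]) (use n in \<open>auto simp: A_def dest!: dvd_mult_right zdvd_imp_le\<close>)
  have pnz: "(of_int p :: hur) \<noteq> 0" using p0 by simp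
  have bij: "(\<Sum>d\<in>A - C. p * d) = \<Sum>(E - B)"
  proof (rule sum.reindex_bij_witness[of _ "\<lambda>e. e div p" "\<lambda>d. p * d"])
    fix d assume d: "d \<in> A - C"
    then obtain f where f: "n = p * d * f" by (auto simp: A_def)
    have "\<not> p dvd f"
    proof
      assume "p dvd f"
      then have "p * d * p dvd n" unfolding f by (intro mult_dvd_mono) auto
      then show False using d by (auto simp: A_def C_def power2_eq_square algebra_simps)
    qed
    obtain m' where m': "m = d * m'" using d by (auto simp: A_def)
    have "of_int d ldvd x" using d by (auto simp: A_def)
    then have "d\<^sup>2 dvd hN x" using ldvd_imp_hN_dvd by fastforce
    \<comment> \<open>The norm equation places the missing factor \<open>p\<close> in
      \<open>m\<close>, because \<open>f\<close> does not contain it.\<close>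
    then have "p\<^sup>2 * d\<^sup>2 dvd p * d * f * (d * m')" using N f m' by (metis dvd_refl mult_dvd_mono)
    then have "(p * d\<^sup>2) * p dvd (p * d\<^sup>2) * (f * m')" by (simp add: power2_eq_square algebra_simps)
    then have "p dvd f * m'" using p0 d by (subst (asm) dvd_mult_cancel_left) (auto simp: A_def)
    then have "p dvd m'" using \<open>\<not> p dvd f\<close> p(1) by (simp add: prime_dvd_mult_iff)
    then have "p * d dvd m" by (simp add: m' mult.commute)
    moreover have "of_int (p * d) ldvd of_int p * x" using \<open>of_int d ldvd x\<close> pnz by (simp add: ldvd_mult_cancel)
    moreover have "\<not> p * (p * d) dvd n"
      using d by (auto simp: A_def C_def power2_eq_square mult.assoc)
    ultimately show "p * d \<in> E - B" using d p p0 by (auto simp: A_def B_def E_def odd_cd_def)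
    show "p * d div p = d" using p0 by simp
  next
    fix e assume e: "e \<in> E - B"
    then obtain f where f: "n = e * f" by (auto simp: E_def odd_cd_def)
    have nd: "\<not> p * e dvd n" using e by (auto simp: E_def odd_cd_def B_def)
    then have "\<not> p dvd f" unfolding f by (metis dvd_refl mult.commute mult_dvd_mono)
    then have "p dvd e" using n(2) p(1) by (auto simp: f prime_dvd_mult_iff)
    then obtain d where d: "e = p * d" by auto
    have "of_int (p * d) ldvd of_int p * x" using e d by (auto simp: E_def odd_cd_def)
    then have "of_int d ldvd x" using pnz by (simp add: ldvd_mult_cancel)
    moreover have "\<not> p\<^sup>2 * d dvd n" using nd d by (simp add: power2_eq_square mult.assoc)
    moreover have "d dvd m" using e d by (auto simp: E_def odd_cd_def dest: dvd_mult_right)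
    moreover have "d > 0" "odd d" "p * d dvd n" using e d p0 by (auto simp: E_def odd_cd_def zero_less_mult_iff)
    ultimately have "d \<in> A - C" by (auto simp: A_def C_def)
    then show "e div p \<in> A - C" "p * (e div p) = e" using d p0 by auto
  qed simp
  have "\<Sum>A = \<Sum>(A - C) + \<Sum>C" "\<Sum>E = \<Sum>(E - B) + \<Sum>B"
    using sum.subset_diff[OF sub(1) finA, of "\<lambda>x. x"] sum.subset_diff[OF sub(2) fin, of "\<lambda>x. x"] by simp_all
  then show ?thesis using bij unfolding E_def[symmetric] by (simp add: sum_distrib_left algebra_simps)
qed

text \<open>Induction on \<open>n\<close> along a prime \<open>p\<close> dividing \<open>n\<close>.
  If \<open>p = 2\<close>, or if \<open>p\<close> does not divide \<open>w\<close>, the divisors of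
  norm \<open>n\<close> share a left factor of norm \<open>p\<close>, which is cancelled. If an odd
  \<open>p\<close> divides \<open>w\<close>, no such factor is distinguished, and the pairs of some
  \<open>\<pi>\<close> of norm \<open>p\<close> and a divisor \<open>u\<close> with
  \<open>\<pi> ldvd u\<close> are counted twice: \<open>u\<close> has 24 or
  \<open>24 * (p + 1)\<close> partners according to whether \<open>p\<close> divides it, and
  \<open>\<pi>\<close> leads to the divisors of \<open>hconj \<pi> * x\<close> of norm
  \<open>n'\<close>.\<close>

theorem card_ldivs:
  assumes "n > 0" "hN w = n * m"
  shows "int (card (ldivs n w)) = 24 * \<Sum>(odd_cd n m w)"
  using assms
proof (induction "nat n" arbitrary: n m w rule: less_induct)
  case less
  note n = less.prems(1) and N = less.prems(2)
  show ?case
  proof (cases "n = 1")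
    case True
    have "ldivs n w = hunits" by (auto simp: ldivs_def hunits_def True ldvd_unit_imp)
    moreover have "odd_cd n m w = {1}" by (auto simp: odd_cd_def True of_int_ldvd_iff)
    ultimately show ?thesis by (simp add: card_hunits)
  next
    case False
    then have "\<not> is_unit n" using n by auto
    then obtain p where p: "prime p" "p dvd n" using prime_divisor_exists[of n] n by auto
    have p0: "p > 1" using p by (simp add: prime_gt_1_int)
    obtain n' where n': "n = p * n'" using p by auto
    have n'0: "n' > 0" using n n' p0 by (simp add: zero_less_mult_iff)
    have lt: "nat n' < nat n" using n' n'0 p0 by (simp add: n')
    have pw: "p dvd hN w" using N n' by simp
    have step: ?thesis if pi: "hN \<pi> = p" "w = \<pi> * w'" "p = 2 \<or> \<not> of_int p ldvd w"
      "\<And>u. u \<in> ldivs n w \<Longrightarrow> \<pi> ldvd u" for \<pi> w'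
    proof -
      have "hN w' = n' * m" using N pi n' p0 by (simp add: hN_mult)
      then have "int (card (ldivs n' w')) = 24 * \<Sum>(odd_cd n' m w')" using less.hyps[OF lt n'0] by simp
      then show ?thesis
        using card_ldivs_step[OF pi(1) _ pi(2) n' pi(4)] odd_cd_step[OF pi(1) p(1) pi(2) n' pi(3), of m] p0 by simp
    qed
    consider "p = 2" | "odd p" "\<not> of_int p ldvd w" | "odd p" "of_int p ldvd w"
      using p by (metis prime_int_iff dvd_refl primes_dvd_imp_eq two_is_prime_nat prime_int_numeral_eq two_is_prime)
    then show ?thesis
    proof cases
      case 1
      obtain w' where "w = one_plus_i * w'" using pw 1 one_plus_i_ldvd_iff[of w] by (auto simp: ldvd_def)
      then show ?thesis
        by (rule step[rotated]) (use 1 n' in \<open>auto simp: ldivs_def one_plus_i_ldvd_iff\<close>)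
    next
      case 2
      have "{\<pi>. hN \<pi> = p \<and> \<pi> ldvd w} \<noteq> {}"
        using left_divisors_of_norm_p(1)[OF p(1) pw 2(2)] by (metis card.empty zero_neq_numeral)
      then obtain \<pi> w' where pi: "hN \<pi> = p" "\<pi> ldvd w" "w = \<pi> * w'" by (auto simp: ldvd_def)
      have "\<pi> ldvd u" if u: "u \<in> ldivs n w" for u
      proof -
        have "p dvd hN u" "u ldvd w" using u n' by (auto simp: ldivs_def)
        moreover have "\<not> of_int p ldvd u" using 2(2) ldvd_trans \<open>u ldvd w\<close> by blast
        ultimately have "{\<pi>. hN \<pi> = p \<and> \<pi> ldvd u} \<noteq> {}"
          using left_divisors_of_norm_p(1)[OF p(1), of u] by (metis card.empty zero_neq_numeral)
        then obtain \<pi>' where "hN \<pi>' = p" "\<pi>' ldvd u" by auto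
        then show ?thesis
          using left_divisors_of_norm_p(2)[OF p(1) pw 2(2) pi(1,2), of \<pi>'] \<open>u ldvd w\<close> ldvd_trans by blast
      qed
      then show ?thesis using step pi 2 by blast
    next
      case 3
      obtain x where x: "w = of_int p * x" using 3 by (auto simp: ldvd_def)
      have N': "p\<^sup>2 * hN x = n * m" using N by (simp add: x hN_of_int_mult)
      define P where "P = {\<pi>. hN \<pi> = p}"
      define U where "U = ldivs n w"
      have fin: "finite P" "finite U" unfolding P_def U_def using finite_hN[of p] by simp_all
      have "(\<Sum>u\<in>U. card {\<pi>\<in>P. \<pi> ldvd u}) = (\<Sum>\<pi>\<in>P. card {u\<in>U. \<pi> ldvd u})"
        unfolding card_eq_sum sum.inter_filter[OF fin(1)] sum.inter_filter[OF fin(2)] by (rule sum.swap)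
      then have double: "(\<Sum>u\<in>U. int (card {\<pi>\<in>P. \<pi> ldvd u})) = (\<Sum>\<pi>\<in>P. int (card {u\<in>U. \<pi> ldvd u}))"
        by (simp only: of_nat_sum[symmetric])
      define A where "A = {d. d > 0 \<and> odd d \<and> p * d dvd n \<and> d dvd m \<and> of_int d ldvd x}"
      define B where "B = {d. d > 0 \<and> odd d \<and> p * d dvd n \<and> d dvd m \<and> of_int d ldvd of_int p * x}"
      define C where "C = {d. d > 0 \<and> odd d \<and> p\<^sup>2 * d dvd n \<and> d dvd m \<and> of_int d ldvd x}"
      define T where "T = {d. d > 0 \<and> odd d \<and> p * d dvd n \<and> d dvd m}"
      have finT: "finite T"
        by (rule finite_subset[of _ "{1..n}"]) (use n in \<open>auto simp: T_def dest!: dvd_mult_right zdvd_imp_le\<close>)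
      have left: "int (card {\<pi>\<in>P. \<pi> ldvd u}) = 24 + (if of_int p ldvd u then 24 * p else 0)" if "u \<in> U" for u
      proof (cases "of_int p ldvd u")
        case True
        have "\<pi> ldvd u" if "\<pi> \<in> P" for \<pi>
          using ldvd_hN[of \<pi>] that True ldvd_trans[of \<pi> "of_int p" u] by (simp add: P_def)
        then have "{\<pi>\<in>P. \<pi> ldvd u} = {\<pi>. hN \<pi> = p}" by (auto simp: P_def)
        then show ?thesis using card_norm_odd_prime[OF p(1) 3(1)] True p0 by simp
      next
        case False
        moreover have "p dvd hN u" using that n' by (auto simp: U_def ldivs_def)
        ultimately show ?thesis using left_divisors_of_norm_p(1)[OF p(1)] by (simp add: P_def)
      qed
      have right: "int (card {u\<in>U. \<pi> ldvd u}) = 24 * \<Sum>{d\<in>T. of_int d ldvd hconj \<pi> * x}" if pi: "\<pi> \<in> P" for \<pi>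
      proof -
        have pi': "hN \<pi> = p" "\<pi> \<noteq> 0" using pi p0 by (auto simp: P_def)
        have w: "w = \<pi> * (hconj \<pi> * x)" using pi' by (simp add: x mult.assoc[symmetric] mult_hconj)
        have "{u\<in>U. \<pi> ldvd u} = (\<lambda>u. \<pi> * u) ` ldivs n' (hconj \<pi> * x)"
          using pi' n' p0 unfolding U_def ldivs_def w
          by (auto simp: hN_mult ldvd_mult_cancel ldvd_def[of \<pi>] image_iff)
        then have "card {u\<in>U. \<pi> ldvd u} = card (ldivs n' (hconj \<pi> * x))"
          using pi' by (simp add: card_image inj_on_def)
        moreover have "p * (p * hN x) = p * (n' * m)" using N' n' by (simp add: power2_eq_square)
        then have "hN (hconj \<pi> * x) = n' * m" using pi' p0 by (simp add: hN_mult)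
        then have "int (card (ldivs n' (hconj \<pi> * x))) = 24 * \<Sum>(odd_cd n' m (hconj \<pi> * x))"
          using less.hyps[OF lt n'0] by simp
        moreover have "odd_cd n' m (hconj \<pi> * x) = {d\<in>T. of_int d ldvd hconj \<pi> * x}"
          using p0 by (auto simp: odd_cd_def T_def n')
        ultimately show ?thesis by simp
      qed
      \<comment> \<open>Such a \<open>u\<close> is \<open>p\<close> times a left divisor of
        \<open>x\<close> of norm \<open>n / p^2\<close>; if \<open>p^2\<close> does not divide
        \<open>n\<close>, both sides are empty.\<close>
      have pU: "int (card {u\<in>U. of_int p ldvd u}) = 24 * \<Sum>C"
      proof (cases "p\<^sup>2 dvd n")
        case True
        then obtain k where k: "n = p\<^sup>2 * k" by auto
        have k0: "k > 0" using n k p0 by (simp add: zero_less_mult_iff)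
        have "{u\<in>U. of_int p ldvd u} = (\<lambda>u. of_int p * u) ` ldivs k x"
          using k p0 unfolding U_def ldivs_def x
          by (auto simp: hN_mult ldvd_mult_cancel ldvd_def[of "of_int p"] image_iff)
        then have "card {u\<in>U. of_int p ldvd u} = card (ldivs k x)"
          using p0 by (simp add: card_image inj_on_def)
        moreover have "hN x = k * m" using N' k p0 by simp
        moreover have "1 * k < p\<^sup>2 * k" using k0 p0 by (intro mult_strict_right_mono) (auto simp: power2_eq_square intro: less_1_mult)
        then have "nat k < nat n" using k k0 n by simp
        ultimately have "int (card {u\<in>U. of_int p ldvd u}) = 24 * \<Sum>(odd_cd k m x)"
          using less.hyps[of k x m] k0 by simp
        also have "odd_cd k m x = C" using p0 by (auto simp: odd_cd_def C_def k)
        finally show ?thesis .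
      next
        case False
        have "{u\<in>U. of_int p ldvd u} = {}"
          using False by (auto simp: U_def ldivs_def ldvd_def hN_mult)
        then have "card {u\<in>U. of_int p ldvd u} = 0" by (simp only: card.empty)
        moreover have "C = {}" using False by (auto simp: C_def dest: dvd_mult_left)
        ultimately show ?thesis by simp
      qed
      have AB: "{d\<in>T. of_int d ldvd x} = A" "{d\<in>T. of_int d ldvd of_int p * x} = B"
        by (auto simp: T_def A_def B_def)
      have "(\<Sum>\<pi>\<in>P. \<Sum>{d\<in>T. of_int d ldvd hconj \<pi> * x}) =
        (\<Sum>\<pi>\<in>P. \<Sum>d\<in>T. if of_int d ldvd hconj \<pi> * x then d else 0)"
        using finT by (simp add: sum.inter_filter)
      also have "\<dots> = (\<Sum>d\<in>T. \<Sum>\<pi>\<in>P. if of_int d ldvd hconj \<pi> * x then d else 0)"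
        by (rule sum.swap)
      also have "\<dots> = (\<Sum>d\<in>T. 24 * (p * (if of_int d ldvd x then d else 0) + (if of_int d ldvd of_int p * x then d else 0)))"
      proof (rule sum.cong[OF refl])
        fix d assume d: "d \<in> T"
        have "(\<Sum>\<pi>\<in>P. if of_int d ldvd hconj \<pi> * x then d else 0) = d * int (card {\<pi>\<in>P. of_int d ldvd hconj \<pi> * x})"
          using fin by (simp add: sum.inter_filter[symmetric])
        also have "{\<pi>\<in>P. of_int d ldvd hconj \<pi> * x} = {\<pi>. hN \<pi> = p \<and> of_int d ldvd hconj \<pi> * x}"
          by (auto simp: P_def)
        also have "p * d\<^sup>2 dvd p\<^sup>2 * hN x"
        proof -
          have "p * d * d dvd n * m" using d by (intro mult_dvd_mono) (auto simp: T_def)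
          then show ?thesis using N' by (simp add: power2_eq_square mult.assoc)
        qed
        then have "int (card {\<pi>. hN \<pi> = p \<and> of_int d ldvd hconj \<pi> * x}) =
           24 * ((if of_int d ldvd x then p else 0) + (if of_int d ldvd of_int p * x then 1 else 0))"
          using d by (intro count_norm_p_divisors[OF p(1) 3(1)]) (auto simp: T_def)
        finally show "(\<Sum>\<pi>\<in>P. if of_int d ldvd hconj \<pi> * x then d else 0) =
          24 * (p * (if of_int d ldvd x then d else 0) + (if of_int d ldvd of_int p * x then d else 0))"
          by (simp add: algebra_simps)
      qed
      also have "\<dots> = 24 * (p * \<Sum>{d\<in>T. of_int d ldvd x} + \<Sum>{d\<in>T. of_int d ldvd of_int p * x})"
        using finT by (simp add: sum_distrib_left[symmetric] sum.distrib sum.inter_filter)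
      also have "\<dots> = 24 * (p * \<Sum>A + \<Sum>B)" by (simp only: AB)
      finally have R: "(\<Sum>\<pi>\<in>P. int (card {u\<in>U. \<pi> ldvd u})) = 24 * (24 * (p * \<Sum>A + \<Sum>B))"
        using right by (simp add: sum_distrib_left[symmetric])
      have "(\<Sum>u\<in>U. int (card {\<pi>\<in>P. \<pi> ldvd u})) = (\<Sum>u\<in>U. 24 + (if of_int p ldvd u then 24 * p else 0))"
        using left by (rule sum.cong[OF refl])
      also have "\<dots> = 24 * int (card U) + 24 * p * int (card {u\<in>U. of_int p ldvd u})"
        using fin by (simp add: sum.distrib sum.inter_filter[symmetric] algebra_simps)
      finally have "24 * int (card U) + 24 * p * (24 * \<Sum>C) = 24 * (24 * (p * \<Sum>A + \<Sum>B))"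
        using double R pU by simp
      moreover have "p * \<Sum>A + \<Sum>B = \<Sum>(odd_cd n m w) + p * \<Sum>C"
        unfolding A_def B_def C_def x by (rule divisor_sum_recursion[OF p(1) 3(1) n p(2) N'])
      ultimately have "int (card U) = 24 * \<Sum>(odd_cd n m w)" by (simp add: algebra_simps)
      then show ?thesis by (simp add: U_def)
    qed
  qed
qed

section \<open>Pairs of integer vectors with given Gram matrix\<close>

definition r3 :: "int \<Rightarrow> nat" where
  "r3 N = card {(x, y, z). x\<^sup>2 + y\<^sup>2 + z\<^sup>2 = (N :: int)}"

lemma finite_three_squares: "finite {(x, y, z). x\<^sup>2 + y\<^sup>2 + z\<^sup>2 = (N :: int)}"
proof (rule finite_subset)
  show "{(x, y, z). x\<^sup>2 + y\<^sup>2 + z\<^sup>2 = N} \<subseteq> {-N..N} \<times> {-N..N} \<times> {-N..N}"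
  proof
    fix v assume "v \<in> {(x, y, z). x\<^sup>2 + y\<^sup>2 + z\<^sup>2 = N}"
    then obtain x y z where v: "v = (x, y, z)" "x\<^sup>2 + y\<^sup>2 + z\<^sup>2 = N" by auto
    have "\<bar>x\<bar> \<le> N" "\<bar>y\<bar> \<le> N" "\<bar>z\<bar> \<le> N"
      using v square_bound[of x] square_bound[of y] square_bound[of z] zero_le_power2[of x] zero_le_power2[of y] zero_le_power2[of z] by linarith+
    then show "v \<in> {-N..N} \<times> {-N..N} \<times> {-N..N}" by (auto simp: v(1))
  qed
qed simp

section \<open>Integral coordinates inside the Hurwitz order\<close>

definition lip :: "hur set" where "lip = {x. even (ha x)}"

text \<open>Here \<open>z\<close> plays the part of the conjugate of the second vector, so that the
  real part \<open>r\<close> of \<open>x * z\<close> is the inner product. That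
  \<open>ha (x * z)\<close> is even also forces integral coordinates on the product.\<close>

definition hpairs :: "int \<Rightarrow> int \<Rightarrow> int \<Rightarrow> (hur \<times> hur) set" where
  "hpairs n m r = {(x, z). hN x = n \<and> hN z = m \<and> ha (x * z) = 2 * r}"

lemma finite_hpairs [simp]: "finite (hpairs n m r)"
proof (rule finite_subset)
  show "hpairs n m r \<subseteq> {x. hN x = n} \<times> {z. hN z = m}" by (auto simp: hpairs_def)
qed (simp add: finite_hN)

definition htrace_set :: "int \<Rightarrow> int \<Rightarrow> hur set" where
  "htrace_set N r = {w. hN w = N \<and> ha w = 2 * r}"

lemma card_hpairs:
  assumes "n > 0"
  shows "card (hpairs n m r) = (\<Sum>w\<in>htrace_set (n * m) r. card (ldivs n w))"
proof -
  have "bij_betw (\<lambda>(x, z). (x * z, x)) (hpairs n m r) (Sigma (htrace_set (n * m) r) (ldivs n))"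
  proof (rule bij_betwI')
    fix a b assume "a \<in> hpairs n m r" "b \<in> hpairs n m r"
    then show "((case a of (x, z) \<Rightarrow> (x * z, x)) = (case b of (x, z) \<Rightarrow> (x * z, x))) = (a = b)"
      using assms by (auto simp: hpairs_def split: prod.splits)
  next
    fix a assume "a \<in> hpairs n m r"
    then show "(case a of (x, z) \<Rightarrow> (x * z, x)) \<in> Sigma (htrace_set (n * m) r) (ldivs n)"
      by (auto simp: hpairs_def htrace_set_def ldivs_def hN_mult ldvd_mult_right split: prod.splits)
  next
    fix b assume "b \<in> Sigma (htrace_set (n * m) r) (ldivs n)"
    then obtain w x where b: "b = (w, x)" "hN w = n * m" "ha w = 2 * r" "hN x = n" "x ldvd w"
      by (auto simp: htrace_set_def ldivs_def)
    then obtain z where z: "w = x * z" by (auto simp: ldvd_def)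
    have "hN z = m" using b z assms by (simp add: hN_mult)
    then show "\<exists>a\<in>hpairs n m r. b = (case a of (x, z) \<Rightarrow> (x * z, x))"
      using b z by (intro bexI[of _ "(x, z)"]) (auto simp: hpairs_def)
  qed
  then have "card (hpairs n m r) = card (Sigma (htrace_set (n * m) r) (ldivs n))" by (rule bij_betw_same_card)
  also have "\<dots> = (\<Sum>w\<in>htrace_set (n * m) r. card (ldivs n w))"
    using finite_hN[of "n * m"] by (intro card_SigmaI) (auto simp: htrace_set_def)
  finally show ?thesis .
qed

lemma even_ha_mult:
  "even (ha (x * y)) \<longleftrightarrow> even (ha x * ha y + ha x * (hb y + hc y + hd y) + (hb x + hc x + hd x) * ha y)"
proof -
  have "ha (x * y) = - (ha x * ha y + ha x * (hb y + hc y + hd y) + (hb x + hc x + hd x) * ha y)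
     - 2 * (hb x * hb y + hc x * hc y + hd x * hd y)"
    by (simp add: hur_mult_sel algebra_simps)
  moreover have "even (- X - 2 * Y) \<longleftrightarrow> even X" for X Y :: int by simp
  ultimately show ?thesis by (simp only:)
qed

lemma even_norm_lip: "even (hN x) \<Longrightarrow> x \<in> lip"
  by (simp add: lip_def even_hN_iff)

text \<open>This is \<open>\<omega>\<close>, a sixth root of unity. Its residue generates the
  multiplicative group of the field with four elements that the order becomes modulo
  \<open>one_plus_i\<close>.\<close>

definition h6 :: hur where "h6 = Hur 1 0 0 0"

lemma hN_h6 [simp]: "hN h6 = 1" by (simp add: h6_def hN_def)

lemma lip_h6:
  "x * h6 \<in> lip \<longleftrightarrow> even (ha x + (hb x + hc x + hd x))"
  "x * (h6 * h6) \<in> lip \<longleftrightarrow> even (hb x + hc x + hd x)"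
  unfolding lip_def by (auto simp: even_ha_mult hur_mult_sel h6_def)

lemma hconj_lip [simp]: "hconj x \<in> lip \<longleftrightarrow> x \<in> lip"
  by (simp add: lip_def)

definition lip_pairs :: "int \<Rightarrow> int \<Rightarrow> int \<Rightarrow> (hur \<times> hur) set" where
  "lip_pairs n m r = {(x, z)\<in>hpairs n m r. x \<in> lip \<and> z \<in> lip}"

text \<open>Integral coordinates mean residue 0 or 1 in the field with four elements. A unit
  \<open>e\<close> acts by \<open>(x * e, hconj e * z)\<close> and preserves the product, whose
  residue is 0 or 1. Hence exactly one of \<open>1\<close>, \<open>h6\<close>,
  \<open>h6 * h6\<close> makes both members integral, unless both residues are 0, that is, both
  norms are even; then all pairs are integral already.\<close>

lemma card_hpairs_lip:
  "card (hpairs n m r) = (if even n \<and> even m then 1 else 3) * card (lip_pairs n m r)"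
proof (cases "even n \<and> even m")
  case True
  then have "lip_pairs n m r = hpairs n m r"
    by (auto simp: lip_pairs_def hpairs_def intro!: even_norm_lip)
  then show ?thesis using True by simp
next
  case False
  define g where "g = (\<lambda>e. {(x, z)\<in>hpairs n m r. x * e \<in> lip \<and> hconj z * e \<in> lip})"
  have g1: "g 1 = lip_pairs n m r" by (auto simp: g_def lip_pairs_def)
  have unit: "card (g e) = card (g 1)" if e: "hN e = 1" for e
  proof -
    have ee: "e * hconj e = 1" "hconj e * e = 1" using e by (simp_all add: mult_hconj)
    have inv: "x * e * hconj e = x" "x * hconj e * e = x" "e * (hconj e * x) = x" "hconj e * (e * x) = x"
      "x * e * (hconj e * y) = x * y" "x * hconj e * (e * y) = x * y" for x y
      using ee by (simp_all add: mult.assoc) (simp_all add: mult.assoc[symmetric] ee)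
    have flip: "hconj e * z \<in> lip \<longleftrightarrow> hconj z * e \<in> lip" for z
      using hconj_lip[of "hconj e * z"] by (simp add: hconj_mult del: hconj_lip)
    have "bij_betw (\<lambda>(x, z). (x * e, hconj e * z)) (g e) (g 1)"
      by (rule bij_betw_byWitness[where f' = "\<lambda>(x, z). (x * hconj e, e * z)"])
        (auto simp: g_def hpairs_def inv hN_mult e hconj_mult flip)
    then show ?thesis by (rule bij_betw_same_card)
  qed
  have ex: "x \<in> lip \<and> hconj z \<in> lip \<or> x * h6 \<in> lip \<and> hconj z * h6 \<in> lip
     \<or> x * (h6 * h6) \<in> lip \<and> hconj z * (h6 * h6) \<in> lip" (is ?ex)
   and un: "\<not> ((x \<in> lip \<and> hconj z \<in> lip) \<and> (x * h6 \<in> lip \<and> hconj z * h6 \<in> lip))"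
      "\<not> ((x \<in> lip \<and> hconj z \<in> lip) \<and> (x * (h6 * h6) \<in> lip \<and> hconj z * (h6 * h6) \<in> lip))"
      "\<not> ((x * h6 \<in> lip \<and> hconj z * h6 \<in> lip) \<and> (x * (h6 * h6) \<in> lip \<and> hconj z * (h6 * h6) \<in> lip))"
    if xz: "(x, z) \<in> hpairs n m r" for x z
  proof -
    have N: "hN x = n" "hN z = m" and L: "x * z \<in> lip" using xz by (auto simp: hpairs_def lip_def)
    have "even (ha x * ha z + ha x * (hb z + hc z + hd z) + (hb x + hc x + hd x) * ha z)"
      using L by (simp add: lip_def even_ha_mult)
    moreover have "\<not> (even (ha x) \<and> even (hb x + hc x + hd x) \<and> even (ha z) \<and> even (hb z + hc z + hd z))"
      using False N even_hN_iff[of x] even_hN_iff[of z] by blast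
    ultimately show ?ex "\<not> ((x \<in> lip \<and> hconj z \<in> lip) \<and> (x * h6 \<in> lip \<and> hconj z * h6 \<in> lip))"
      "\<not> ((x \<in> lip \<and> hconj z \<in> lip) \<and> (x * (h6 * h6) \<in> lip \<and> hconj z * (h6 * h6) \<in> lip))"
      "\<not> ((x * h6 \<in> lip \<and> hconj z * h6 \<in> lip) \<and> (x * (h6 * h6) \<in> lip \<and> hconj z * (h6 * h6) \<in> lip))"
      unfolding lip_h6 by (auto simp: lip_def)
  qed
  have "hpairs n m r = g 1 \<union> g h6 \<union> g (h6 * h6)"
    using ex by (auto simp: g_def)
  moreover have "g 1 \<inter> g h6 = {}" "(g 1 \<union> g h6) \<inter> g (h6 * h6) = {}"
    using un unfolding g_def by auto
  moreover have "finite (g e)" for e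
    by (rule finite_subset[of _ "hpairs n m r"]) (auto simp: g_def)
  ultimately have "card (hpairs n m r) = card (g 1) + card (g h6) + card (g (h6 * h6))"
    by (simp add: card_Un_disjoint)
  also have "\<dots> = 3 * card (g 1)" using unit[of h6] unit[of "h6 * h6"] by (simp add: hN_mult)
  finally have "card (hpairs n m r) = 3 * card (lip_pairs n m r)" unfolding g1 .
  then show ?thesis by (simp only: False if_False)
qed

definition odd_cdivs :: "int \<Rightarrow> int \<Rightarrow> int \<Rightarrow> int set" where
  "odd_cdivs n r m = {d. d > 0 \<and> odd d \<and> d dvd n \<and> d dvd r \<and> d dvd m}"

text \<open>After exchanging the sums, an odd \<open>d\<close> that divides some \<open>w\<close> of
  trace \<open>2 * r\<close> divides \<open>r\<close>. The imaginary part of \<open>w\<close> is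
  then \<open>d\<close> times an integer vector whose three squares add up to
  \<open>(n * m - r^2) / d^2\<close>.\<close>

lemma sum_odd_cd_htrace:
  assumes n: "n > 0"
  shows "(\<Sum>w\<in>htrace_set (n * m) r. \<Sum>(odd_cd n m w)) =
    (\<Sum>d\<in>odd_cdivs n r m. d * int (r3 ((n * m - r\<^sup>2) div d\<^sup>2)))"
proof -
  define T where "T = {d. d > 0 \<and> odd d \<and> d dvd n \<and> d dvd m}"
  have finT: "finite T"
    by (rule finite_subset[of _ "{1..n}"]) (use n in \<open>auto simp: T_def dest!: zdvd_imp_le\<close>)
  define X where "X = htrace_set (n * m) r"
  have finX: "finite X" unfolding X_def htrace_set_def using finite_hN[of "n * m"] by simp
  have "(\<Sum>w\<in>X. \<Sum>(odd_cd n m w)) = (\<Sum>w\<in>X. \<Sum>d\<in>T. if of_int d ldvd w then d else 0)"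
  proof (rule sum.cong[OF refl])
    fix w
    have "odd_cd n m w = {d\<in>T. of_int d ldvd w}" by (auto simp: odd_cd_def T_def)
    then show "\<Sum>(odd_cd n m w) = (\<Sum>d\<in>T. if of_int d ldvd w then d else 0)"
      using finT by (simp add: sum.inter_filter)
  qed
  also have "\<dots> = (\<Sum>d\<in>T. \<Sum>w\<in>X. if of_int d ldvd w then d else 0)" by (rule sum.swap)
  also have "\<dots> = (\<Sum>d\<in>T. d * int (card {w\<in>X. of_int d ldvd w}))"
    using finX by (simp add: sum.inter_filter[symmetric] mult.commute)
  also have "\<dots> = (\<Sum>d\<in>odd_cdivs n r m. d * int (card {w\<in>X. of_int d ldvd w}))"
  proof (rule sum.mono_neutral_right[OF finT])
    show "odd_cdivs n r m \<subseteq> T" by (auto simp: odd_cdivs_def T_def)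
    show "\<forall>d\<in>T - odd_cdivs n r m. d * int (card {w \<in> X. of_int d ldvd w}) = 0"
    proof
      fix d assume d: "d \<in> T - odd_cdivs n r m"
      then have "\<not> d dvd r" "odd d" by (auto simp: T_def odd_cdivs_def)
      then have "\<not> d dvd 2 * r" using coprime_dvd_mult_right_iff[of d 2 r] by simp
      then have "{w \<in> X. of_int d ldvd w} = {}" by (auto simp: X_def htrace_set_def of_int_ldvd_iff)
      then have "card {w \<in> X. of_int d ldvd w} = 0" by (simp only: card.empty)
      then show "d * int (card {w \<in> X. of_int d ldvd w}) = 0" by simp
    qed
  qed
  also have "\<dots> = (\<Sum>d\<in>odd_cdivs n r m. d * int (r3 ((n * m - r\<^sup>2) div d\<^sup>2)))"
  proof (rule sum.cong[OF refl])
    fix d assume "d \<in> odd_cdivs n r m"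
    then have d: "d > 0" "odd d" "d dvd n" "d dvd m" "d dvd r" by (auto simp: odd_cdivs_def)
    obtain s where s: "r = d * s" using d by auto
    have "d\<^sup>2 dvd n * m" "d\<^sup>2 dvd r\<^sup>2" using d by (auto simp: power2_eq_square intro: mult_dvd_mono)
    then have "d\<^sup>2 dvd n * m - r\<^sup>2" by (rule dvd_diff)
    then obtain k where k: "n * m - r\<^sup>2 = d\<^sup>2 * k" by auto
    have kd: "(n * m - r\<^sup>2) div d\<^sup>2 = k" using k d by simp
    \<comment> \<open>The element on the right is \<open>r + d * (x i + y j + z k)\<close>, written
      in the basis \<open>\<omega>, i, j, k\<close>.\<close>
    have "bij_betw (\<lambda>(x, y, z). Hur (2 * r) (d * x - r) (d * y - r) (d * z - r))
       {(x, y, z). x\<^sup>2 + y\<^sup>2 + z\<^sup>2 = k} {w\<in>X. of_int d ldvd w}"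
    proof (rule bij_betwI')
      fix a b :: "int \<times> int \<times> int"
      show "((case a of (x, y, z) \<Rightarrow> Hur (2 * r) (d * x - r) (d * y - r) (d * z - r)) =
        (case b of (x, y, z) \<Rightarrow> Hur (2 * r) (d * x - r) (d * y - r) (d * z - r))) = (a = b)"
        using d by (auto split: prod.splits)
    next
      fix a :: "int \<times> int \<times> int" assume "a \<in> {(x, y, z). x\<^sup>2 + y\<^sup>2 + z\<^sup>2 = k}"
      then obtain x y z where a: "a = (x, y, z)" "x\<^sup>2 + y\<^sup>2 + z\<^sup>2 = k" by auto
      have "hN (Hur (2 * r) (d * x - r) (d * y - r) (d * z - r)) = r\<^sup>2 + d\<^sup>2 * (x\<^sup>2 + y\<^sup>2 + z\<^sup>2)"
        by (simp add: hN_def power2_eq_square algebra_simps)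
      also have "\<dots> = n * m" using k a by simp
      finally show "(case a of (x, y, z) \<Rightarrow> Hur (2 * r) (d * x - r) (d * y - r) (d * z - r)) \<in> {w\<in>X. of_int d ldvd w}"
        using d by (simp add: a X_def htrace_set_def of_int_ldvd_iff)
    next
      fix w assume "w \<in> {w\<in>X. of_int d ldvd w}"
      then have w: "hN w = n * m" "ha w = 2 * r" "d dvd hb w" "d dvd hc w" "d dvd hd w"
        by (auto simp: X_def htrace_set_def of_int_ldvd_iff)
      have "d dvd hb w + r" "d dvd hc w + r" "d dvd hd w + r" using w d by auto
      then obtain x y z where xyz: "hb w + r = d * x" "hc w + r = d * y" "hd w + r = d * z" by (auto elim!: dvdE)
      have weq: "w = Hur (2 * r) (d * x - r) (d * y - r) (d * z - r)"
        using w xyz by (simp add: hur_eq_iff)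
      have "hN w = r\<^sup>2 + d\<^sup>2 * (x\<^sup>2 + y\<^sup>2 + z\<^sup>2)" unfolding weq
        by (simp add: hN_def power2_eq_square algebra_simps)
      then have "d\<^sup>2 * (x\<^sup>2 + y\<^sup>2 + z\<^sup>2) = d\<^sup>2 * k" using w k by simp
      then have "x\<^sup>2 + y\<^sup>2 + z\<^sup>2 = k" using d by simp
      then show "\<exists>a\<in>{(x, y, z). x\<^sup>2 + y\<^sup>2 + z\<^sup>2 = k}. w = (case a of (x, y, z) \<Rightarrow> Hur (2 * r) (d * x - r) (d * y - r) (d * z - r))"
        using weq by (intro bexI[of _ "(x, y, z)"]) auto
    qed
    then have "card {w\<in>X. of_int d ldvd w} = r3 k" unfolding r3_def by (simp add: bij_betw_same_card)
    then show "d * int (card {w\<in>X. of_int d ldvd w}) = d * int (r3 ((n * m - r\<^sup>2) div d\<^sup>2))" by (simp add: kd)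
  qed
  finally show ?thesis by (simp add: X_def)
qed

theorem card_lip_pairs:
  assumes n: "n > 0"
  shows "int (card (lip_pairs n m r)) = (if even n \<and> even m then 24 else 8) *
     (\<Sum>d\<in>odd_cdivs n r m. d * int (r3 ((n * m - r\<^sup>2) div d\<^sup>2)))"
proof -
  have "int (card (hpairs n m r)) = (\<Sum>w\<in>htrace_set (n * m) r. int (card (ldivs n w)))"
    by (simp add: card_hpairs[OF n])
  also have "\<dots> = (\<Sum>w\<in>htrace_set (n * m) r. 24 * \<Sum>(odd_cd n m w))"
    by (rule sum.cong[OF refl]) (use card_ldivs[OF n] in \<open>auto simp: htrace_set_def\<close>)
  also have "\<dots> = 24 * (\<Sum>d\<in>odd_cdivs n r m. d * int (r3 ((n * m - r\<^sup>2) div d\<^sup>2)))"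
    by (simp add: sum_distrib_left[symmetric] sum_odd_cd_htrace[OF n])
  finally show ?thesis unfolding card_hpairs_lip by (auto split: if_splits)
qed

section \<open>Sums of three squares\<close>

definition sell_supp :: "int \<Rightarrow> (int \<times> int \<times> int) set" where
  "sell_supp N = {(p, q, t). p * q + q * t + t * p = N \<and> sell_wt p q t \<noteq> 0}"

definition sell_sum :: "int \<Rightarrow> int" where
  "sell_sum N = (\<Sum>(p, q, t)\<in>sell_supp N. par3 p q t * sell_wt p q t)"

lemma finite_sell_supp [simp]: "finite (sell_supp N)"
  by (rule finite_subset[of _ "{-N..N} \<times> {-N..N} \<times> {-N..N}"])
    (use sell_wt_bounds in \<open>fastforce simp: sell_supp_def\<close>, simp)

lemma sell_supp_neg: "N < 0 \<Longrightarrow> sell_supp N = {}"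
  using sell_wt_bounds by (force simp: sell_supp_def)

lemma sell_sum_neg: "N < 0 \<Longrightarrow> sell_sum N = 0"
  by (simp add: sell_sum_def sell_supp_neg)

lemma sell_sum_0: "sell_sum 0 = 1"
proof -
  have "sell_supp 0 = {(0, 0, 0)}"
  proof (intro equalityI subsetI)
    fix x assume "x \<in> sell_supp 0"
    then obtain p q t where x: "x = (p, q, t)" "p * q + q * t + t * p = 0" "sell_wt p q t \<noteq> 0" by (auto simp: sell_supp_def)
    have "p = 0 \<and> q = 0 \<and> t = 0" using sell_wt_bounds[OF x(2,3)] by simp
    then show "x \<in> {(0, 0, 0)}" by (simp add: x)
  qed (simp add: sell_supp_def sell_wt_def)
  then show ?thesis by (simp add: sell_sum_def par3_def sell_wt_def)
qed

lemma ssum_sell_wt4_sell_sum: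
  assumes n: "n > 0"
  shows "ssum n sell_wt4 = (\<Sum>r\<in>{-n..n}. sell_sum (n - r\<^sup>2))"
proof -
  have "ssum n sell_wt4 = (\<Sum>x\<in>Sigma {-n..n} (\<lambda>r. sell_supp (n - r\<^sup>2)).
    if qform4 x = n then (case x of (r, p, q, t) \<Rightarrow> par3 p q t) * sell_wt4 x else 0)"
  proof (rule ssum_superset)
    show "{x. qform4 x = n \<and> sell_wt4 x \<noteq> 0} \<subseteq> Sigma {-n..n} (\<lambda>r. sell_supp (n - r\<^sup>2))"
    proof
      fix x assume "x \<in> {x. qform4 x = n \<and> sell_wt4 x \<noteq> 0}"
      then obtain r p q t where x: "x = (r, p, q, t)" and w: "sell_wt p q t \<noteq> 0"
        and eq: "p * q + q * t + t * p = n - r\<^sup>2"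
        by (cases x) (auto simp: qform4_def sell_wt4_def)
      have "r\<^sup>2 \<le> n" using sell_wt_bounds[OF eq w] by simp
      then have "\<bar>r\<bar> \<le> n" using square_bound[of r] by linarith
      then show "x \<in> Sigma {-n..n} (\<lambda>r. sell_supp (n - r\<^sup>2))" using eq w by (auto simp: x sell_supp_def)
    qed
  qed simp
  also have "\<dots> = (\<Sum>(r, x)\<in>Sigma {-n..n} (\<lambda>r. sell_supp (n - r\<^sup>2)). case x of (p, q, t) \<Rightarrow> par3 p q t * sell_wt p q t)"
    by (rule sum.cong) (auto simp: sell_supp_def qform4_def sell_wt4_def)
  also have "\<dots> = (\<Sum>r\<in>{-n..n}. sell_sum (n - r\<^sup>2))"
    unfolding sell_sum_def by (rule sum.Sigma[symmetric]) auto
  finally show ?thesis .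
qed

section \<open>Divisor sums and the four-square count\<close>

definition odd_sigma :: "int \<Rightarrow> int" where
  "odd_sigma n = (\<Sum>d | 0 < d \<and> odd d \<and> d dvd n. d)"

lemma odd_cofactor:
  fixes b N :: int
  assumes "odd N" "b dvd N"
  shows "odd (N div b) \<and> odd b"
proof -
  obtain k where k: "N = b * k" using assms(2) by auto
  then have "b \<noteq> 0" using assms(1) by auto
  then show ?thesis using k assms(1) by simp
qed

lemma sum_divisors_double:
  assumes N: "N > 0"
  shows "(\<Sum>a | 0 < a \<and> a dvd 2 * N. f a) =
    (\<Sum>a | 0 < a \<and> odd a \<and> a dvd N. f a) + (\<Sum>b | 0 < b \<and> b dvd N. f (2 * b :: int) :: int)"
proof -
  have iff: "a dvd 2 * N \<longleftrightarrow> a dvd N" if "odd a" for a :: int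
    using that by (simp add: coprime_dvd_mult_right_iff)
  have "{a. 0 < a \<and> a dvd 2 * N} = {a. 0 < a \<and> odd a \<and> a dvd N} \<union> (\<lambda>b. 2 * b) ` {b. 0 < b \<and> b dvd N}"
  proof (intro equalityI subsetI)
    fix x assume x: "x \<in> {a. 0 < a \<and> a dvd 2 * N}"
    show "x \<in> {a. 0 < a \<and> odd a \<and> a dvd N} \<union> (\<lambda>b. 2 * b) ` {b. 0 < b \<and> b dvd N}"
    proof (cases "even x")
      case True
      then obtain b where "x = 2 * b" by auto
      then show ?thesis using x by auto
    qed (use x iff in simp)
  qed auto
  moreover have "finite {a. 0 < a \<and> odd a \<and> a dvd N}" "finite {b. 0 < b \<and> b dvd N}"
    by (rule finite_subset[of _ "{1..N}"]; use N in \<open>auto dest: zdvd_imp_le\<close>)+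
  moreover have "{a. 0 < a \<and> odd a \<and> a dvd N} \<inter> (\<lambda>b. 2 * b) ` {b. 0 < b \<and> b dvd N} = {}" by auto
  ultimately show ?thesis by (simp add: sum.union_disjoint sum.reindex inj_on_def)
qed

lemma odd_sigma_double: "odd_sigma (2 * N) = odd_sigma N"
  unfolding odd_sigma_def by (rule sum.cong) (auto simp: coprime_dvd_mult_right_iff)

text \<open>For \<open>N = 2 * M\<close> the odd divisors contribute \<open>- odd_sigma M\<close>,
  the even ones twice the same alternating sum for \<open>M\<close>; by induction
  \<open>-1 + 2 = 1\<close>.\<close>

lemma alternating_sigma:
  "N > 0 \<Longrightarrow> (\<Sum>b | 0 < b \<and> b dvd N. (if even (N div b) then - b else b)) = odd_sigma N"
proof (induction "nat N" arbitrary: N rule: less_induct)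
  case less
  show ?case
  proof (cases "even N")
    case False
    show ?thesis unfolding odd_sigma_def using odd_cofactor[OF False] by (intro sum.cong) auto
  next
    case True
    then obtain M where M: "N = 2 * M" by auto
    have M0: "M > 0" "nat M < nat N" using less.prems M by auto
    have 1: "(\<Sum>a | 0 < a \<and> odd a \<and> a dvd M. (if even (N div a) then - a else a)) = - odd_sigma M"
      unfolding odd_sigma_def sum_negf[symmetric]
    proof (rule sum.cong[OF refl])
      fix a assume "a \<in> {a. 0 < a \<and> odd a \<and> a dvd M}"
      then have "even (N div a)" by (auto simp: M elim!: dvdE)
      then show "(if even (N div a) then - a else a) = - a" by simp
    qed
    have 2: "(\<Sum>b | 0 < b \<and> b dvd M. (if even (N div (2 * b)) then - (2 * b) else 2 * b)) =
      2 * (\<Sum>b | 0 < b \<and> b dvd M. (if even (M div b) then - b else b))"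
      unfolding sum_distrib_left by (rule sum.cong) (auto simp: M)
    show ?thesis unfolding M sum_divisors_double[OF M0(1)]
      using 1 2 less.hyps[OF M0(2,1)] unfolding M odd_sigma_double by simp
  qed
qed

text \<open>For even \<open>n\<close> the odd divisors give \<open>odd_sigma\<close>, and the even
  ones give twice the alternating sum for \<open>n / 2\<close>, hence the factor 3.\<close>

lemma eps_sigma_eq:
  assumes n: "n > 0"
  shows "eps_sigma n = (if even n then 3 else 1) * odd_sigma n"
proof (cases "even n")
  case False
  then show ?thesis using odd_cofactor[OF False] unfolding eps_sigma_def odd_sigma_def by (auto intro!: sum.cong)
next
  case True
  then obtain M where M: "n = 2 * M" by auto
  have M0: "M > 0" using n M by simp
  have 1: "(\<Sum>a | 0 < a \<and> odd a \<and> a dvd M. (if even a \<and> even (n div a) then - a else a)) = odd_sigma M"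
    unfolding odd_sigma_def by (rule sum.cong) auto
  have 2: "(\<Sum>b | 0 < b \<and> b dvd M. (if even (2 * b) \<and> even (n div (2 * b)) then - (2 * b) else 2 * b)) =
      2 * (\<Sum>b | 0 < b \<and> b dvd M. (if even (M div b) then - b else b))"
    unfolding sum_distrib_left by (rule sum.cong) (auto simp: M)
  show ?thesis unfolding eps_sigma_def M sum_divisors_double[OF M0]
    using 1 2 alternating_sigma[OF M0] unfolding M odd_sigma_double by simp
qed

lemma r3_neg: "N < 0 \<Longrightarrow> r3 N = 0"
proof -
  assume "N < 0"
  moreover have "x\<^sup>2 + y\<^sup>2 + z\<^sup>2 \<ge> 0" for x y z :: int by simp
  ultimately have "{(x, y, z). x\<^sup>2 + y\<^sup>2 + z\<^sup>2 = N} = {}" by (auto simp: not_less[symmetric])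
  then show ?thesis unfolding r3_def by (simp only: card.empty)
qed

lemma r3_0: "r3 0 = 1"
proof -
  have "{(x, y, z). x\<^sup>2 + y\<^sup>2 + z\<^sup>2 = (0::int)} = {(0, 0, 0)}"
    by (auto simp: add_nonneg_eq_0_iff)
  then show ?thesis unfolding r3_def by simp
qed

lemma sum_r3:
  assumes n: "n > 0"
  shows "(\<Sum>r\<in>{-n..n}. int (r3 (n - r\<^sup>2))) = 8 * eps_sigma n"
proof -
  define V where "V = (\<lambda>N. {(x, y, z). x\<^sup>2 + y\<^sup>2 + z\<^sup>2 = (N::int)})"
  have finV: "finite (V N)" for N unfolding V_def by (rule finite_three_squares)
  have "bij_betw (\<lambda>(r, x, y, z). (Hur (2 * r) (x - r) (y - r) (z - r), 0)) (Sigma {-n..n} (\<lambda>r. V (n - r\<^sup>2))) (lip_pairs n 0 0)"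
  proof (rule bij_betwI')
    fix a b :: quad
    show "((case a of (r, x, y, z) \<Rightarrow> (Hur (2 * r) (x - r) (y - r) (z - r), 0::hur)) =
        (case b of (r, x, y, z) \<Rightarrow> (Hur (2 * r) (x - r) (y - r) (z - r), 0))) = (a = b)"
      by (auto split: prod.splits)
  next
    fix a assume "a \<in> Sigma {-n..n} (\<lambda>r. V (n - r\<^sup>2))"
    then show "(case a of (r, x, y, z) \<Rightarrow> (Hur (2 * r) (x - r) (y - r) (z - r), 0)) \<in> lip_pairs n 0 0"
      by (auto simp: V_def lip_pairs_def hpairs_def lip_def hN_def power2_eq_square algebra_simps)
  next
    fix w assume "w \<in> lip_pairs n 0 0"
    then obtain u where u: "w = (u, 0)" "hN u = n" "even (ha u)"
      by (auto simp: lip_pairs_def hpairs_def lip_def)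
    then obtain r where r: "ha u = 2 * r" by auto
    define x y z where "x = hb u + r" and "y = hc u + r" and "z = hd u + r"
    have ueq: "u = Hur (2 * r) (x - r) (y - r) (z - r)" by (simp add: hur_eq_iff r x_def y_def z_def)
    have eq: "x\<^sup>2 + y\<^sup>2 + z\<^sup>2 = n - r\<^sup>2"
      using u(2) unfolding ueq by (simp add: hN_def power2_eq_square algebra_simps)
    moreover have "x\<^sup>2 + y\<^sup>2 + z\<^sup>2 \<ge> 0" by simp
    ultimately have "\<bar>r\<bar> \<le> n" using square_bound[of r] by linarith
    then show "\<exists>a\<in>Sigma {-n..n} (\<lambda>r. V (n - r\<^sup>2)). w = (case a of (r, x, y, z) \<Rightarrow> (Hur (2 * r) (x - r) (y - r) (z - r), 0))"
      using u(1) ueq eq by (intro bexI[of _ "(r, x, y, z)"]) (auto simp: V_def)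
  qed
  then have "card (lip_pairs n 0 0) = card (Sigma {-n..n} (\<lambda>r. V (n - r\<^sup>2)))" by (simp add: bij_betw_same_card)
  also have "\<dots> = (\<Sum>r\<in>{-n..n}. r3 (n - r\<^sup>2))"
    using finV by (simp add: card_SigmaI r3_def V_def)
  finally have "(\<Sum>r\<in>{-n..n}. int (r3 (n - r\<^sup>2))) = int (card (lip_pairs n 0 0))" by simp
  also have "\<dots> = (if even n then 24 else 8) * odd_sigma n"
    unfolding card_lip_pairs[OF n] by (simp add: r3_0 odd_cdivs_def odd_sigma_def)
  also have "\<dots> = 8 * eps_sigma n" using eps_sigma_eq[OF n] by simp
  finally show ?thesis .
qed

text \<open>Both sides satisfy the recursion that expresses the number of representations as a sum of
  four squares, with the same right-hand side.\<close>

theorem sell_sum_eq_r3: "sell_sum N = int (r3 N)"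
proof (cases "N < 0")
  case True
  then show ?thesis by (simp add: sell_sum_neg r3_neg)
next
  case False
  then have "N \<ge> 0" by simp
  then show ?thesis
  proof (induction "nat N" arbitrary: N rule: less_induct)
    case less
    show ?case
    proof (cases "N = 0")
      case True
      then show ?thesis by (simp add: sell_sum_0 r3_0)
    next
      case False
      then have N: "N > 0" using less.prems by simp
      have "(\<Sum>r\<in>{-N..N}. sell_sum (N - r\<^sup>2)) = (\<Sum>r\<in>{-N..N}. int (r3 (N - r\<^sup>2)))"
        using ssum_sell_wt4[OF N] ssum_sell_wt4_sell_sum[OF N] sum_r3[OF N] by simp
      moreover have "sell_sum (N - r\<^sup>2) = int (r3 (N - r\<^sup>2))" if "r \<in> {-N..N} - {0}" for r
      proof (cases "N - r\<^sup>2 < 0")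
        case True then show ?thesis by (simp add: sell_sum_neg r3_neg)
      next
        case False
        have "r\<^sup>2 > 0" using that by simp
        then show ?thesis using less.hyps[of "N - r\<^sup>2"] False N by simp
      qed
      then have "(\<Sum>r\<in>{-N..N} - {0}. sell_sum (N - r\<^sup>2)) = (\<Sum>r\<in>{-N..N} - {0}. int (r3 (N - r\<^sup>2)))"
        by (rule sum.cong[OF refl])
      moreover have "0 \<in> {-N..N}" using N by simp
      ultimately show ?thesis by (simp add: sum.remove[of "{-N..N}" 0])
    qed
  qed
qed

section \<open>Weighted counts of Selling parameters and the passage from \<open>N\<close> to
  \<open>4 * N\<close>\<close>

definition nnset :: "int \<Rightarrow> (int \<times> int \<times> int) set" where
  "nnset N = {(p, q, t). 0 \<le> p \<and> 0 \<le> q \<and> 0 \<le> t \<and> p * q + q * t + t * p = N}"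

definition same_parity :: "int \<times> int \<times> int \<Rightarrow> bool" where
  "same_parity = (\<lambda>(p, q, t). even (p - q) \<and> even (q - t))"

definition sell_wt3 :: "int \<times> int \<times> int \<Rightarrow> int" where
  "sell_wt3 = (\<lambda>(p, q, t). sell_wt p q t)"

text \<open>For \<open>N > 0\<close>, \<open>taus N\<close> is \<open>6 * H N\<close> by
  \<open>H_taus\<close>. As equal parity of a triple with value \<open>4 * N\<close> means that all
  three parameters are even, \<open>tau N\<close> is \<open>6 * H (4 * N)\<close>.\<close>

definition tau :: "int \<Rightarrow> int" where "tau N = sum sell_wt3 (nnset N)"
definition taus :: "int \<Rightarrow> int" where "taus N = sum sell_wt3 {x\<in>nnset N. same_parity x}"

lemma sell_wt3_nonneg:
  "p \<ge> 0 \<Longrightarrow> q \<ge> 0 \<Longrightarrow> t \<ge> 0 \<Longrightarrow> sell_wt3 (p, q, t) = sgn p + sgn q + sgn t - 1"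
  by (auto simp: sell_wt3_def sell_wt_def)

lemma sell_wt_nnset:
  assumes "N > 0" "(p, q, t) \<in> nnset N"
  shows "sell_wt p q t \<noteq> 0"
proof -
  have "p \<noteq> 0 \<or> q \<noteq> 0" "q \<noteq> 0 \<or> t \<noteq> 0" "t \<noteq> 0 \<or> p \<noteq> 0" using assms by (auto simp: nnset_def)
  then show ?thesis using assms by (auto simp: nnset_def sell_wt_def sgn_if)
qed

lemma finite_nnset:
  assumes "N > 0"
  shows "finite (nnset N)"
proof (rule finite_subset[OF _ finite_sell_supp[of N]])
  show "nnset N \<subseteq> sell_supp N" using sell_wt_nnset[OF assms] by (auto simp: sell_supp_def nnset_def)
qed

text \<open>The factor 2 comes from the solutions of opposite sign. The triples of equal parity
  enter with -1 instead of 1, so they are subtracted twice.\<close>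

lemma sell_sum_tau:
  assumes N: "N > 0"
  shows "sell_sum N = 2 * tau N - 4 * taus N"
proof -
  let ?f = "\<lambda>(p, q, t). par3 p q t * sell_wt p q t"
  let ?u = "\<lambda>(p, q, t). (- p, - q, - t) :: int \<times> int \<times> int"
  have "sell_supp N = nnset N \<union> ?u ` nnset N"
  proof (intro equalityI subsetI)
    fix x assume "x \<in> sell_supp N"
    then obtain p q t where x: "x = (p, q, t)" "p * q + q * t + t * p = N" "sell_wt p q t \<noteq> 0"
      by (auto simp: sell_supp_def)
    then consider "p \<ge> 0 \<and> q \<ge> 0 \<and> t \<ge> 0" | "p \<le> 0 \<and> q \<le> 0 \<and> t \<le> 0"
      by (auto simp: sell_wt_def split: if_splits)
    then show "x \<in> nnset N \<union> ?u ` nnset N"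
    proof cases
      case 1 then show ?thesis using x by (simp add: nnset_def)
    next
      case 2
      have "x \<in> ?u ` nnset N"
        by (rule image_eqI[of _ _ "(-p, -q, -t)"]) (use 2 x in \<open>auto simp: nnset_def\<close>)
      then show ?thesis by simp
    qed
  next
    fix x assume "x \<in> nnset N \<union> ?u ` nnset N"
    then obtain p q t where pqt: "(p, q, t) \<in> nnset N" "x = (p, q, t) \<or> x = (- p, - q, - t)" by (cases x) auto
    have "sell_wt (- p) (- q) (- t) = sell_wt p q t" by (auto simp: sell_wt_def)
    then show "x \<in> sell_supp N" using pqt sell_wt_nnset[OF N pqt(1)] by (auto simp: sell_supp_def nnset_def)
  qed
  moreover have "nnset N \<inter> ?u ` nnset N = {}"
  proof (rule ccontr)
    assume "nnset N \<inter> ?u ` nnset N \<noteq> {}"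
    then obtain y where y: "y \<in> nnset N" "y \<in> ?u ` nnset N" by blast
    obtain p q t where "y = (p, q, t)" by (cases y)
    with y have x: "(p, q, t) \<in> nnset N" "(p, q, t) \<in> ?u ` nnset N" by simp_all
    then have "(- p, - q, - t) \<in> nnset N" by (auto simp: image_iff)
    then have "p = 0" "q = 0" "t = 0" using x(1) by (simp_all add: nnset_def)
    then show False using x(1) N by (simp add: nnset_def)
  qed
  moreover have fin: "finite (nnset N)" using finite_nnset[OF N] .
  ultimately have "sell_sum N = sum ?f (nnset N) + sum ?f (?u ` nnset N)"
    unfolding sell_sum_def by (simp add: sum.union_disjoint)
  also have "sum ?f (?u ` nnset N) = sum ?f (nnset N)"
    by (subst sum.reindex) (auto simp: inj_on_def par3_def sell_wt_def intro!: sum.cong)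
  also have "sum ?f (nnset N) = (\<Sum>x\<in>nnset N. sell_wt3 x - 2 * (if same_parity x then sell_wt3 x else 0))"
  proof (rule sum.cong[OF refl])
    fix x :: "int \<times> int \<times> int"
    obtain p q t where x: "x = (p, q, t)" by (cases x)
    define c where "c \<longleftrightarrow> even (p - q) \<and> even (q - t)"
    show "(case x of (p, q, t) \<Rightarrow> par3 p q t * sell_wt p q t) = sell_wt3 x - 2 * (if same_parity x then sell_wt3 x else 0)"
      unfolding x prod.case par3_def sell_wt3_def same_parity_def c_def[symmetric] by simp
  qed
  also have "\<dots> = tau N - 2 * taus N"
    using fin unfolding tau_def taus_def by (simp add: sum_subtractf sum_distrib_left[symmetric] sum.inter_filter)
  finally show ?thesis by simp
qed

lemma sum_sell_wt3_perm:
  assumes "\<And>p q t. P (p, q, t) \<longleftrightarrow> P' (q, t, p)"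
  shows "sum sell_wt3 {x\<in>nnset N. P x} = sum sell_wt3 {x\<in>nnset N. P' x}"
  by (rule sum.reindex_bij_witness[of _ "\<lambda>(p, q, t). (t, p, q)" "\<lambda>(p, q, t). (q, t, p)"])
    (auto simp: nnset_def sell_wt3_def sell_wt_def assms algebra_simps)

text \<open>In a triple without common parity exactly two of the three pairs have opposite parity,
  and by rotation the three pairs contribute equally.\<close>

lemma tau_mixed:
  assumes N: "N > 0"
  shows "3 * sum sell_wt3 {x\<in>nnset N. odd (fst x + fst (snd x))} = 2 * (tau N - taus N)"
proof -
  let ?A = "\<lambda>x::int\<times>int\<times>int. odd (fst x + fst (snd x))"
  let ?B = "\<lambda>x::int\<times>int\<times>int. odd (fst (snd x) + snd (snd x))"
  let ?C = "\<lambda>x::int\<times>int\<times>int. odd (snd (snd x) + fst x)"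
  have fin: "finite (nnset N)" using finite_nnset[OF N] .
  have "sum sell_wt3 {x\<in>nnset N. ?A x} = sum sell_wt3 {x\<in>nnset N. ?C x}" by (rule sum_sell_wt3_perm) auto
  moreover have "sum sell_wt3 {x\<in>nnset N. ?C x} = sum sell_wt3 {x\<in>nnset N. ?B x}" by (rule sum_sell_wt3_perm) auto
  ultimately have "3 * sum sell_wt3 {x\<in>nnset N. ?A x} =
    sum sell_wt3 {x\<in>nnset N. ?A x} + sum sell_wt3 {x\<in>nnset N. ?B x} + sum sell_wt3 {x\<in>nnset N. ?C x}" by simp
  also have "\<dots> = (\<Sum>x\<in>nnset N. 2 * (sell_wt3 x - (if same_parity x then sell_wt3 x else 0)))"
    unfolding sum.inter_filter[OF fin] sum.distrib[symmetric]
    by (rule sum.cong[OF refl]) (auto simp: same_parity_def)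
  also have "\<dots> = 2 * (tau N - taus N)"
    using fin unfolding tau_def taus_def by (simp add: sum_distrib_left[symmetric] sum_subtractf sum.inter_filter)
  finally show ?thesis .
qed

lemma sell_wt3_double: "sell_wt3 (2 * p, 2 * q, 2 * t) = sell_wt3 (p, q, t)"
  by (simp add: sell_wt3_def sell_wt_def sgn_mult)

lemma tau_all_even:
  assumes N: "N > 0"
  shows "sum sell_wt3 {(p, q, t)\<in>nnset (4 * N). even p \<and> even q \<and> even t} = tau N"
  unfolding tau_def
  by (rule sum.reindex_bij_witness[of _ "\<lambda>(p, q, t). (2 * p, 2 * q, 2 * t)" "\<lambda>(p, q, t). (p div 2, q div 2, t div 2)"])
    (auto simp: nnset_def sell_wt3_double elim!: evenE)

text \<open>For odd \<open>p\<close> and even \<open>q, t\<close> the sum \<open>q + t\<close> is divisible by 4; the substitution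
  \<open>(p, q, t) \<mapsto> (t/2, t/2 + p, (q - t)/4)\<close> divides the value of the form by 4.\<close>

lemma tau_one_odd:
  assumes N: "N > 0"
  shows "sum sell_wt3 {(p, q, t)\<in>nnset (4 * N). odd p \<and> even q \<and> even t} = sum sell_wt3 {x\<in>nnset N. odd (fst x + fst (snd x))}"
proof -
  define X where "X = {(p, q, t)\<in>nnset (4 * N). odd p \<and> even q \<and> even t}"
  define Y where "Y = {x\<in>nnset N. odd (fst x + fst (snd x))}"
  have fin: "finite X" "finite Y" unfolding X_def Y_def
    using finite_nnset[of N] finite_nnset[of "4 * N"] N by (auto intro: finite_subset[of _ "nnset (4 * N)"])
  have swapX: "sum sell_wt3 {(p, q, t)\<in>X. q < t} = sum sell_wt3 {(p, q, t)\<in>X. t < q}"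
    by (rule sum.reindex_bij_witness[of _ "\<lambda>(p, q, t). (p, t, q)" "\<lambda>(p, q, t). (p, t, q)"])
      (auto simp: X_def nnset_def sell_wt3_def sell_wt_def algebra_simps)
  have swapY: "sum sell_wt3 {(p, q, t)\<in>Y. q < p} = sum sell_wt3 {(p, q, t)\<in>Y. p < q}"
    by (rule sum.reindex_bij_witness[of _ "\<lambda>(p, q, t). (q, p, t)" "\<lambda>(p, q, t). (q, p, t)"])
      (auto simp: Y_def nnset_def sell_wt3_def sell_wt_def algebra_simps)
  have X: "X = ({(p, q, t)\<in>X. t < q} \<union> {(p, q, t)\<in>X. q < t}) \<union> {(p, q, t)\<in>X. q = t}" by auto
  have "sum sell_wt3 X = sum sell_wt3 {(p, q, t)\<in>X. t < q} + sum sell_wt3 {(p, q, t)\<in>X. q < t} + sum sell_wt3 {(p, q, t)\<in>X. q = t}"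
    by (subst X, subst sum.union_disjoint; (subst sum.union_disjoint)?)
      (auto intro: finite_subset[OF _ fin(1)])
  then have sX: "sum sell_wt3 X = 2 * sum sell_wt3 {(p, q, t)\<in>X. t < q} + sum sell_wt3 {(p, q, t)\<in>X. q = t}"
    using swapX by simp
  have Y: "Y = {(p, q, t)\<in>Y. p < q} \<union> {(p, q, t)\<in>Y. q < p}"
  proof -
    have "p < q \<or> q < p" if "(p, q, t) \<in> Y" for p q t
      using that linorder_less_linear[of p q] by (auto simp: Y_def)
    then show ?thesis by auto
  qed
  have "sum sell_wt3 Y = sum sell_wt3 {(p, q, t)\<in>Y. p < q} + sum sell_wt3 {(p, q, t)\<in>Y. q < p}"
    by (subst Y, subst sum.union_disjoint) (auto intro: finite_subset[OF _ fin(2)])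
  then have sY: "sum sell_wt3 Y = 2 * sum sell_wt3 {(p, q, t)\<in>Y. p < q}" using swapY by simp
  have "2 * sum sell_wt3 {(p, q, t)\<in>X. t < q} + sum sell_wt3 {(p, q, t)\<in>X. q = t} =
    sum (\<lambda>x. 2 * sell_wt3 x) {(p, q, t)\<in>X. t < q} + sum sell_wt3 {(p, q, t)\<in>X. q = t}"
    by (simp add: sum_distrib_left)
  \<comment> \<open>For \<open>t < q\<close> the third parameter \<open>(q - t) / 4\<close> of the
    image is positive and the weights agree. For \<open>q = t\<close> it vanishes and the image has
    half the weight; this is why the diagonal is not doubled.\<close>
  also have "\<dots> = (\<Sum>x\<in>{(p, q, t)\<in>X. t \<le> q}. case x of (p, q, t) \<Rightarrow> if t < q then 2 * sell_wt3 x else sell_wt3 x)"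
  proof -
    have e: "{(p, q, t)\<in>X. t \<le> q} = {(p, q, t)\<in>X. t < q} \<union> {(p, q, t)\<in>X. q = t}" by auto
    show ?thesis unfolding e
      by (subst sum.union_disjoint)
        (auto intro!: finite_subset[OF _ fin(1)] arg_cong2[of _ _ _ _ "(+)"] sum.cong)
  qed
  also have "\<dots> = (\<Sum>x\<in>{(p, q, t)\<in>Y. p < q}. 2 * sell_wt3 x)"
  proof (rule sum.reindex_bij_witness[of _ "\<lambda>(p, q, t). (q - p, 4 * t + 2 * p, 2 * p)"
        "\<lambda>(p, q, t). (t div 2, t div 2 + p, (q - t) div 4)"])
    fix x assume "x \<in> {(p, q, t)\<in>X. t \<le> q}"
    then obtain p q t where x: "x = (p, 2 * q, 2 * t)" "odd p" "p \<ge> 0" "q \<ge> 0" "t \<ge> 0" "t \<le> q"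
      "p * (2 * q) + 2 * q * (2 * t) + 2 * t * p = 4 * N"
      by (auto simp: X_def nnset_def elim!: evenE)
    have e2: "p * (q + t) = 2 * (N - q * t)" using x(7) by (simp add: algebra_simps)
    then have "even (p * (q + t))" by simp
    then have "even (q - t)" using x(2) by auto
    then obtain d where "q - t = 2 * d" by (rule evenE)
    then have d: "q = t + 2 * d" "d \<ge> 0" using x(6) by auto
    have N': "t * (t + p) + (t + p) * d + d * t = N"
      using e2 unfolding d by (simp add: algebra_simps)
    have m: "(case x of (p, q, t) \<Rightarrow> (t div 2, t div 2 + p, (q - t) div 4)) = (t, t + p, d)"
      by (simp add: x d)
    have p1: "p > 0" using x(2,3) by (cases "p = 0") auto
    show "(case (case x of (p, q, t) \<Rightarrow> (t div 2, t div 2 + p, (q - t) div 4)) of (p, q, t) \<Rightarrow> (q - p, 4 * t + 2 * p, 2 * p)) = x"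
      unfolding m by (simp add: x d)
    show "(case x of (p, q, t) \<Rightarrow> (t div 2, t div 2 + p, (q - t) div 4)) \<in> {(p, q, t)\<in>Y. p < q}"
      unfolding m using x(2-5) d(2) N' p1 by (simp add: Y_def nnset_def)
    have tq: "t > 0 \<or> d > 0" using N N' x(5) d(2) by (cases "t = 0"; cases "d = 0") auto
    show "2 * sell_wt3 (case x of (p, q, t) \<Rightarrow> (t div 2, t div 2 + p, (q - t) div 4)) =
      (case x of (p, q, t) \<Rightarrow> if t < q then 2 * sell_wt3 x else sell_wt3 x)"
      unfolding m using x(2-5) d(2) p1 tq
      by (simp add: sell_wt3_nonneg x(1) d(1) sgn_if)
  next
    fix x assume "x \<in> {(p, q, t)\<in>Y. p < q}"
    then obtain p q t where x: "x = (p, q, t)" "p < q" "p \<ge> 0" "q \<ge> 0" "t \<ge> 0"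
      "p * q + q * t + t * p = N" "odd (p + q)"
      by (auto simp: Y_def nnset_def)
    have "(q - p) * (4 * t + 2 * p) + (4 * t + 2 * p) * (2 * p) + 2 * p * (q - p) = 4 * (p * q + q * t + t * p)"
      by (simp add: algebra_simps)
    then show "(case x of (p, q, t) \<Rightarrow> (q - p, 4 * t + 2 * p, 2 * p)) \<in> {(p, q, t)\<in>X. t \<le> q}"
      using x by (simp add: X_def nnset_def)
    show "(case (case x of (p, q, t) \<Rightarrow> (q - p, 4 * t + 2 * p, 2 * p)) of (p, q, t) \<Rightarrow> (t div 2, t div 2 + p, (q - t) div 4)) = x"
      by (simp add: x)
  qed
  also have "\<dots> = 2 * sum sell_wt3 {(p, q, t)\<in>Y. p < q}" by (simp add: sum_distrib_left)
  finally show ?thesis using sX sY unfolding X_def Y_def by simp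
qed

text \<open>The form is even exactly when at most one parameter is odd. The all-even triples give
  \<open>tau N\<close>, and each of the three families with one odd parameter gives two thirds of
  \<open>tau N - taus N\<close>.\<close>

theorem tau_four:
  assumes N: "N > 0"
  shows "tau (4 * N) = 3 * tau N - 2 * taus N"
proof -
  define E where "E = {(p, q, t)\<in>nnset (4 * N). even p \<and> even q \<and> even t}"
  define X1 where "X1 = {(p, q, t)\<in>nnset (4 * N). odd p \<and> even q \<and> even t}"
  define X2 where "X2 = {(p, q, t)\<in>nnset (4 * N). odd q \<and> even t \<and> even p}"
  define X3 where "X3 = {(p, q, t)\<in>nnset (4 * N). odd t \<and> even p \<and> even q}"
  have fin: "finite (nnset (4 * N))" using finite_nnset N by simp
  have ev: "even (p * q + q * t + t * p)" if "(p, q, t) \<in> nnset (4 * N)" for p q t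
    using that by (simp add: nnset_def)
  have "nnset (4 * N) = ((E \<union> X1) \<union> X2) \<union> X3"
    using ev unfolding E_def X1_def X2_def X3_def by (auto simp del: even_add) auto
  moreover have "finite E" "finite X1" "finite X2" "finite X3"
    unfolding E_def X1_def X2_def X3_def by (auto intro: finite_subset[OF _ fin])
  moreover have "E \<inter> X1 = {}" "(E \<union> X1) \<inter> X2 = {}" "((E \<union> X1) \<union> X2) \<inter> X3 = {}"
    unfolding E_def X1_def X2_def X3_def by auto
  ultimately have "tau (4 * N) = sum sell_wt3 E + sum sell_wt3 X1 + sum sell_wt3 X2 + sum sell_wt3 X3"
    unfolding tau_def by (simp add: sum.union_disjoint)
  moreover have "sum sell_wt3 X2 = sum sell_wt3 X1"
    unfolding X1_def X2_def
    by (rule sum.reindex_bij_witness[of _ "\<lambda>(p, q, t). (t, p, q)" "\<lambda>(p, q, t). (q, t, p)"])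
      (auto simp: nnset_def sell_wt3_def sell_wt_def algebra_simps)
  moreover have "sum sell_wt3 X3 = sum sell_wt3 X1"
    unfolding X1_def X3_def
    by (rule sum.reindex_bij_witness[of _ "\<lambda>(p, q, t). (q, t, p)" "\<lambda>(p, q, t). (t, p, q)"])
      (auto simp: nnset_def sell_wt3_def sell_wt_def algebra_simps)
  moreover have "sum sell_wt3 E = tau N" unfolding E_def by (rule tau_all_even[OF N])
  moreover have "3 * sum sell_wt3 X1 = 2 * (tau N - taus N)"
    unfolding X1_def tau_one_odd[OF N] by (rule tau_mixed[OF N])
  ultimately show ?thesis by simp
qed

lemma taus_four:
  assumes N: "N > 0"
  shows "taus (4 * N) = tau N"
proof -
  have "{x\<in>nnset (4 * N). same_parity x} = {(p, q, t)\<in>nnset (4 * N). even p \<and> even q \<and> even t}"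
  proof -
    have ev: "even (p * q + q * t + t * p)" if "(p, q, t) \<in> nnset (4 * N)" for p q t
      using that by (simp add: nnset_def)
    show ?thesis using ev by (auto simp: same_parity_def simp del: even_add) auto
  qed
  then show ?thesis unfolding taus_def by (simp add: tau_all_even[OF N])
qed

section \<open>Class numbers of binary forms\<close>

lemma qforms_transform:
  assumes f: "f \<in> qforms D" and det: "p * t - q * s = 1"
    and g: "\<And>x y. qf_eval g x y = qf_eval f (p * x + q * y) (s * x + t * y)"
  shows "g \<in> qforms D"
proof -
  obtain a b c a' b' c' where fg: "f = (a, b, c)" "g = (a', b', c')" by (cases f; cases g) auto
  have "qf_eval g x y > 0" if "(x, y) \<noteq> (0, 0)" for x y
  proof -
    have "t * (p * x + q * y) - q * (s * x + t * y) = (p * t - q * s) * x"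
      "p * (s * x + t * y) - s * (p * x + q * y) = (p * t - q * s) * y" by (simp_all add: algebra_simps)
    then have "(p * x + q * y, s * x + t * y) \<noteq> (0, 0)" using that det by auto
    then show ?thesis using f unfolding g qforms_def qf_pos_def_def by blast
  qed
  moreover have "qf_disc g = - D"
  proof -
    have "a' = a * p\<^sup>2 + b * p * s + c * s\<^sup>2" "c' = a * q\<^sup>2 + b * q * t + c * t\<^sup>2"
      "b' = 2 * a * p * q + b * (p * t + q * s) + 2 * c * s * t"
      using g[of 1 0] g[of 0 1] g[of 1 1]
      by (simp_all add: fg qf_eval_def power2_eq_square algebra_simps)
    then have "qf_disc g = qf_disc f * (p * t - q * s)\<^sup>2"
      by (simp add: fg qf_disc_def power2_eq_square algebra_simps)
    then show ?thesis using f det by (simp add: qforms_def)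
  qed
  ultimately show ?thesis by (simp add: qforms_def qf_pos_def_def)
qed

lemma qf_SL2_relI:
  assumes "f \<in> qforms D" "p * t - q * s = 1"
    "\<And>x y. qf_eval g x y = qf_eval f (p * x + q * y) (s * x + t * y)"
  shows "(f, g) \<in> qf_SL2_rel D"
  using assms qforms_transform[OF assms] unfolding qf_SL2_rel_def by blast

lemma equiv_qf_SL2_rel: "equiv (qforms D) (qf_SL2_rel D)"
proof (rule equivI)
  show "qf_SL2_rel D \<subseteq> qforms D \<times> qforms D" by (auto simp: qf_SL2_rel_def)
  show "refl_on (qforms D) (qf_SL2_rel D)"
    by (rule refl_onI) (auto intro!: qf_SL2_relI[where p = 1 and t = 1 and q = 0 and s = 0])
  show "sym (qf_SL2_rel D)"
  proof (rule symI)
    fix f g assume "(f, g) \<in> qf_SL2_rel D"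
    then obtain p q s t where d: "p * t - q * s = 1" "g \<in> qforms D"
      and e: "\<And>x y. qf_eval g x y = qf_eval f (p * x + q * y) (s * x + t * y)"
      by (auto simp: qf_SL2_rel_def)
    show "(g, f) \<in> qf_SL2_rel D"
    proof (rule qf_SL2_relI[OF d(2), of t p "-q" "-s"])
      fix x y
      have "p * (t * x + - q * y) + q * (- s * x + p * y) = (p * t - q * s) * x"
        "s * (t * x + - q * y) + t * (- s * x + p * y) = (p * t - q * s) * y" by (simp_all add: algebra_simps)
      then show "qf_eval f x y = qf_eval g (t * x + - q * y) (- s * x + p * y)" unfolding e by (simp add: d)
    qed (use d in \<open>simp add: algebra_simps\<close>)
  qed
  show "trans (qf_SL2_rel D)"
  proof (rule transI)
    fix f g h assume "(f, g) \<in> qf_SL2_rel D" "(g, h) \<in> qf_SL2_rel D"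
    then obtain p q s t p' q' s' t' where f: "f \<in> qforms D" and d: "p * t - q * s = 1" "p' * t' - q' * s' = 1"
      and e: "\<And>x y. qf_eval g x y = qf_eval f (p * x + q * y) (s * x + t * y)"
        "\<And>x y. qf_eval h x y = qf_eval g (p' * x + q' * y) (s' * x + t' * y)"
      by (auto simp: qf_SL2_rel_def)
    show "(f, h) \<in> qf_SL2_rel D"
    proof (rule qf_SL2_relI[OF f])
      show "(p * p' + q * s') * (s * q' + t * t') - (p * q' + q * t') * (s * p' + t * s') = 1"
      proof -
        have "(p * p' + q * s') * (s * q' + t * t') - (p * q' + q * t') * (s * p' + t * s')
          = (p * t - q * s) * (p' * t' - q' * s')" by (simp add: algebra_simps)
        then show ?thesis by (simp add: d)
      qed
      show "qf_eval h x y = qf_eval f ((p * p' + q * s') * x + (p * q' + q * t') * y)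
          ((s * p' + t * s') * x + (s * q' + t * t') * y)" for x y
        unfolding e by (simp add: algebra_simps)
    qed
  qed
qed

text \<open>The form with Selling parameters \<open>p, q, z\<close>: twice its value is \<open>p x\<^sup>2 + q y\<^sup>2 + z (x - y)\<^sup>2\<close>.\<close>

definition sell :: "int \<times> int \<times> int \<Rightarrow> qform" where
  "sell = (\<lambda>(p, q, z). ((p + z) div 2, - z, (q + z) div 2))"

definition sells :: "int \<Rightarrow> (int \<times> int \<times> int) set" where
  "sells D = {x\<in>nnset D. same_parity x}"

lemma taus_sells: "taus D = sum sell_wt3 (sells D)"
  by (simp add: taus_def sells_def)

lemma sell_eval:
  assumes "same_parity (p, q, z)"
  shows "2 * qf_eval (sell (p, q, z)) x y = p * x\<^sup>2 + q * y\<^sup>2 + z * (x - y)\<^sup>2"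
proof -
  have "even (p + z)" "even (q + z)" using assms by (auto simp: same_parity_def)
  then have "2 * ((p + z) div 2) = p + z" "2 * ((q + z) div 2) = q + z" by simp_all
  moreover have "2 * qf_eval (sell (p, q, z)) x y =
     (2 * ((p + z) div 2)) * x\<^sup>2 - 2 * z * x * y + (2 * ((q + z) div 2)) * y\<^sup>2"
    by (simp add: sell_def qf_eval_def algebra_simps)
  ultimately show ?thesis by (simp add: power2_eq_square algebra_simps)
qed

lemma sell_in_qforms:
  assumes D: "D > 0" and x: "(p, q, z) \<in> sells D"
  shows "sell (p, q, z) \<in> qforms D"
proof -
  have sp: "same_parity (p, q, z)" and nn: "p \<ge> 0" "q \<ge> 0" "z \<ge> 0" and e: "p * q + q * z + z * p = D"
    using x by (auto simp: sells_def nnset_def)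
  have "qf_eval (sell (p, q, z)) x y > 0" if "(x, y) \<noteq> (0, 0)" for x y
  proof -
    have ge: "p * x\<^sup>2 \<ge> 0" "q * y\<^sup>2 \<ge> 0" "z * (x - y)\<^sup>2 \<ge> 0" using nn by simp_all
    have "\<not> (p * x\<^sup>2 = 0 \<and> q * y\<^sup>2 = 0 \<and> z * (x - y)\<^sup>2 = 0)"
      using that e D by auto
    then have "p * x\<^sup>2 + q * y\<^sup>2 + z * (x - y)\<^sup>2 > 0" using ge by linarith
    then show ?thesis using sell_eval[OF sp, of x y] by linarith
  qed
  moreover have "qf_disc (sell (p, q, z)) = - D"
  proof -
    have "even (p + z)" "even (q + z)" using sp by (auto simp: same_parity_def)
    then have h: "2 * ((p + z) div 2) = p + z" "2 * ((q + z) div 2) = q + z" by simp_all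
    have "qf_disc (sell (p, q, z)) = z\<^sup>2 - (2 * ((p + z) div 2)) * (2 * ((q + z) div 2))"
      by (simp add: sell_def qf_disc_def)
    also have "\<dots> = - D" unfolding h using e by (simp add: power2_eq_square algebra_simps)
    finally show ?thesis .
  qed
  ultimately show ?thesis by (simp add: qforms_def qf_pos_def_def)
qed

lemma qform_pos:
  assumes "(a, b, c) \<in> qforms D"
  shows "a > 0" "c > 0" "a + b + c > 0" "a - b + c > 0"
proof -
  have "qf_eval (a, b, c) x y > 0" if "(x, y) \<noteq> (0, 0)" for x y
    using assms that by (auto simp: qforms_def qf_pos_def_def)
  from this[of 1 0] this[of 0 1] this[of 1 1] this[of 1 "-1"]
  show "a > 0" "c > 0" "a + b + c > 0" "a - b + c > 0" by (simp_all add: qf_eval_def)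
qed

lemma obtuse_sell:
  assumes f: "(a, b, c) \<in> qforms D" and "b \<le> 0" "2 * a + b \<ge> 0" "2 * c + b \<ge> 0"
  shows "(2 * a + b, 2 * c + b, - b) \<in> sells D" "sell (2 * a + b, 2 * c + b, - b) = (a, b, c)"
  using assms by (auto simp: sells_def nnset_def same_parity_def sell_def qforms_def qf_disc_def
      power2_eq_square algebra_simps)

text \<open>Take \<open>a + c\<close> minimal in the class; the shears by 1 and -1 then give
  \<open>\<bar>b\<bar> \<le> a\<close> and \<open>\<bar>b\<bar> \<le> c\<close>. If \<open>b\<close>
  is positive, one further shear replaces it by \<open>b - 2 * a\<close>, and the parameters become
  \<open>b\<close>, \<open>2 * c - b\<close>, \<open>2 * a - b\<close>.\<close>

lemma exists_sell:
  assumes f: "f \<in> qforms D"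
  shows "\<exists>x\<in>sells D. (f, sell x) \<in> qf_SL2_rel D"
proof -
  define m where "m = (\<lambda>(a::int, b::int, c::int). nat (a + c))"
  note eq = equiv_qf_SL2_rel[of D]
  have "(f, f) \<in> qf_SL2_rel D" using f eq by (meson equivE refl_onD)
  then obtain g where fg: "(f, g) \<in> qf_SL2_rel D" and min: "\<And>h. (f, h) \<in> qf_SL2_rel D \<Longrightarrow> m g \<le> m h"
    using ex_has_least_nat[of "\<lambda>g. (f, g) \<in> qf_SL2_rel D" f m] by blast
  obtain a b c where g: "g = (a, b, c)" by (cases g) auto
  have gq: "(a, b, c) \<in> qforms D" using fg by (auto simp: qf_SL2_rel_def g)
  have tr: "(f, h) \<in> qf_SL2_rel D" if "(g, h) \<in> qf_SL2_rel D" for h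
    using that fg eq by (meson equivE transD)
  have shift: "(g, (a, b + 2 * k * a, c + k * b + k\<^sup>2 * a)) \<in> qf_SL2_rel D" for k
    by (rule qf_SL2_relI[of g D 1 1 k 0])
      (use gq in \<open>simp_all add: g qf_eval_def power2_eq_square algebra_simps\<close>)
  have shift2: "(g, (a + k * b + k\<^sup>2 * c, b + 2 * k * c, c)) \<in> qf_SL2_rel D" for k
    by (rule qf_SL2_relI[of g D 1 1 0 k])
      (use gq in \<open>simp_all add: g qf_eval_def power2_eq_square algebra_simps\<close>)
  have ab: "\<bar>b\<bar> \<le> a" "\<bar>b\<bar> \<le> c"
    using min[OF tr[OF shift[of 1]]] min[OF tr[OF shift[of "-1"]]] min[OF tr[OF shift2[of 1]]]
      min[OF tr[OF shift2[of "-1"]]] qform_pos[OF gq]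
    by (simp_all add: m_def g)
  show ?thesis
  proof (cases "b \<le> 0")
    case True
    have "2 * a + b \<ge> 0" "2 * c + b \<ge> 0" using ab by linarith+
    from obtuse_sell[OF gq True this] show ?thesis using fg g by (intro bexI[of _ "(2 * a + b, 2 * c + b, - b)"]) simp_all
  next
    case False
    have fh: "(f, (a, b - 2 * a, c - b + a)) \<in> qf_SL2_rel D" using tr[OF shift[of "-1"]] by simp
    then have h: "(a, b - 2 * a, c - b + a) \<in> qforms D" by (simp add: qf_SL2_rel_def)
    have b: "b \<le> a" "b \<le> c" "b > 0" using ab False by simp_all
    then have "b - 2 * a \<le> 0" "2 * a + (b - 2 * a) \<ge> 0" by simp_all
    moreover have "2 * (c - b + a) + (b - 2 * a) = c + (c - b)" by simp
    then have "2 * (c - b + a) + (b - 2 * a) \<ge> 0" using b by simp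
    ultimately have o: "b - 2 * a \<le> 0" "2 * a + (b - 2 * a) \<ge> 0" "2 * (c - b + a) + (b - 2 * a) \<ge> 0"
      by blast+
    from obtuse_sell[OF h o] show ?thesis using fh by (metis (no_types))
  qed
qed

text \<open>The substitution of \<open>(y, y - x)\<close> for \<open>(x, y)\<close> has determinant
  1 and permutes \<open>x^2\<close>, \<open>y^2\<close>, \<open>(x - y)^2\<close>
  cyclically.\<close>

lemma sell_rot:
  assumes D: "D > 0" and x: "(p, q, z) \<in> sells D"
  shows "(z, p, q) \<in> sells D" "(sell (p, q, z), sell (z, p, q)) \<in> qf_SL2_rel D"
proof -
  show z: "(z, p, q) \<in> sells D" using x by (auto simp: sells_def nnset_def same_parity_def algebra_simps)
  have sp: "same_parity (p, q, z)" "same_parity (z, p, q)" using x z by (auto simp: sells_def)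
  show "(sell (p, q, z), sell (z, p, q)) \<in> qf_SL2_rel D"
  proof (rule qf_SL2_relI[OF sell_in_qforms[OF D x], of 0 1 1 "-1"])
    fix u v
    have "2 * qf_eval (sell (z, p, q)) u v = 2 * qf_eval (sell (p, q, z)) (0 * u + 1 * v) (- 1 * u + 1 * v)"
      unfolding sell_eval[OF sp(1)] sell_eval[OF sp(2)] by (simp add: power2_eq_square algebra_simps)
    then show "qf_eval (sell (z, p, q)) u v = qf_eval (sell (p, q, z)) (0 * u + 1 * v) (- 1 * u + 1 * v)"
      by simp
  qed simp
qed

text \<open>Exchanging the variables has determinant -1. If the third parameter is 0, the sign of
  one variable does not matter and can be used to correct the determinant.\<close>

lemma sell_swap:
  assumes D: "D > 0" and x: "(p, q, 0) \<in> sells D"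
  shows "(q, p, 0) \<in> sells D" "(sell (p, q, 0), sell (q, p, 0)) \<in> qf_SL2_rel D"
proof -
  show z: "(q, p, 0) \<in> sells D" using x by (auto simp: sells_def nnset_def same_parity_def algebra_simps)
  have sp: "same_parity (p, q, 0)" "same_parity (q, p, 0)" using x z by (auto simp: sells_def)
  show "(sell (p, q, 0), sell (q, p, 0)) \<in> qf_SL2_rel D"
  proof (rule qf_SL2_relI[OF sell_in_qforms[OF D x], of 0 0 "-1" 1])
    fix u v
    have "2 * qf_eval (sell (q, p, 0)) u v = 2 * qf_eval (sell (p, q, 0)) (0 * u + - 1 * v) (1 * u + 0 * v)"
      unfolding sell_eval[OF sp(1)] sell_eval[OF sp(2)] by (simp add: power2_eq_square algebra_simps)
    then show "qf_eval (sell (q, p, 0)) u v = qf_eval (sell (p, q, 0)) (0 * u + - 1 * v) (1 * u + 0 * v)"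
      by simp
  qed simp
qed

lemma one_le_square: "(x::int) \<noteq> 0 \<Longrightarrow> 1 \<le> x\<^sup>2"
  using zero_less_power2[of x] by linarith

section \<open>Minima on the cosets modulo 2\<close>

definition sell_form :: "int \<times> int \<times> int \<Rightarrow> int \<Rightarrow> int \<Rightarrow> int" where
  "sell_form = (\<lambda>(p, q, z) x y. p * x\<^sup>2 + q * y\<^sup>2 + z * (x - y)\<^sup>2)"

text \<open>The value of \<open>sell_form\<close> at \<open>(1, 1)\<close>, \<open>(1, 0)\<close>,
  \<open>(0, 1)\<close> or \<open>(0, 0)\<close>, the standard representative of the coset.\<close>

definition coset_min :: "int \<times> int \<times> int \<Rightarrow> bool \<Rightarrow> bool \<Rightarrow> int" where
  "coset_min = (\<lambda>(p, q, z) ox oy. if ox \<and> oy then p + q else if ox then p + z else if oy then q + z else 0)"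

lemma coset_min_le:
  assumes "p \<ge> 0" "q \<ge> 0" "z \<ge> 0"
  shows "coset_min (p, q, z) (odd x) (odd y) \<le> sell_form (p, q, z) x y"
proof -
  have ge: "p * x\<^sup>2 \<ge> (if x = 0 then 0 else p)" "q * y\<^sup>2 \<ge> (if y = 0 then 0 else q)"
    "z * (x - y)\<^sup>2 \<ge> (if x = y then 0 else z)"
    using mult_left_mono[OF one_le_square[of x] assms(1)] mult_left_mono[OF one_le_square[of y] assms(2)]
      mult_left_mono[OF one_le_square[of "x - y"] assms(3)] by auto
  have "odd x \<Longrightarrow> x \<noteq> 0" "odd y \<Longrightarrow> y \<noteq> 0" "odd x \<noteq> odd y \<Longrightarrow> x \<noteq> y" by auto
  then show ?thesis
    using ge assms unfolding coset_min_def sell_form_def prod.case by (auto split: if_splits)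
qed

text \<open>Uniqueness of the minimal vectors up to sign is what excludes transpositions of positive
  parameters in \<open>sell_equiv_imp\<close>.\<close>

lemma coset_min_eq_imp:
  assumes "p > 0" "q > 0" "z > 0" "sell_form (p, q, z) x y = coset_min (p, q, z) (odd x) (odd y)"
  shows "(odd x \<and> even y \<longrightarrow> y = 0 \<and> \<bar>x\<bar> = 1) \<and> (even x \<and> odd y \<longrightarrow> x = 0 \<and> \<bar>y\<bar> = 1)
    \<and> (odd x \<and> odd y \<longrightarrow> x = y \<and> \<bar>x\<bar> = 1)"
proof -
  have key: "u\<^sup>2 = 1 \<and> v\<^sup>2 = 1 \<and> w\<^sup>2 = 0"
    if "a > 0" "b > 0" "c > 0" "u \<noteq> 0" "v \<noteq> 0" "a * u\<^sup>2 + b * v\<^sup>2 + c * w\<^sup>2 = a + b" for a b c u v w :: int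
  proof -
    have "u\<^sup>2 \<ge> 1" "v\<^sup>2 \<ge> 1" "w\<^sup>2 \<ge> 0" using that one_le_square by auto
    then have "a * (u\<^sup>2 - 1) \<ge> 0" "b * (v\<^sup>2 - 1) \<ge> 0" "c * w\<^sup>2 \<ge> 0" using that by simp_all
    moreover have "a * (u\<^sup>2 - 1) + b * (v\<^sup>2 - 1) + c * w\<^sup>2 = 0" using that by (simp add: algebra_simps)
    ultimately have "a * (u\<^sup>2 - 1) = 0" "b * (v\<^sup>2 - 1) = 0" "c * w\<^sup>2 = 0" by linarith+
    then show ?thesis using that by simp
  qed
  have sq1: "\<bar>u\<bar> = 1" if "u\<^sup>2 = 1" for u :: int using that by (auto simp: power2_eq_1_iff)
  show ?thesis
  proof (intro conjI impI; elim conjE)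
    assume o: "odd x" "even y"
    then have "x \<noteq> 0" "x - y \<noteq> 0" by auto
    then have "x\<^sup>2 = 1 \<and> (x - y)\<^sup>2 = 1 \<and> y\<^sup>2 = 0"
      using o assms by (intro key[of p z q]) (simp_all add: sell_form_def coset_min_def)
    then show "y = 0" "\<bar>x\<bar> = 1" using sq1 by auto
  next
    assume o: "even x" "odd y"
    then have "y \<noteq> 0" "x - y \<noteq> 0" by auto
    then have "y\<^sup>2 = 1 \<and> (x - y)\<^sup>2 = 1 \<and> x\<^sup>2 = 0"
      using o assms by (intro key[of q z p]) (simp_all add: sell_form_def coset_min_def)
    then show "x = 0" "\<bar>y\<bar> = 1" using sq1 by auto
  next
    assume o: "odd x" "odd y"
    then have "x \<noteq> 0" "y \<noteq> 0" by auto
    then have "x\<^sup>2 = 1 \<and> y\<^sup>2 = 1 \<and> (x - y)\<^sup>2 = 0"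
      using o assms by (intro key[of p q z]) (simp_all add: sell_form_def coset_min_def)
    then show "x = y" "\<bar>x\<bar> = 1" using sq1 by auto
  qed
qed

text \<open>Modulo 2 the matrix permutes the three nonzero cosets, whose minima add up to
  \<open>2 * (p + q + z)\<close>. The values at the images of \<open>(1, 0)\<close>,
  \<open>(0, 1)\<close>, \<open>(1, 1)\<close> add up to \<open>2 * (p' + q' + z')\<close>; equality
  of the sums forces equality in each coset.\<close>

lemma sell_sum_le:
  assumes nn: "p \<ge> 0" "q \<ge> 0" "z \<ge> 0" and det: "P * T - Q * U = (1::int)"
    and e: "\<And>x y. sell_form (p', q', z') x y = sell_form (p, q, z) (P * x + Q * y) (U * x + T * y)"
  shows "p + q + z \<le> p' + q' + z'"
    and "p + q + z = p' + q' + z' \<Longrightarrow> sell_form (p, q, z) P U = coset_min (p, q, z) (odd P) (odd U)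
      \<and> sell_form (p, q, z) Q T = coset_min (p, q, z) (odd Q) (odd T)
      \<and> sell_form (p, q, z) (P + Q) (U + T) = coset_min (p, q, z) (odd (P + Q)) (odd (U + T))"
proof -
  have v: "p' + z' = sell_form (p, q, z) P U" "q' + z' = sell_form (p, q, z) Q T"
    "p' + q' = sell_form (p, q, z) (P + Q) (U + T)"
    using e[of 1 0] e[of 0 1] e[of 1 1] by (simp_all add: sell_form_def)
  have "odd (P * T - Q * U)" using det by simp
  then have "coset_min (p, q, z) (odd P) (odd U) + coset_min (p, q, z) (odd Q) (odd T)
     + coset_min (p, q, z) (odd (P + Q)) (odd (U + T)) = 2 * (p + q + z)"
    unfolding coset_min_def by (cases "even P"; cases "even Q"; cases "even U"; cases "even T") simp_all
  note fs = this v coset_min_le[OF nn, of P U] coset_min_le[OF nn, of Q T] coset_min_le[OF nn, of "P + Q" "U + T"]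
  have lin: "s \<le> x + y + w" "s = x + y + w \<Longrightarrow> X = A \<and> Y = B \<and> Z = C"
    if "A + B + C = 2 * s" "x + w = X" "y + w = Y" "x + y = Z" "A \<le> X" "B \<le> Y" "C \<le> Z" for A B C s x y w X Y Z :: int
    using that by linarith+
  show "p + q + z \<le> p' + q' + z'" by (rule lin(1)[OF fs])
  assume "p + q + z = p' + q' + z'"
  then show "sell_form (p, q, z) P U = coset_min (p, q, z) (odd P) (odd U)
      \<and> sell_form (p, q, z) Q T = coset_min (p, q, z) (odd Q) (odd T)
      \<and> sell_form (p, q, z) (P + Q) (U + T) = coset_min (p, q, z) (odd (P + Q)) (odd (U + T))"
    by (rule lin(2)[OF fs])
qed

text \<open>Equivalent forms with nonnegative Selling parameters have the same sum of the minima on the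
  three nonzero cosets modulo 2; so the three minima agree up to order, and with them the parameters.\<close>

lemma sell_equiv_imp:
  assumes x: "(p, q, z) \<in> sells D" and y: "(p', q', z') \<in> sells D"
    and rel: "(sell (p, q, z), sell (p', q', z')) \<in> qf_SL2_rel D"
  shows "(p', q', z') \<in> {(p, q, z), (q, z, p), (z, p, q)} \<or>
    ((p', q', z') \<in> {(q, p, z), (p, z, q), (z, q, p)} \<and> (p = 0 \<or> q = 0 \<or> z = 0))"
proof -
  have sf: "sell_form (p, q, z) u v = 2 * qf_eval (sell (p, q, z)) u v"
    if "(p, q, z) \<in> sells D" for p q z u v
    using sell_eval[of p q z u v] that by (simp add: sells_def sell_form_def)
  have nn: "p \<ge> 0" "q \<ge> 0" "z \<ge> 0" "p' \<ge> 0" "q' \<ge> 0" "z' \<ge> 0"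
    using x y by (auto simp: sells_def nnset_def)
  obtain P Q U T where det: "P * T - Q * U = 1" and
    e: "\<And>u v. qf_eval (sell (p', q', z')) u v = qf_eval (sell (p, q, z)) (P * u + Q * v) (U * u + T * v)"
    using rel by (auto simp: qf_SL2_rel_def)
  have e1: "sell_form (p', q', z') u v = sell_form (p, q, z) (P * u + Q * v) (U * u + T * v)" for u v
    using e by (simp add: sf[OF x] sf[OF y])
  have "(sell (p', q', z'), sell (p, q, z)) \<in> qf_SL2_rel D"
    using rel equiv_qf_SL2_rel by (meson equivE symD)
  then obtain P' Q' U' T' where det': "P' * T' - Q' * U' = 1" and
    e': "\<And>u v. qf_eval (sell (p, q, z)) u v = qf_eval (sell (p', q', z')) (P' * u + Q' * v) (U' * u + T' * v)"
    by (auto simp: qf_SL2_rel_def)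
  have e2: "sell_form (p, q, z) u v = sell_form (p', q', z') (P' * u + Q' * v) (U' * u + T' * v)" for u v
    using e' by (simp add: sf[OF x] sf[OF y])
  have sum: "p + q + z = p' + q' + z'"
    using sell_sum_le(1)[OF nn(1-3) det e1] sell_sum_le(1)[OF nn(4-6) det' e2] by linarith
  note eqs = sell_sum_le(2)[OF nn(1-3) det e1 sum]
  have v: "p' + z' = coset_min (p, q, z) (odd P) (odd U)" "q' + z' = coset_min (p, q, z) (odd Q) (odd T)"
    using eqs e1[of 1 0] e1[of 0 1] by (simp_all add: sell_form_def)
  have oddet: "odd (P * T - Q * U)" using det by simp
  \<comment> \<open>These are the odd permutations of the three cosets. Unique minimal vectors would
    then determine the matrix up to signs, and its determinant would be -1.\<close>
  have strict: "\<not> (odd P \<and> even U \<and> odd Q \<and> odd T) \<and> \<not> (even P \<and> odd U \<and> odd Q \<and> even T)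
      \<and> \<not> (odd P \<and> odd U \<and> even Q \<and> odd T)" if pos: "p > 0" "q > 0" "z > 0"
  proof -
    have c: "sell_form (p, q, z) P U = coset_min (p, q, z) (odd P) (odd U)"
      "sell_form (p, q, z) Q T = coset_min (p, q, z) (odd Q) (odd T)"
      "sell_form (p, q, z) (P + Q) (U + T) = coset_min (p, q, z) (odd (P + Q)) (odd (U + T))"
      using eqs by auto
    note i = coset_min_eq_imp[OF pos c(1)] coset_min_eq_imp[OF pos c(2)] coset_min_eq_imp[OF pos c(3)]
    have ab: "w = 1 \<or> w = - 1" if "\<bar>w\<bar> = 1" for w :: int using that by linarith
    show ?thesis
    proof (intro conjI notI; elim conjE)
      assume o: "odd P" "even U" "odd Q" "odd T"
      then have "U = 0" "\<bar>P\<bar> = 1" "Q = T" "\<bar>Q\<bar> = 1" "P + Q = 0" using i by auto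
      then show False using det ab[of P] ab[of Q] by auto
    next
      assume o: "even P" "odd U" "odd Q" "even T"
      then have "P = 0" "\<bar>U\<bar> = 1" "T = 0" "\<bar>Q\<bar> = 1" "P + Q = U + T" using i by auto
      then show False using det ab[of U] ab[of Q] by auto
    next
      assume o: "odd P" "odd U" "even Q" "odd T"
      then have "P = U" "\<bar>P\<bar> = 1" "Q = 0" "\<bar>T\<bar> = 1" "U + T = 0" using i by auto
      then show False using det ab[of P] ab[of T] by auto
    qed
  qed
  \<comment> \<open>The six invertible matrices modulo 2; the first three permute the cosets
    evenly.\<close>
  consider "odd P" "even U" "even Q" "odd T" | "odd P" "odd U" "odd Q" "even T" | "even P" "odd U" "odd Q" "odd T"
    | "odd P" "even U" "odd Q" "odd T" | "even P" "odd U" "odd Q" "even T" | "odd P" "odd U" "even Q" "odd T"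
    using oddet by (cases "even P"; cases "even Q"; cases "even U"; cases "even T") simp_all
  then show ?thesis
  proof cases
    case 1 then show ?thesis using v sum by (simp add: coset_min_def)
  next
    case 2 then show ?thesis using v sum by (simp add: coset_min_def)
  next
    case 3 then show ?thesis using v sum by (simp add: coset_min_def)
  next
    case 4
    then have "p = 0 \<or> q = 0 \<or> z = 0" using strict nn by (rule_tac ccontr) simp
    then show ?thesis using v sum 4 by (auto simp: coset_min_def)
  next
    case 5
    then have "p = 0 \<or> q = 0 \<or> z = 0" using strict nn by (rule_tac ccontr) simp
    then show ?thesis using v sum 5 by (auto simp: coset_min_def)
  next
    case 6
    then have "p = 0 \<or> q = 0 \<or> z = 0" using strict nn by (rule_tac ccontr) simp
    then show ?thesis using v sum 6 by (auto simp: coset_min_def)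
  qed
qed

text \<open>If a parameter is 0, a rotation brings it to the third place, where
  \<open>sell_swap\<close> applies; together with the rotations this yields all six orders.\<close>

lemma class_sells:
  assumes D: "D > 0" and x: "(p, q, z) \<in> sells D"
  shows "{y\<in>sells D. (sell (p, q, z), sell y) \<in> qf_SL2_rel D} = {(p, q, z), (q, z, p), (z, p, q)} \<union>
    (if p = 0 \<or> q = 0 \<or> z = 0 then {(q, p, z), (p, z, q), (z, q, p)} else {})"
proof -
  let ?R = "\<lambda>x y. y \<in> sells D \<and> (sell x, sell y) \<in> qf_SL2_rel D"
  have tr: "?R x w" if "?R x y" "?R y w" for x y w
    using that equiv_qf_SL2_rel[of D] by (meson equivE transD)
  have "?R (p, q, z) (z, p, q)" using sell_rot[OF D x] by simp
  moreover from this have "?R (z, p, q) (q, z, p)" using sell_rot[OF D, of z p q] by simp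
  moreover from this have "?R (q, z, p) (p, q, z)" using sell_rot[OF D, of q z p] by simp
  ultimately have rots: "?R (p, q, z) (z, p, q)" "?R (p, q, z) (q, z, p)" "?R (p, q, z) (p, q, z)"
    using tr by blast+
  have odd_perms: "?R (p, q, z) (q, p, z) \<and> ?R (p, q, z) (p, z, q) \<and> ?R (p, q, z) (z, q, p)"
    if "p = 0 \<or> q = 0 \<or> z = 0"
  proof -
    have one: "?R (p, q, z) y" if y: "?R (p, q, z) (a, b, 0)" "y \<in> {(b, a, 0), (a, 0, b), (0, b, a)}" for a b y
    proof -
      have 1: "?R (a, b, 0) (b, a, 0)" using sell_swap[OF D] y(1) by blast
      then have 2: "?R (b, a, 0) (0, b, a)" using sell_rot[OF D] by blast
      then have 3: "?R (0, b, a) (a, 0, b)" using sell_rot[OF D] by blast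
      show ?thesis using y tr[OF y(1) 1] tr[OF tr[OF y(1) 1] 2] tr[OF tr[OF tr[OF y(1) 1] 2] 3] by blast
    qed
    from that show ?thesis
    proof (elim disjE)
      assume e: "p = 0"
      have r: "?R (p, q, z) (q, z, 0)" using rots(2) e by simp
      show ?thesis using one[OF r, of "(z, q, 0)"] one[OF r, of "(q, 0, z)"] one[OF r, of "(0, z, q)"] e by simp
    next
      assume e: "q = 0"
      have r: "?R (p, q, z) (z, p, 0)" using rots(1) e by simp
      show ?thesis using one[OF r, of "(p, z, 0)"] one[OF r, of "(z, 0, p)"] one[OF r, of "(0, p, z)"] e by simp
    next
      assume e: "z = 0"
      have r: "?R (p, q, z) (p, q, 0)" using rots(3) e by simp
      show ?thesis using one[OF r, of "(q, p, 0)"] one[OF r, of "(p, 0, q)"] one[OF r, of "(0, q, p)"] e by simp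
    qed
  qed
  show ?thesis
  proof (intro equalityI subsetI)
    fix y assume y: "y \<in> {y\<in>sells D. (sell (p, q, z), sell y) \<in> qf_SL2_rel D}"
    obtain p' q' z' where y': "y = (p', q', z')" by (cases y)
    have "(p', q', z') \<in> sells D" "(sell (p, q, z), sell (p', q', z')) \<in> qf_SL2_rel D" using y y' by simp_all
    from sell_equiv_imp[OF x this]
    show "y \<in> {(p, q, z), (q, z, p), (z, p, q)} \<union>
      (if p = 0 \<or> q = 0 \<or> z = 0 then {(q, p, z), (p, z, q), (z, q, p)} else {})"
      unfolding y' by (cases "p = 0 \<or> q = 0 \<or> z = 0") (simp_all only: if_True if_False, blast+)
  next
    fix y assume y: "y \<in> {(p, q, z), (q, z, p), (z, p, q)} \<union>
      (if p = 0 \<or> q = 0 \<or> z = 0 then {(q, p, z), (p, z, q), (z, q, p)} else {})"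
    show "y \<in> {y\<in>sells D. (sell (p, q, z), sell y) \<in> qf_SL2_rel D}"
    proof (cases "p = 0 \<or> q = 0 \<or> z = 0")
      case True
      then have "y \<in> {(p, q, z), (q, z, p), (z, p, q), (q, p, z), (p, z, q), (z, q, p)}"
        using y by (simp only: if_True) blast
      then show ?thesis using rots odd_perms[OF True] by blast
    next
      case False
      then have "y \<in> {(p, q, z), (q, z, p), (z, p, q)}" using y by (simp only: if_False) blast
      then show ?thesis using rots by blast
    qed
  qed
qed

section \<open>Selling parameters and class weights\<close>

lemma sum_sell_wt3_boundary:
  assumes "a > 0" "b > 0"
  shows "sum sell_wt3 {(a, b, 0), (b, 0, a), (0, a, b), (b, a, 0), (a, 0, b), (0, b, a)} = (if a = b then 3 else 6)"
proof (cases "a = b")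
  case True
  then have "{(a, b, 0), (b, 0, a), (0, a, b), (b, a, 0), (a, 0, b), (0, b, a)} = {(a, a, 0), (a, 0, a), (0, a, a)}"
    by blast
  then show ?thesis using True assms by (simp add: sell_wt3_nonneg)
next
  case False
  then show ?thesis using assms by (simp add: sell_wt3_nonneg)
qed

text \<open>A class with positive parameters contains three rotations of weight 2, or a single
  triple of weight 2 if they are all equal, giving 6 or 2. With a zero parameter there are six
  orders of weight 1, or three if the nonzero parameters agree, giving 6 or 3. These are the class
  weights 1, 1/3 and 1/2.\<close>

lemma class_sum:
  assumes D: "D > 0" and C: "C \<in> qforms D // qf_SL2_rel D"
  shows "of_int (sum sell_wt3 {y\<in>sells D. sell y \<in> C}) = 6 * class_weight C"
proof -
  note eq = equiv_qf_SL2_rel[of D]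
  obtain f where f: "f \<in> qforms D" "C = qf_SL2_rel D `` {f}" using C by (rule quotientE)
  obtain x where x: "x \<in> sells D" "(f, sell x) \<in> qf_SL2_rel D" using exists_sell[OF f(1)] by blast
  obtain p q z where pqz: "x = (p, q, z)" by (cases x)
  have Ceq: "g \<in> C \<longleftrightarrow> (sell (p, q, z), g) \<in> qf_SL2_rel D" for g
    using equiv_class_eq[OF eq x(2)] f(2) by (simp add: pqz Image_singleton_iff)
  have nn: "p \<ge> 0" "q \<ge> 0" "z \<ge> 0" and sp: "even (p - q)" "even (q - z)" and e2: "p * q + q * z + z * p = D"
    using x(1) by (auto simp: sells_def nnset_def pqz same_parity_def)
  have set: "{y\<in>sells D. sell y \<in> C} = {(p, q, z), (q, z, p), (z, p, q)} \<union>
    (if p = 0 \<or> q = 0 \<or> z = 0 then {(q, p, z), (p, z, q), (z, q, p)} else {})"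
    unfolding Ceq using class_sells[OF D] x(1) by (simp add: pqz)
  have mem: "y \<in> {(p, q, z), (q, z, p), (z, p, q)} \<union>
    (if p = 0 \<or> q = 0 \<or> z = 0 then {(q, p, z), (p, z, q), (z, q, p)} else {}) \<longleftrightarrow> y \<in> sells D \<and> sell y \<in> C" for y
    unfolding set[symmetric] by simp
  have two: "(\<exists>a. (a, 0, a) \<in> C) \<longleftrightarrow> (\<exists>a. (a, a, 0) \<in> {y\<in>sells D. sell y \<in> C})"
  proof
    assume "\<exists>a. (a, 0, a) \<in> C"
    then obtain a where a: "(a, 0, a) \<in> C" by blast
    then have "(a, 0, a) \<in> qforms D" unfolding Ceq by (simp add: qf_SL2_rel_def)
    then have "(2 * a, 2 * a, 0) \<in> sells D" "sell (2 * a, 2 * a, 0) = (a, 0, a)"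
      using obtuse_sell[of a 0 a D] qform_pos[of a 0 a D] by simp_all
    then show "\<exists>a. (a, a, 0) \<in> {y\<in>sells D. sell y \<in> C}" using a by (intro exI[of _ "2 * a"]) simp
  next
    assume "\<exists>a. (a, a, 0) \<in> {y\<in>sells D. sell y \<in> C}"
    then show "\<exists>a. (a, 0, a) \<in> C" by (auto simp: sell_def)
  qed
  \<comment> \<open>The form \<open>(a, a, a)\<close> has a positive middle coefficient and is not
    of the shape \<open>sell\<close>; the equivalent form \<open>(a, - a, a)\<close> is
    \<open>sell (a, a, a)\<close>.\<close>
  have three: "(\<exists>a. (a, a, a) \<in> C) \<longleftrightarrow> (\<exists>a. (a, a, a) \<in> {y\<in>sells D. sell y \<in> C})"
  proof
    assume "\<exists>a. (a, a, a) \<in> C"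
    then obtain a where a: "(a, a, a) \<in> C" by blast
    then have q: "(a, a, a) \<in> qforms D" unfolding Ceq by (simp add: qf_SL2_rel_def)
    have r: "((a, a, a), (a, - a, a)) \<in> qf_SL2_rel D"
      by (rule qf_SL2_relI[OF q, of 1 1 "-1" 0]) (simp_all add: qf_eval_def power2_eq_square algebra_simps)
    then have "(a, - a, a) \<in> qforms D" by (simp add: qf_SL2_rel_def)
    then have "(a, a, a) \<in> sells D" "sell (a, a, a) = (a, - a, a)"
      using obtuse_sell[of a "- a" a D] qform_pos[OF q] by simp_all
    moreover have "(a, - a, a) \<in> C" using a r eq unfolding Ceq by (meson equivE transD)
    ultimately show "\<exists>a. (a, a, a) \<in> {y\<in>sells D. sell y \<in> C}" by (intro exI[of _ a]) simp
  next
    assume "\<exists>a. (a, a, a) \<in> {y\<in>sells D. sell y \<in> C}"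
    then obtain a where a: "(a, a, a) \<in> sells D" "(a, - a, a) \<in> C" by (auto simp: sell_def)
    then have q: "(a, - a, a) \<in> qforms D" unfolding Ceq by (simp add: qf_SL2_rel_def)
    have r: "((a, - a, a), (a, a, a)) \<in> qf_SL2_rel D"
      by (rule qf_SL2_relI[OF q, of 1 1 1 0]) (simp_all add: qf_eval_def power2_eq_square algebra_simps)
    then have "(a, a, a) \<in> C" using a(2) eq unfolding Ceq by (meson equivE transD)
    then show "\<exists>a. (a, a, a) \<in> C" by blast
  qed
  have pos2: "p \<noteq> 0 \<or> q \<noteq> 0" "q \<noteq> 0 \<or> z \<noteq> 0" "z \<noteq> 0 \<or> p \<noteq> 0" using e2 D by auto
  show ?thesis
  proof (cases "p = 0 \<or> q = 0 \<or> z = 0")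
    case True
    then have s: "{y\<in>sells D. sell y \<in> C} = {(p, q, z), (q, z, p), (z, p, q), (q, p, z), (p, z, q), (z, q, p)}"
      using set by auto
    have no3: "\<not> (\<exists>a. (a, a, a) \<in> C)" unfolding three s using True pos2 by auto
    have "(\<exists>a. (a, a, 0) \<in> {(p, q, z), (q, z, p), (z, p, q), (q, p, z), (p, z, q), (z, q, p)}) \<longleftrightarrow>
        p = q \<and> z = 0 \<or> q = z \<and> p = 0 \<or> z = p \<and> q = 0" by (simp add: ex_disj_distrib) blast
    then have half: "(\<exists>a. (a, 0, a) \<in> C) \<longleftrightarrow> p = q \<or> q = z \<or> z = p" unfolding two s using True pos2 by blast
    obtain a b where ab: "a > 0" "b > 0" "(p = q \<or> q = z \<or> z = p) \<longleftrightarrow> a = b"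
      "{(p, q, z), (q, z, p), (z, p, q), (q, p, z), (p, z, q), (z, q, p)} =
        {(a, b, 0), (b, 0, a), (0, a, b), (b, a, 0), (a, 0, b), (0, b, a)}"
    proof -
      from True consider "p = 0" | "q = 0" | "z = 0" by blast
      then show ?thesis
      proof cases
        case 1
        then have "q > 0" "z > 0" using pos2 nn by auto
        then show ?thesis using 1 by (intro that[of q z]) (simp_all, blast?)
      next
        case 2
        then have "z > 0" "p > 0" using pos2 nn by auto
        then show ?thesis using 2 by (intro that[of z p]) (simp_all, blast?)
      next
        case 3
        then have "p > 0" "q > 0" using pos2 nn by auto
        then show ?thesis using 3 by (intro that[of p q]) (simp_all, blast?)
      qed
    qed
    have "sum sell_wt3 {y\<in>sells D. sell y \<in> C} = (if a = b then 3 else 6)"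
      unfolding s ab(4) by (rule sum_sell_wt3_boundary[OF ab(1,2)])
    then show ?thesis unfolding class_weight_def half ab(3) by (simp add: no3)
  next
    case False
    then have s: "{y\<in>sells D. sell y \<in> C} = {(p, q, z), (q, z, p), (z, p, q)}" using set by auto
    have no2: "\<not> (\<exists>a. (a, 0, a) \<in> C)" unfolding two s using False by auto
    have third: "(\<exists>a. (a, a, a) \<in> C) \<longleftrightarrow> p = q \<and> q = z" unfolding three s by auto
    have pos: "p > 0" "q > 0" "z > 0" using False nn by auto
    have "sum sell_wt3 {y\<in>sells D. sell y \<in> C} = (if p = q \<and> q = z then 2 else 6)"
    proof (cases "p = q \<and> q = z")
      case True
      then show ?thesis unfolding s using pos by (simp add: sell_wt3_nonneg)
    next
      case False
      then have "(p, q, z) \<noteq> (q, z, p)" "(p, q, z) \<noteq> (z, p, q)" "(q, z, p) \<noteq> (z, p, q)" by auto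
      then have "sum sell_wt3 {(p, q, z), (q, z, p), (z, p, q)} = sell_wt3 (p, q, z) + (sell_wt3 (q, z, p) + sell_wt3 (z, p, q))"
        by (subst sum.insert; simp)+
      then show ?thesis unfolding s using False pos by (simp add: sell_wt3_nonneg)
    qed
    then show ?thesis unfolding class_weight_def third by (simp add: no2)
  qed
qed

theorem H_taus:
  assumes D: "D > 0"
  shows "6 * H D = of_int (taus D)"
proof (cases "D mod 4 \<in> {1, 2}")
  case True
  have "sells D = {}"
  proof (rule ccontr)
    assume "sells D \<noteq> {}"
    then obtain p q z where x: "(p, q, z) \<in> sells D" by (metis ex_in_conv prod_cases3)
    then have "qf_disc (sell (p, q, z)) = - D" using sell_in_qforms[OF D] by (simp add: qforms_def)
    then obtain a b c :: int where "b\<^sup>2 - 4 * a * c = - D" by (auto simp: qf_disc_def split: prod.splits)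
    then have D': "D = 4 * (a * c) - b\<^sup>2" by simp
    have sq: "b\<^sup>2 mod 4 = 0 \<or> b\<^sup>2 mod 4 = 1"
    proof (cases "even b")
      case True then obtain k where "b = 2 * k" by auto
      then have "b\<^sup>2 = 4 * k\<^sup>2" by (simp add: power2_eq_square)
      then show ?thesis by simp
    next
      case False then obtain k where "b = 2 * k + 1" by (auto elim: oddE)
      then have "b\<^sup>2 = 4 * (k\<^sup>2 + k) + 1" by (simp add: power2_eq_square algebra_simps)
      then show ?thesis by presburger
    qed
    have gen: "(4 * e - B) mod 4 \<notin> {1, 2}" if "B mod 4 = 0 \<or> B mod 4 = 1" for e B :: int
      using that by (simp, presburger)
    have "(4 * (a * c) - b\<^sup>2) mod 4 \<notin> {1, 2}" by (rule gen[OF sq])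
    then show False using True by (simp only: D')
  qed
  then show ?thesis using True D by (simp add: H_def taus_sells)
next
  case False
  let ?Q = "qforms D // qf_SL2_rel D"
  note eq = equiv_qf_SL2_rel[of D]
  have fin: "finite (sells D)" using finite_nnset[OF D] by (simp add: sells_def)
  have cover: "\<exists>y\<in>sells D. sell y \<in> C" if "C \<in> ?Q" for C
    using that exists_sell by (fastforce elim!: quotientE)
  have "?Q \<subseteq> (\<lambda>y. qf_SL2_rel D `` {sell y}) ` sells D"
  proof
    fix C assume C: "C \<in> ?Q"
    then obtain y where y: "y \<in> sells D" "sell y \<in> C" using cover by blast
    obtain f where f: "C = qf_SL2_rel D `` {f}" using C by (rule quotientE)
    then have "C = qf_SL2_rel D `` {sell y}" using equiv_class_eq[OF eq, of f "sell y"] y(2) by simp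
    then show "C \<in> (\<lambda>y. qf_SL2_rel D `` {sell y}) ` sells D" using y(1) by blast
  qed
  then have finQ: "finite ?Q" using fin finite_subset by blast
  have un: "sells D = (\<Union>C\<in>?Q. {y\<in>sells D. sell y \<in> C})"
  proof -
    have "sell y \<in> \<Union>?Q" if "y \<in> sells D" for y
      using that sell_in_qforms[OF D] Union_quotient[OF eq] by (cases y) simp
    then show ?thesis by auto
  qed
  have "sum sell_wt3 (sells D) = (\<Sum>C\<in>?Q. sum sell_wt3 {y\<in>sells D. sell y \<in> C})"
  proof (subst un, rule sum.UNION_disjoint[OF finQ])
    show "\<forall>C\<in>?Q. finite {y\<in>sells D. sell y \<in> C}" using fin by simp
    show "\<forall>C\<in>?Q. \<forall>C'\<in>?Q. C \<noteq> C' \<longrightarrow> {y\<in>sells D. sell y \<in> C} \<inter> {y\<in>sells D. sell y \<in> C'} = {}"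
      using quotient_disj[OF eq] by blast
  qed
  then have "of_int (taus D) = (\<Sum>C\<in>?Q. of_int (sum sell_wt3 {y\<in>sells D. sell y \<in> C}) :: rat)"
    by (simp add: taus_sells)
  also have "\<dots> = (\<Sum>C\<in>?Q. 6 * class_weight C)" by (rule sum.cong[OF refl]) (rule class_sum[OF D])
  also have "\<dots> = 6 * H D" using D False by (simp add: H_def sum_distrib_left)
  finally show ?thesis by simp
qed

text \<open>Both claims reduce to \<open>2 * tau D - 4 * taus D\<close>: the second by
  \<open>H D\<close> and \<open>H (4 * D)\<close> directly, the first because
  \<open>tau_four\<close> expresses \<open>H (16 * D)\<close> by the same two counts.\<close>

theorem H2_r3:
  assumes D: "D > 0"
  shows "12 * H2 (4 * D) = of_nat (r3 D)"
    and "D mod 4 \<in> {0, 3} \<Longrightarrow> 12 * H2 D = of_nat (r3 D)"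
proof -
  have r: "int (r3 D) = 2 * tau D - 4 * taus D" using sell_sum_eq_r3[of D] sell_sum_tau[OF D] by simp
  have r': "of_nat (r3 D) = (2 * of_int (tau D) - 4 * of_int (taus D) :: rat)"
    using arg_cong[OF r, of "of_int :: int \<Rightarrow> rat"] by simp
  have h1: "6 * H D = of_int (taus D)" using H_taus[OF D] .
  have h4: "6 * H (4 * D) = of_int (tau D)" using H_taus[of "4 * D"] taus_four[OF D] D by simp
  have h16: "6 * H (4 * (4 * D)) = of_int (tau (4 * D))" using H_taus[of "4 * (4 * D)"] taus_four[of "4 * D"] D by simp
  have t4: "of_int (tau (4 * D)) = (3 * of_int (tau D) - 2 * of_int (taus D) :: rat)"
    using arg_cong[OF tau_four[OF D], of "of_int :: int \<Rightarrow> rat"] by simp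
  have "H2 (4 * D) = H (4 * (4 * D)) - 2 * H (4 * D)" by (simp add: H2_def)
  then show "12 * H2 (4 * D) = of_nat (r3 D)" using h4 h16 t4 r' by (simp add: algebra_simps)
  assume "D mod 4 \<in> {0, 3}"
  then have "H2 D = H (4 * D) - 2 * H D" by (simp add: H2_def)
  then show "12 * H2 D = of_nat (r3 D)" using h1 h4 r' by (simp add: algebra_simps)
qed

section \<open>Orbits of the hyperoctahedral group\<close>

lemma OZ4_carrier_facts:
  shows "\<And>g. g \<in> carrier OZ4 \<Longrightarrow> bij g"
    and "\<And>g u v. g \<in> carrier OZ4 \<Longrightarrow> ip (g u) (g v) = ip u v"
    and "(\<lambda>x. x) \<in> carrier OZ4"
    and "\<And>g h. g \<in> carrier OZ4 \<Longrightarrow> h \<in> carrier OZ4 \<Longrightarrow> (\<lambda>x. g (h x)) \<in> carrier OZ4"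
    and "\<And>g. g \<in> carrier OZ4 \<Longrightarrow> inv_into UNIV g \<in> carrier OZ4"
proof -
  let ?G = "BijGroup (UNIV :: (int ^ 4) set)" and ?H = "coord_perms \<union> sign_changes"
  interpret G: group ?G by (rule group_BijGroup)
  have Bij: "f \<in> Bij (UNIV :: (int ^ 4) set) \<longleftrightarrow> bij f" for f by (simp add: Bij_def)
  have mult: "g \<otimes>\<^bsub>?G\<^esub> h = (\<lambda>x. g (h x))" if "bij g" "bij h" for g h :: "int ^ 4 \<Rightarrow> int ^ 4"
    using that by (simp add: BijGroup_def Bij compose_def restrict_def)
  have perm: "bij h \<and> (\<forall>u v. ip (h u) (h v) = ip u v)" if hh: "h \<in> coord_perms" for h
  proof -
    obtain \<pi> where \<pi>: "bij \<pi>" and h: "h = (\<lambda>v. \<chi> i. v $ \<pi> i)" using hh unfolding coord_perms_def by blast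
    have "bij h"
      by (rule bij_betw_byWitness[where f' = "\<lambda>v. \<chi> i. v $ inv_into UNIV \<pi> i"])
        (use \<pi> in \<open>auto simp: h vec_eq_iff bij_is_inj bij_is_surj surj_f_inv_f inv_f_f\<close>)
    moreover have "ip (h u) (h v) = ip u v" for u v
      unfolding ip_def h using sum.reindex_bij_betw[OF \<pi>, of "\<lambda>i. u $ i * v $ i"] by simp
    ultimately show ?thesis by simp
  qed
  have sign: "bij h \<and> (\<forall>u v. ip (h u) (h v) = ip u v)" if hh: "h \<in> sign_changes" for h
  proof -
    obtain \<epsilon> where \<epsilon>: "\<forall>i. \<epsilon> i \<in> {1, -1}" and h: "h = (\<lambda>v. \<chi> i. \<epsilon> i * v $ i)"
      using hh unfolding sign_changes_def by blast
    have e: "\<epsilon> i * (\<epsilon> i * x) = x" "\<epsilon> i * x * (\<epsilon> i * y) = x * y" for i x y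
      using spec[OF \<epsilon>, of i] by auto
    have "bij h" by (rule bij_betw_byWitness[where f' = h]) (auto simp: h vec_eq_iff e)
    moreover have "ip (h u) (h v) = ip u v" for u v unfolding ip_def h by (simp add: e)
    ultimately show ?thesis by simp
  qed
  have H: "bij h \<and> (\<forall>u v. ip (h u) (h v) = ip u v)" if "h \<in> ?H" for h using that perm sign by blast
  have Hsub: "?H \<subseteq> carrier ?G" using H by (auto simp: BijGroup_def Bij)
  have inv: "inv\<^bsub>?G\<^esub> g = inv_into UNIV g" if "bij g" for g
    using inv_BijGroup[of g UNIV] that by (simp add: Bij restrict_def)
  have carr: "carrier OZ4 = generate ?G ?H" by (simp add: OZ4_def)
  have bij: "bij g" if "g \<in> generate ?G ?H" for g
    using G.generate_in_carrier[OF Hsub that] by (simp add: BijGroup_def Bij)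
  then show "\<And>g. g \<in> carrier OZ4 \<Longrightarrow> bij g" by (simp add: carr)
  show "(\<lambda>x. x) \<in> carrier OZ4"
    using generate.one[of ?G ?H] by (simp add: carr BijGroup_def restrict_def)
  show "(\<lambda>x. g (h x)) \<in> carrier OZ4" if "g \<in> carrier OZ4" "h \<in> carrier OZ4" for g h
    using generate.eng[of g ?G ?H h] that bij by (simp add: carr mult)
  show "inv_into UNIV g \<in> carrier OZ4" if "g \<in> carrier OZ4" for g
    using G.generate_m_inv_closed[OF Hsub, of g] that bij inv by (simp add: carr)
  have "\<forall>u v. ip (g u) (g v) = ip u v" if "g \<in> generate ?G ?H" for g
    using that
  proof (induction rule: generate.induct)
    case one
    then show ?case by (simp add: BijGroup_def)
  next
    case (incl h)
    then show ?case using H by blast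
  next
    case (inv h)
    have h: "bij h" "\<And>u v. ip (h u) (h v) = ip u v" using H[OF inv] by auto
    have "ip (inv_into UNIV h u) (inv_into UNIV h v) = ip u v" for u v
      using h(2)[of "inv_into UNIV h u" "inv_into UNIV h v"] h(1)
      by (simp add: bij_is_surj surj_f_inv_f)
    then show ?case using inv_BijGroup[of h UNIV] h(1) by (simp add: Bij restrict_def)
  next
    case (eng g h)
    then show ?case using mult bij by simp
  qed
  then show "\<And>g u v. g \<in> carrier OZ4 \<Longrightarrow> ip (g u) (g v) = ip u v" by (simp add: carr)
qed

lemma OZ4_orbit_eq: "OZ4_orbit v = {g v | g. g \<in> carrier OZ4}"
  by (simp add: orbit_def)

lemma OZ4_orbit_self: "v \<in> OZ4_orbit v"
  unfolding OZ4_orbit_eq using OZ4_carrier_facts(3) by force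

lemma OZ4_orbit_eqI:
  assumes "w \<in> OZ4_orbit v"
  shows "OZ4_orbit w = OZ4_orbit v"
proof -
  obtain g where g: "g \<in> carrier OZ4" "w = g v" using assms by (auto simp: OZ4_orbit_eq)
  have "inv_into UNIV g w = v" using OZ4_carrier_facts(1)[OF g(1)] by (simp add: g bij_is_inj inv_f_f)
  then have v: "h v = h (inv_into UNIV g w)" for h :: "int ^ 4 \<Rightarrow> int ^ 4" by simp
  show ?thesis unfolding OZ4_orbit_eq
  proof (intro equalityI subsetI)
    fix x assume "x \<in> {h w | h. h \<in> carrier OZ4}"
    then obtain h where h: "h \<in> carrier OZ4" "x = h (g v)" using g(2) by blast
    then show "x \<in> {h v | h. h \<in> carrier OZ4}" using OZ4_carrier_facts(4)[OF h(1) g(1)] h(2)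
      by (intro CollectI exI[of _ "\<lambda>x. h (g x)"]) simp
  next
    fix x assume "x \<in> {h v | h. h \<in> carrier OZ4}"
    then obtain h where h: "h \<in> carrier OZ4" "x = h (inv_into UNIV g w)" using v by auto
    then show "x \<in> {h w | h. h \<in> carrier OZ4}"
      using OZ4_carrier_facts(4)[OF h(1) OZ4_carrier_facts(5)[OF g(1)]] h(2)
      by (intro CollectI exI[of _ "\<lambda>x. h (inv_into UNIV g x)"]) simp
  qed
qed

lemma rho_orbit:
  assumes "w \<in> OZ4_orbit v"
  shows "rho w n r = rho v n r"
proof -
  obtain g where g: "g \<in> carrier OZ4" "w = g v" using assms by (auto simp: OZ4_orbit_eq)
  note ip = OZ4_carrier_facts(2)[OF g(1)]
  have surj: "surj g" "inj g" using OZ4_carrier_facts(1)[OF g(1)] by (auto simp: bij_def)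
  have "{u. ip u u = int n \<and> ip w u = r} = g ` {u. ip u u = int n \<and> ip v u = r}"
  proof (intro equalityI subsetI)
    fix u assume u: "u \<in> {u. ip u u = int n \<and> ip w u = r}"
    obtain x where "u = g x" using surj by (metis surjD)
    then show "u \<in> g ` {u. ip u u = int n \<and> ip v u = r}" using u g ip by auto
  qed (use g ip in auto)
  then show ?thesis unfolding rho_def using surj(2) by (simp add: card_image inj_on_subset)
qed

text \<open>The quaternion with coordinates \<open>v\<close>, written in the basis
  \<open>\<omega>, i, j, k\<close>.\<close>

definition hur_of :: "int ^ 4 \<Rightarrow> hur" where
  "hur_of v = Hur (2 * v $ 1) (v $ 2 - v $ 1) (v $ 3 - v $ 1) (v $ 4 - v $ 1)"

lemma hN_hur_of: "hN (hur_of v) = ip v v"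
  by (simp add: hN_def hur_of_def ip_def sum_4 power2_eq_square algebra_simps)

lemma ha_hur_of: "ha (hur_of u * hconj (hur_of v)) = 2 * ip u v"
  by (simp add: hur_mult_sel hur_of_def ip_def sum_4 algebra_simps)

lemma bij_hur_of: "bij_betw hur_of UNIV lip"
proof (rule bij_betwI')
  fix u v :: "int ^ 4"
  show "hur_of u = hur_of v \<longleftrightarrow> u = v"
    by (auto simp: hur_of_def vec_eq_iff forall_4)
next
  fix x assume "x \<in> lip"
  then obtain a where a: "ha x = 2 * a" by (auto simp: lip_def)
  define v :: "int ^ 4" where "v = (\<chi> i. if i = 1 then a else if i = 2 then hb x + a else if i = 3 then hc x + a else hd x + a)"
  have "x = hur_of v" by (simp add: hur_of_def v_def hur_eq_iff a)
  then show "\<exists>v\<in>UNIV. x = hur_of v" by blast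
qed (simp add: lip_def hur_of_def)

lemma hconj_inject [simp]: "hconj x = hconj y \<longleftrightarrow> x = y"
  by (metis hconj_hconj)

text \<open>The inner product of two vectors is the real part of one times the conjugate of the
  other.\<close>

lemma card_gram_pairs:
  "card {(u, w). ip u u = n \<and> ip w w = m \<and> ip u w = r} = card (lip_pairs n m r)"
proof -
  have inj: "inj hur_of" and im: "range hur_of = lip" using bij_hur_of by (auto simp: bij_betw_def)
  have "bij_betw (\<lambda>(u, w). (hur_of u, hconj (hur_of w))) {(u, w). ip u u = n \<and> ip w w = m \<and> ip u w = r} (lip_pairs n m r)"
  proof (rule bij_betwI')
    fix a b :: "(int ^ 4) \<times> (int ^ 4)"
    show "((case a of (u, w) \<Rightarrow> (hur_of u, hconj (hur_of w))) = (case b of (u, w) \<Rightarrow> (hur_of u, hconj (hur_of w)))) = (a = b)"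
      using inj by (cases a; cases b) (auto dest: injD)
  next
    fix a :: "(int ^ 4) \<times> (int ^ 4)" assume "a \<in> {(u, w). ip u u = n \<and> ip w w = m \<and> ip u w = r}"
    then show "(case a of (u, w) \<Rightarrow> (hur_of u, hconj (hur_of w))) \<in> lip_pairs n m r"
      using im by (auto simp: lip_pairs_def hpairs_def hN_hur_of ha_hur_of)
  next
    fix b assume "b \<in> lip_pairs n m r"
    then obtain x z where b: "b = (x, z)" "hN x = n" "hN z = m" "ha (x * z) = 2 * r" "x \<in> lip" "hconj z \<in> lip"
      by (auto simp: lip_pairs_def hpairs_def)
    obtain u w where uw: "x = hur_of u" "hconj z = hur_of w" using b(5,6) im by blast
    have z: "z = hconj (hur_of w)" using uw(2) by (metis hconj_hconj)
    show "\<exists>a\<in>{(u, w). ip u u = n \<and> ip w w = m \<and> ip u w = r}. b = (case a of (u, w) \<Rightarrow> (hur_of u, hconj (hur_of w)))"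
      using b(2-4) by (intro bexI[of _ "(u, w)"]) (auto simp: b(1) uw(1) z hN_hur_of ha_hur_of)
  qed
  then show ?thesis by (rule bij_betw_same_card)
qed

lemma ip_commute: "ip u v = ip v u"
  by (simp add: ip_def mult.commute)

lemma finite_ip_eq: "finite {v. ip v v = n}"
proof -
  have "inj hur_of" using bij_hur_of by (auto simp: bij_betw_def)
  then have "finite (hur_of -` {x. hN x = n})" using finite_hN by (rule finite_vimageI[rotated])
  then show ?thesis by (simp add: vimage_def hN_hur_of)
qed

lemma sum_over_orbits:
  assumes orbs: "bij_betw (\<lambda>j. OZ4_orbit (v j)) {1..t} (OZ4_orbits m)"
  shows "(\<Sum>j=1..t. card (OZ4_orbit (v j)) * rho (v j) n r) =
    card {(u, w). ip u u = int n \<and> ip w w = int m \<and> ip u w = r}"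
proof -
  have finS: "finite (S m)" unfolding S_def by (rule finite_ip_eq)
  have orb: "OZ4_orbits m = OZ4_orbit ` S m" by (auto simp: orbits_def)
  have sub: "OZ4_orbit x \<subseteq> S m" if "x \<in> S m" for x
    using that OZ4_carrier_facts(2) by (auto simp: OZ4_orbit_eq S_def)
  have un: "S m = (\<Union>X\<in>OZ4_orbits m. X)" unfolding orb using sub OZ4_orbit_self by blast
  have finX: "finite X" if "X \<in> OZ4_orbits m" for X
    using that sub finS finite_subset unfolding orb by blast
  have disj: "X \<inter> Y = {}" if XY: "X \<in> OZ4_orbits m" "Y \<in> OZ4_orbits m" "X \<noteq> Y" for X Y
  proof (rule ccontr)
    assume "X \<inter> Y \<noteq> {}"
    then obtain w where "w \<in> X" "w \<in> Y" by blast
    then show False using XY OZ4_orbit_eqI unfolding orb by blast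
  qed
  have "card {(u, w). ip u u = int n \<and> ip w w = int m \<and> ip u w = r}
     = card (Sigma (S m) (\<lambda>w. {u. ip u u = int n \<and> ip w u = r}))"
    by (rule bij_betw_same_card[of prod.swap], rule bij_betw_byWitness[where f' = prod.swap])
      (auto simp: S_def ip_commute)
  also have "\<dots> = (\<Sum>w\<in>S m. rho w n r)"
    unfolding rho_def using finS finite_ip_eq[of "int n"] by (intro card_SigmaI) auto
  also have "\<dots> = (\<Sum>X\<in>OZ4_orbits m. \<Sum>w\<in>X. rho w n r)"
  proof -
    have "finite (OZ4_orbits m)" unfolding orb using finS by simp
    then have "sum f (\<Union>X\<in>OZ4_orbits m. X) = (\<Sum>X\<in>OZ4_orbits m. sum f X)" for f :: "int ^ 4 \<Rightarrow> nat"
      using finX disj by (intro sum.UNION_disjoint) blast+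
    then show ?thesis using arg_cong[OF un, of "sum (\<lambda>w. rho w n r)"] by simp
  qed
  also have "\<dots> = (\<Sum>j\<in>{1..t}. \<Sum>w\<in>OZ4_orbit (v j). rho w n r)"
    by (rule sum.reindex_bij_betw[OF orbs, symmetric])
  also have "\<dots> = (\<Sum>j=1..t. card (OZ4_orbit (v j)) * rho (v j) n r)"
    by (rule sum.cong[OF refl]) (simp add: rho_orbit)
  finally show ?thesis by simp
qed

section \<open>Class numbers against three squares, and the comparison of both sides\<close>

text \<open>At \<open>k = 0\<close> the convention \<open>H 0 = - 1 / 12\<close> gives
  \<open>12 * H2 0 = 1\<close>, in agreement with \<open>r3 0\<close>.\<close>

lemma H2_four_r3: "12 * H2 (4 * k) = of_nat (r3 k)"
proof -
  consider "k > 0" | "k = 0" | "k < 0" by linarith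
  then show ?thesis
  proof cases
    case 1
    then show ?thesis by (rule H2_r3)
  qed (simp_all add: r3_0 r3_neg H2_def H_def)
qed

lemma H2_r3_all:
  assumes "k mod 4 \<in> {0, 3}"
  shows "12 * H2 k = of_nat (r3 k)"
proof -
  consider "k > 0" | "k = 0" | "k < 0" by linarith
  then show ?thesis
  proof cases
    case 1
    then show ?thesis using assms by (rule H2_r3)
  qed (simp_all add: r3_0 r3_neg H2_def H_def)
qed

theorem theorem1p8:
  fixes m n t :: nat and r :: int and v :: "nat \<Rightarrow> int ^ 4"
  assumes n_pos: "n > 0"
    and reps: "\<forall>j\<in>{1..t}. v j \<in> S m"
    and orbs: "bij_betw (\<lambda>j. OZ4_orbit (v j)) {1..t} (OZ4_orbits m)"
  shows "of_nat (\<Sum>j=1..t. card (OZ4_orbit (v j)) * rho (v j) n r) =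
      (if even n \<and> even m then
         96 * ((\<Sum>d\<in>odd_divs n r m.
                  of_nat d * H2 ((4 * (int n * int m - r ^ 2)) div (int d) ^ 2))
             + 2 * (\<Sum>d\<in>odd_divs n r m.
                  of_nat d * H2 ((int n * int m - r ^ 2) div (int d) ^ 2)))
       else
         96 * (\<Sum>d\<in>odd_divs n r m.
                  of_nat d * H2 ((4 * (int n * int m - r ^ 2)) div (int d) ^ 2)))
    \<and> (\<Sum>j=1..t. card (OZ4_orbit (v j)) * rho (v j) n r) =
        card {(u, w). ip u u = int n \<and> ip w w = int m \<and> ip u w = r}"
proof
  let ?D = "int n * int m - r\<^sup>2"
  let ?A = "\<Sum>d\<in>odd_divs n r m. of_nat d * H2 ((4 * ?D) div (int d)\<^sup>2)"
  let ?B = "\<Sum>d\<in>odd_divs n r m. of_nat d * H2 (?D div (int d)\<^sup>2)"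
  define R :: rat where "R = (\<Sum>d\<in>odd_divs n r m. of_nat d * of_nat (r3 (?D div (int d)\<^sup>2)))"
  have dvd: "(int d)\<^sup>2 dvd ?D" if "d \<in> odd_divs n r m" for d
  proof -
    have "int d dvd int n" "int d dvd int m" "int d dvd r" using that by (auto simp: odd_divs_def)
    then show ?thesis unfolding power2_eq_square by (intro dvd_diff mult_dvd_mono)
  qed
  have A: "12 * ?A = R"
    unfolding sum_distrib_left R_def
  proof (rule sum.cong[OF refl])
    fix d assume "d \<in> odd_divs n r m"
    then have "(4 * ?D) div (int d)\<^sup>2 = 4 * (?D div (int d)\<^sup>2)" using dvd by (simp add: div_mult_swap)
    then show "12 * (of_nat d * H2 ((4 * ?D) div (int d)\<^sup>2)) = of_nat d * of_nat (r3 (?D div (int d)\<^sup>2))"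
      using H2_four_r3[of "?D div (int d)\<^sup>2"] by simp
  qed
  \<comment> \<open>For even \<open>n\<close> and \<open>m\<close>, \<open>?D\<close> is congruent
    to \<open>- r^2\<close> modulo 4, and division by the odd square \<open>d^2\<close> preserves
    this; the quotient is therefore 0 or 3 modulo 4, as \<open>H2_r3_all\<close> requires.\<close>
  have B: "12 * ?B = R" if "even n" "even m"
    unfolding sum_distrib_left R_def
  proof (rule sum.cong[OF refl])
    fix d assume d: "d \<in> odd_divs n r m"
    obtain k where k: "?D = (int d)\<^sup>2 * k" using dvd[OF d] by auto
    have "odd (int d)" "d > 0" using d by (auto simp: odd_divs_def)
    then have kd: "?D div (int d)\<^sup>2 = k" using k by simp
    obtain e where e: "int d = 2 * e + 1" using \<open>odd (int d)\<close> by (auto elim: oddE)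
    have "even (int n)" "even (int m)" using that by simp_all
    then obtain n' m' where nm: "int n = 2 * n'" "int m = 2 * m'" by (elim evenE)
    have "4 * (n' * m') - r\<^sup>2 = (2 * e + 1)\<^sup>2 * k" using k unfolding e nm by simp
    then have k1: "k = 4 * (n' * m' - (e\<^sup>2 + e) * k) - r\<^sup>2" by (simp add: power2_eq_square algebra_simps)
    have sq: "r\<^sup>2 mod 4 = 0 \<or> r\<^sup>2 mod 4 = 1"
    proof (cases "even r")
      case True then obtain s where "r = 2 * s" by auto
      then have "r\<^sup>2 = 4 * s\<^sup>2" by (simp add: power2_eq_square)
      then show ?thesis by simp
    next
      case False then obtain s where "r = 2 * s + 1" by (auto elim: oddE)
      then have "r\<^sup>2 = 4 * (s\<^sup>2 + s) + 1" by (simp add: power2_eq_square algebra_simps)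
      then show ?thesis by presburger
    qed
    have gen: "(4 * y - x) mod 4 \<in> {0, 3}" if "x mod 4 = 0 \<or> x mod 4 = 1" for x y :: int
      using that by (simp, presburger)
    have "(4 * (n' * m' - (e\<^sup>2 + e) * k) - r\<^sup>2) mod 4 \<in> {0, 3}" by (rule gen[OF sq])
    then have "k mod 4 \<in> {0, 3}" by (simp only: k1[symmetric])
    then show "12 * (of_nat d * H2 (?D div (int d)\<^sup>2)) = of_nat d * of_nat (r3 (?D div (int d)\<^sup>2))"
      using H2_r3_all[of k] unfolding kd by simp
  qed
  have "(\<Sum>d\<in>odd_cdivs (int n) r (int m). d * int (r3 (?D div d\<^sup>2))) =
     (\<Sum>d\<in>odd_divs n r m. int d * int (r3 (?D div (int d)\<^sup>2)))"
    by (rule sum.reindex_bij_witness[of _ int nat]) (auto simp: odd_cdivs_def odd_divs_def nat_dvd_iff even_nat_iff)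
  then have "int (card {(u, w). ip u u = int n \<and> ip w w = int m \<and> ip u w = r}) =
     (if even n \<and> even m then 24 else 8) * (\<Sum>d\<in>odd_divs n r m. int d * int (r3 (?D div (int d)\<^sup>2)))"
    using card_lip_pairs[of "int n" "int m" r] n_pos by (simp add: card_gram_pairs)
  from arg_cong[OF this, of "of_int :: int \<Rightarrow> rat"]
  have "of_nat (card {(u, w). ip u u = int n \<and> ip w w = int m \<and> ip u w = r}) = (if even n \<and> even m then 24 else 8) * R"
    by (simp add: R_def)
  \<comment> \<open>By \<open>A\<close> the expression \<open>96 * ?A\<close> is
    \<open>8 * R\<close>; if \<open>n\<close> and \<open>m\<close> are even, then by
    \<open>B\<close> also \<open>96 * (?A + 2 * ?B)\<close> is \<open>24 * R\<close>.\<close>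
  then show "of_nat (\<Sum>j=1..t. card (OZ4_orbit (v j)) * rho (v j) n r) =
      (if even n \<and> even m then 96 * (?A + 2 * ?B) else 96 * ?A)"
    unfolding sum_over_orbits[OF orbs] using A B by (auto simp: algebra_simps)
  show "(\<Sum>j=1..t. card (OZ4_orbit (v j)) * rho (v j) n r) =
        card {(u, w). ip u u = int n \<and> ip w w = int m \<and> ip u w = r}"
    by (rule sum_over_orbits[OF orbs])
qed

end
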